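(* Let $M$ be an oriented, finite volume, $1$-cusped hyperbolic $3$-manifold, and let $K$ be a topological ideal triangulation of $M$ with edges $e_1,\dots,e_n$. Let $\rho:\pi_1(M,* )\to\mathrm{PSL}_2\mathbb{C}$ be a representation on which $\mathit{Orth}_K$ is defined (i.e. for which, with $m,l$ any pair of generators of $\pi_1(\partial N,* )$, neither $\mathrm{tr}^2\rho(m)=\mathrm{tr}^2\rho(l)=4$ nor $\mathrm{tr}^2\rho(m)=\mathrm{tr}^2\rho(l)=\mathrm{tr}^2\rho(ml)=0$). Let $\beta\in\pi_1(\partial N,* )$ be non-trivial, and for $i=1,\dots,n$ let $\alpha_i\notin\pi_1(\partial N,* )$ be the loop lying in $\partial N\cup e_i$ which is the generator corresponding to the edge $e_i$ in the presentation of $\pi_1(M,* )$ based on $K$. For $i=1,\dots,n$ let $\tilde h,\tilde g_i\in\mathrm{SL}_2\mathbb{C}$ be matrices which cover $\rho(\beta),\rho(\alpha_i)\in\mathrm{PSL}_2\mathbb{C}$. Then the $i$-th coordinate $\cosh d_i$ of $\mathit{Orth}_K(\rho)\in\mathcal{P}(K)\subseteq\mathbb{C}^n$ is $$\cosh d_i = 2\,\frac{\mathrm{tr}(\tilde h\tilde g_i)\,\mathrm{tr}(\tilde h^{-1}\tilde g_i)-\mathrm{tr}^2\tilde g_i}{\mathrm{tr}^2\tilde h-4}-1$$ where $i=1,\dots,n$.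
   Context: **Lines.** An oriented line in hyperbolic 3-space $\mathbb{H}^3$ is identified with its ordered pair of end-points $(p,q)\in\mathbb{S}^2_\infty\times\mathbb{S}^2_\infty$, $p\neq q$, where $\mathbb{S}^2_\infty=\mathbb{CP}^1$ is the sphere at infinity, and also with the matrix $l\in \mathrm{SL}_2\mathbb{C}$ with $\mathrm{tr}\, l=0$ whose $(-i)$-eigenspace is $p$ and whose $i$-eigenspace is $q$; so $-l$ is the same line with opposite orientation. $\mathrm{PSL}_2\mathbb{C}$ acts on oriented lines by $g\cdot l=\tilde g l\tilde g^{-1}$ ($\tilde g\in\mathrm{SL}_2\mathbb{C}$ a matrix covering $g$). Put $\langle l,m\rangle=-\frac12\mathrm{tr}(lm)$. The complex distance $d_{\mathbb{C}}(l,m)$ between oriented lines (hyperbolic distance plus $i$ times an angle of twist) satisfies $\cosh d_{\mathbb{C}}(l,m)=\langle l,m\rangle$. **Topological set-up.** $N\subset M$ is an embedded horoball neighbourhood of the cusp, $N\cong T^2\times[0,1)$ with $T^2$ a 2-torus, and $*\in\partial N$ is a base-point for $M$. $K$ is a topological ideal triangulation of $M$ with $n$ edges $e_1,\dots,e_n$, meeting $N$ nicely (inside each tetrahedron, $N$ has four connected components, each a punctured neighbourhood of one of the vertices). The presentation of $\pi_1(M,* )$ based on $K$ has as generators generators for $\pi_1(\partial N,* )$ together with loops $\alpha_i\notin\pi_1(\partial N,* )$ which lie in $\partial N\cup e_i$ ($i=1,\dots,n$). $\pi:\widetilde M\to M$ is the universal cover with base-point $\tilde *\in\pi^{-1}(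 * )$, identifying deck-transformations with $\pi_1(M,* )$; $\widetilde N$ is the connected component of $\pi^{-1}(N)$ containing $\tilde *$. **Ortholength invariant.** $\mathit{Orth}_K$ is defined on a homomorphism $\rho:\pi_1(M,* )\to\mathrm{PSL}_2\mathbb{C}$ when $\rho(\pi_1(\partial N,* ))$ fixes exactly two points of $\mathbb{S}^2_\infty$; this is equivalent to the trace conditions in the claim. Let $\sigma$ be the line with these two end-points, with some choice of orientation. For each $i$ choose a lift $\tilde e_i$ of $e_i$ to $\widetilde M$; its two ends correspond to components $\gamma_1(\widetilde N)$, $\gamma_2(\widetilde N)$ of $\pi^{-1}(N)$ for deck-transformations $\gamma_1,\gamma_2$. Define $d_i=d_{\mathbb{C}}(\rho(\gamma_1)\cdot\sigma,\rho(\gamma_2)\cdot\sigma)$ and $\mathit{Orth}_K(\rho)=(\cosh d_1,\dots,\cosh d_n)\in\mathbb{C}^n$; this is independent of the choices and depends only on the conjugacy class of $\rho$. **$\mathcal{P}(K)$.** The ortholength space $\mathcal{P}(K)\subseteq\mathbb{C}^n$ (one coordinate per edge $e_i$) is the complex affine algebraic variety cut out by one hextet equation per tetrahedron $\triangle$ of $K$: numbering the vertices of $\triangle$ from $1$ to $4$ and writing $x_{ab}=x_{ba}$ for the coordinate of the edge of $\triangle$ between vertices $a$ and $b$, and $x_{aa}=1$, the equation is $\det[x_{ab}]_{a,b=1}^4=0$. It contains all values of $\mathit{Orth}_K$.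
   Formalization: The formal statement also assumes tr²h̃ ≠ 4, i.e. that ρ(β) is non-trivial: a non-trivial β may have ρ(β) = 1 (e.g. when ρ factors through a Dehn filling killing β), and then the displayed quotient is 0/0. *)

theory Defs
  imports "HOL-Analysis.Analysis" "HOL-Algebra.Coset" "HOL-Algebra.Generated_Groups"
begin

section \<open>The group PSL(2,C) and its actions\<close>

type_synonym mat2 = "complex^2^2"

definition SL2 :: "mat2 monoid" where
  "SL2 = \<lparr>carrier = {A. det A = 1}, mult = (**), one = mat 1\<rparr>"

text \<open>The elements of \<open>PSL2\<close> are the cosets \<open>{A, - A}\<close>, so that ``the matrix \<open>A\<close> covers \<open>P\<close>''
  is \<open>A \<in> P\<close>.\<close>

definition PSL2 :: "mat2 set monoid" where
  "PSL2 = SL2 Mod {mat 1, - mat 1}"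

text \<open>The value on \<open>P = {A, - A}\<close> of a function \<open>f\<close> of matrices with \<open>f (- A) = f A\<close>.\<close>

definition psl_lift :: "(mat2 \<Rightarrow> 'b) \<Rightarrow> mat2 set \<Rightarrow> 'b" where
  "psl_lift f P = the_elem (f ` P)"

definition psl_trace_sq :: "mat2 set \<Rightarrow> complex" where
  "psl_trace_sq = psl_lift (\<lambda>A. (trace A)\<^sup>2)"

text \<open>The sphere at infinity, as the set of one-dimensional subspaces of \<open>\<complex>\<^sup>2\<close>.\<close>

definition CP1 :: "(complex^2) set set" where
  "CP1 = {vec.span {u} |u. u \<noteq> 0}"

definition CP1_infinity :: "(complex^2) set" where
  "CP1_infinity = vec.span {axis 1 1}"

definition CP1_act :: "mat2 \<Rightarrow> (complex^2) set \<Rightarrow> (complex^2) set" where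
  "CP1_act A p = (*v) A ` p"

definition psl_CP1_act :: "mat2 set \<Rightarrow> (complex^2) set \<Rightarrow> (complex^2) set" where
  "psl_CP1_act P p = psl_lift (\<lambda>A. CP1_act A p) P"

text \<open>The upper half-space model, whose points are pairs \<open>(z, t)\<close> with \<open>t > 0\<close>, and the
  Poincare extension to it of the Moebius transformation given by a matrix in \<open>SL2\<close>.\<close>

definition H3 :: "(complex \<times> real) set" where
  "H3 = {x. snd x > 0}"

definition H3_act :: "mat2 \<Rightarrow> complex \<times> real \<Rightarrow> complex \<times> real" where
  "H3_act A x =
    (let a = A$1$1; b = A$1$2; c = A$2$1; d = A$2$2; z = fst x; t = snd x;
         D = (cmod (c * z + d))\<^sup>2 + (cmod c)\<^sup>2 * t\<^sup>2
     in (((a * z + b) * cnj (c * z + d) + a * cnj c * of_real (t\<^sup>2)) / of_real D, t / D))"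

definition psl_H3_act :: "mat2 set \<Rightarrow> complex \<times> real \<Rightarrow> complex \<times> real" where
  "psl_H3_act P x = psl_lift (\<lambda>A. H3_act A x) P"

section \<open>Oriented lines and complex distance\<close>

definition oriented_lines :: "mat2 set" where
  "oriented_lines = {l. det l = 1 \<and> trace l = 0}"

definition line_start :: "mat2 \<Rightarrow> (complex^2) set" where
  "line_start l = {v. l *v v = (- \<i>) *s v}"

definition line_end :: "mat2 \<Rightarrow> (complex^2) set" where
  "line_end l = {v. l *v v = \<i> *s v}"

definition line_act :: "mat2 \<Rightarrow> mat2 \<Rightarrow> mat2" where
  "line_act A l = A ** l ** matrix_inv A"

definition psl_line_act :: "mat2 set \<Rightarrow> mat2 \<Rightarrow> mat2" where
  "psl_line_act P l = psl_lift (\<lambda>A. line_act A l) P"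

text \<open>The oriented line from \<open>-1\<close> to \<open>1\<close>, which meets the line from \<open>0\<close> to \<open>\<infinity>\<close> orthogonally.\<close>

definition base_line :: mat2 where
  "base_line = vector [vector [0, \<i>], vector [\<i>, 0]]"

text \<open>The isometry \<open>z \<mapsto> exp \<delta> z\<close>: translation by \<open>Re \<delta>\<close> along the line from \<open>0\<close> to \<open>\<infinity>\<close>,
  composed with rotation by \<open>Im \<delta>\<close> about it.\<close>

definition screw_motion :: "complex \<Rightarrow> mat2" where
  "screw_motion \<delta> = vector [vector [exp (\<delta> / 2), 0], vector [0, exp (- \<delta> / 2)]]"

text \<open>\<open>\<delta>\<close> is a complex distance from \<open>l\<close> to \<open>m\<close> if \<open>l\<close> and \<open>m\<close> have a common perpendicular along
  which a screw motion with translation length \<open>Re \<delta> \<ge> 0\<close> (the hyperbolic distance) and angle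
  \<open>Im \<delta>\<close> (the twist) carries \<open>l\<close> to \<open>m\<close>; the common perpendicular is moved to the line from
  \<open>0\<close> to \<open>\<infinity>\<close>. Lines sharing an end-point have distance \<open>0\<close>, and angle \<open>0\<close> or \<open>pi\<close>
  according to whether their orientations agree or disagree at the common end-point; if they share
  exactly one end-point there is no common perpendicular. The imaginary part is only determined
  modulo \<open>2 pi\<close>, and \<open>\<delta>\<close> up to sign if \<open>Re \<delta> = 0\<close>, so this is a relation.\<close>

definition is_complex_distance :: "mat2 \<Rightarrow> mat2 \<Rightarrow> complex \<Rightarrow> bool" where
  "is_complex_distance l m \<delta> \<longleftrightarrow>
     (Re \<delta> \<ge> 0 \<and>
       (\<exists>A \<in> carrier SL2. line_act A l = base_line \<and>
          line_act A m = line_act (screw_motion \<delta>) base_line)) \<or>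
     ((line_start l = line_start m \<or> line_end l = line_end m) \<and> \<delta> = 0) \<or>
     ((line_start l = line_end m \<or> line_end l = line_start m) \<and> \<delta> = \<i> * of_real pi)"

section \<open>Fundamental groups\<close>

definition loop_class :: "'m::topological_space set \<Rightarrow> (real \<Rightarrow> 'm) \<Rightarrow> (real \<Rightarrow> 'm) set" where
  "loop_class M p = {q. homotopic_paths M p q}"

definition fundamental_group :: "'m::topological_space set \<Rightarrow> 'm \<Rightarrow> (real \<Rightarrow> 'm) set monoid" where
  "fundamental_group M x =
    \<lparr>carrier = {loop_class M p |p.
        path p \<and> path_image p \<subseteq> M \<and> pathstart p = x \<and> pathfinish p = x},
     mult = (\<lambda>a b. \<Union>p\<in>a. \<Union>q\<in>b. loop_class M (p +++ q)),
     one = loop_class M (\<lambda>_. x)\<rparr>"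

text \<open>The image in the fundamental group of \<open>M\<close> of that of a subspace \<open>S\<close>.\<close>

definition subspace_loops ::
    "'m::topological_space set \<Rightarrow> 'm set \<Rightarrow> 'm \<Rightarrow> (real \<Rightarrow> 'm) set set" where
  "subspace_loops M S x = {loop_class M p |p.
     path p \<and> path_image p \<subseteq> S \<and> pathstart p = x \<and> pathfinish p = x}"

section \<open>One-cusped hyperbolic manifolds\<close>

text \<open>\<open>M\<close> is a complete oriented hyperbolic 3-manifold: the quotient of \<open>H3\<close> by a discrete group
  \<open>\<Gamma>\<close> of orientation-preserving isometries acting freely, with quotient map \<open>\<pi>\<close>. Thus \<open>\<pi>\<close> is
  the universal cover of \<open>M\<close> and the elements of \<open>\<Gamma>\<close> are its deck-transformations.\<close>

definition hyperbolic_3_manifold ::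
    "mat2 set set \<Rightarrow> (complex \<times> real \<Rightarrow> 'm::topological_space) \<Rightarrow> 'm set \<Rightarrow> bool" where
  "hyperbolic_3_manifold \<Gamma> \<pi> M \<longleftrightarrow>
     subgroup \<Gamma> PSL2 \<and> discrete (\<Union>\<Gamma>) \<and>
     (\<forall>\<gamma>\<in>\<Gamma>. \<forall>x\<in>H3. psl_H3_act \<gamma> x = x \<longrightarrow> \<gamma> = \<one>\<^bsub>PSL2\<^esub>) \<and>
     covering_space H3 \<pi> M \<and>
     (\<forall>x\<in>H3. \<forall>y\<in>H3. \<pi> x = \<pi> y \<longleftrightarrow> (\<exists>\<gamma>\<in>\<Gamma>. y = psl_H3_act \<gamma> x))"

text \<open>The hyperbolic volume element of the upper half-space is \<open>dx dy dt / t\<^sup>3\<close>. The volume of the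
  quotient is finite iff some set of finite volume has translates covering \<open>H3\<close>.\<close>

definition finite_covolume :: "mat2 set set \<Rightarrow> bool" where
  "finite_covolume \<Gamma> \<longleftrightarrow>
     (\<exists>F \<in> sets borel. F \<subseteq> H3 \<and> (\<Union>\<gamma>\<in>\<Gamma>. psl_H3_act \<gamma> ` F) = H3 \<and>
        (\<integral>\<^sup>+ x \<in> F. ennreal (1 / (snd x) ^ 3) \<partial>lborel) < \<infinity>)"

definition parabolic_fixed_points :: "mat2 set set \<Rightarrow> (complex^2) set set" where
  "parabolic_fixed_points \<Gamma> =
     {p \<in> CP1. \<exists>\<gamma>\<in>\<Gamma>. \<gamma> \<noteq> \<one>\<^bsub>PSL2\<^esub> \<and> psl_trace_sq \<gamma> = 4 \<and> psl_CP1_act \<gamma> p = p}"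

text \<open>The cusps of the quotient are the \<open>\<Gamma>\<close>-orbits of parabolic fixed points.\<close>

definition one_cusped :: "mat2 set set \<Rightarrow> bool" where
  "one_cusped \<Gamma> \<longleftrightarrow> parabolic_fixed_points \<Gamma> \<noteq> {} \<and>
     (\<forall>p \<in> parabolic_fixed_points \<Gamma>. \<forall>q \<in> parabolic_fixed_points \<Gamma>.
        \<exists>\<gamma>\<in>\<Gamma>. psl_CP1_act \<gamma> p = q)"

text \<open>Every closed horoball is the image of \<open>{(z, t). t \<ge> 1}\<close> under some matrix \<open>A\<close> in \<open>SL2\<close>.\<close>

definition horoball :: "mat2 \<Rightarrow> (complex \<times> real) set" where
  "horoball A = H3_act A ` {x. snd x \<ge> 1}"

definition horosphere :: "mat2 \<Rightarrow> (complex \<times> real) set" where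
  "horosphere A = H3_act A ` {x. snd x = 1}"

text \<open>The image in the quotient of the horoball of \<open>A\<close> is an embedded horoball neighbourhood
  of a cusp.\<close>

definition cusp_horoball :: "mat2 set set \<Rightarrow> mat2 \<Rightarrow> bool" where
  "cusp_horoball \<Gamma> A \<longleftrightarrow> A \<in> carrier SL2 \<and>
     CP1_act A CP1_infinity \<in> parabolic_fixed_points \<Gamma> \<and>
     (\<forall>\<gamma>\<in>\<Gamma>. psl_H3_act \<gamma> ` horoball A = horoball A \<or>
              psl_H3_act \<gamma> ` horoball A \<inter> horoball A = {})"

section \<open>Topological ideal triangulations\<close>

definition simplex_vertex :: "4 \<Rightarrow> real^4" where
  "simplex_vertex a = axis a 1"

definition ideal_simplex :: "(real^4) set" where
  "ideal_simplex = {x. (\<forall>a. 0 \<le> x $ a) \<and> (\<Sum>a\<in>UNIV. x $ a) = 1} - range simplex_vertex"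

text \<open>\<open>glue (j, a) = (j', s)\<close> means that the face of tetrahedron \<open>j\<close> opposite to its vertex \<open>a\<close> is
  glued to the face of tetrahedron \<open>j'\<close> opposite to its vertex \<open>s a\<close> by the affine map which
  takes each vertex \<open>b \<noteq> a\<close> to \<open>s b\<close>.\<close>

definition face_pairing :: "nat \<Rightarrow> (nat \<times> 4 \<Rightarrow> nat \<times> (4 \<Rightarrow> 4)) \<Rightarrow> bool" where
  "face_pairing k glue \<longleftrightarrow>
     (\<forall>j<k. \<forall>a. case glue (j, a) of (j', s) \<Rightarrow>
        j' < k \<and> bij s \<and> (j', s a) \<noteq> (j, a) \<and> glue (j', s a) = (j, inv_into UNIV s))"

definition glued :: "nat \<Rightarrow> (nat \<times> 4 \<Rightarrow> nat \<times> (4 \<Rightarrow> 4)) \<Rightarrow>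
    nat \<times> (real^4) \<Rightarrow> nat \<times> (real^4) \<Rightarrow> bool" where
  "glued k glue = (\<lambda>(j, x) (j', y).
     j < k \<and> x \<in> ideal_simplex \<and>
     (\<exists>a s. x $ a = 0 \<and> glue (j, a) = (j', s) \<and> (\<forall>b. y $ s b = x $ b)))"

text \<open>A topological ideal triangulation is given by the number \<open>k\<close> of its tetrahedra and their
  characteristic maps \<open>\<Phi> j\<close>, \<open>j < k\<close>; these identify \<open>M\<close> with the quotient of the disjoint
  union of \<open>k\<close> ideal simplices by a pairing of all their faces.\<close>

type_synonym 'm ideal_cells = "nat \<times> (nat \<Rightarrow> real^4 \<Rightarrow> 'm)"

definition ideal_triangulation :: "'m::topological_space set \<Rightarrow> 'm ideal_cells \<Rightarrow> bool" where
  "ideal_triangulation M K \<longleftrightarrow> (case K of (k, \<Phi>) \<Rightarrow>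
     \<exists>glue. face_pairing k glue \<and>
       quotient_map (sum_topology (\<lambda>_. top_of_set ideal_simplex) {..<k}) (top_of_set M)
         (\<lambda>(j, x). \<Phi> j x) \<and>
       (\<forall>j<k. \<forall>j'<k. \<forall>x\<in>ideal_simplex. \<forall>y\<in>ideal_simplex.
          \<Phi> j x = \<Phi> j' y \<longleftrightarrow> (glued k glue)\<^sup>*\<^sup>* (j, x) (j', y)))"

definition edge_path :: "'m ideal_cells \<Rightarrow> nat \<Rightarrow> 4 \<Rightarrow> 4 \<Rightarrow> real \<Rightarrow> 'm" where
  "edge_path K j a b s = snd K j ((1 - s) *\<^sub>R simplex_vertex a + s *\<^sub>R simplex_vertex b)"

definition edge_between :: "'m ideal_cells \<Rightarrow> nat \<Rightarrow> 4 \<Rightarrow> 4 \<Rightarrow> 'm set" where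
  "edge_between K j a b = edge_path K j a b ` {0<..<1}"

definition edges :: "'m ideal_cells \<Rightarrow> 'm set set" where
  "edges K = {edge_between K j a b |j a b. j < fst K \<and> a \<noteq> b}"

text \<open>Inside each tetrahedron, \<open>N\<close> has four components, which are punctured neighbourhoods of the
  four vertices.\<close>

definition meets_nicely :: "'m ideal_cells \<Rightarrow> 'm set \<Rightarrow> bool" where
  "meets_nicely K N \<longleftrightarrow>
     (\<forall>j < fst K. \<exists>C :: 4 \<Rightarrow> (real^4) set. inj C \<and>
        components {x \<in> ideal_simplex. snd K j x \<in> N} = range C \<and>
        (\<forall>a. \<exists>U. open U \<and> simplex_vertex a \<in> U \<and> U \<inter> ideal_simplex \<subseteq> C a))"

text \<open>\<open>\<alpha>\<close> is represented by a loop at \<open>x\<close> in the union of \<open>dN\<close> (the boundary of \<open>N\<close>) and the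
  edge \<open>E\<close>: it goes along \<open>dN\<close> to the point where one end of \<open>E\<close> leaves \<open>N\<close>, traverses \<open>E\<close> to
  the point where its other end enters \<open>N\<close>, and returns to \<open>x\<close> along \<open>dN\<close>.\<close>

definition edge_generator ::
    "'m::topological_space set \<Rightarrow> 'm ideal_cells \<Rightarrow> 'm set \<Rightarrow> 'm set \<Rightarrow> 'm \<Rightarrow> 'm set \<Rightarrow>
     (real \<Rightarrow> 'm) set \<Rightarrow> bool" where
  "edge_generator M K N dN x E \<alpha> \<longleftrightarrow>
     \<alpha> \<notin> subspace_loops M dN x \<and>
     (\<exists>j a b s t p q. j < fst K \<and> a \<noteq> b \<and> edge_between K j a b = E \<and>
        0 < s \<and> s < t \<and> t < 1 \<and>
        edge_path K j a b ` {0<..s} \<subseteq> N \<and> edge_path K j a b ` {t..<1} \<subseteq> N \<and>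
        edge_path K j a b s \<in> dN \<and> edge_path K j a b t \<in> dN \<and>
        path p \<and> path_image p \<subseteq> dN \<and> pathstart p = x \<and> pathfinish p = edge_path K j a b s \<and>
        path q \<and> path_image q \<subseteq> dN \<and> pathstart q = edge_path K j a b t \<and> pathfinish q = x \<and>
        \<alpha> = loop_class M (p +++ (edge_path K j a b \<circ> linepath s t) +++ q))"

section \<open>The ortholength invariant\<close>

text \<open>The element of the fundamental group of \<open>M\<close> at \<open>\<pi> x\<close> identified with the deck-transformation
  \<open>\<gamma>\<close>: the class of the projections of paths from \<open>x\<close> to its image under \<open>\<gamma>\<close>.\<close>

definition deck_class :: "(complex \<times> real \<Rightarrow> 'm::topological_space) \<Rightarrow> 'm set \<Rightarrow>
    complex \<times> real \<Rightarrow> mat2 set \<Rightarrow> (real \<Rightarrow> 'm) set" where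
  "deck_class \<pi> M x \<gamma> = (\<Union>q \<in> {q. path q \<and> path_image q \<subseteq> H3 \<and>
     pathstart q = x \<and> pathfinish q = psl_H3_act \<gamma> x}. loop_class M (\<pi> \<circ> q))"

text \<open>\<open>x\<close> is the base-point of the universal cover \<open>H3\<close>. The complex distance is that of the
  images of \<open>\<sigma>\<close> determined by the two ends of a lift \<open>c\<close> of the edge \<open>E\<close>, where \<open>Nt\<close> is the
  component of the preimage of \<open>N\<close> which contains \<open>x\<close>.\<close>

definition is_ortho_cosh ::
    "mat2 set set \<Rightarrow> (complex \<times> real \<Rightarrow> 'm::topological_space) \<Rightarrow> 'm set \<Rightarrow> 'm set \<Rightarrow> 'm set \<Rightarrow>
     complex \<times> real \<Rightarrow> 'm ideal_cells \<Rightarrow> ((real \<Rightarrow> 'm) set \<Rightarrow> mat2 set) \<Rightarrow> 'm set \<Rightarrow>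
     complex \<Rightarrow> bool" where
  "is_ortho_cosh \<Gamma> \<pi> M N dN x K \<rho> E w \<longleftrightarrow>
     (let Nt = connected_component_set {y \<in> H3. \<pi> y \<in> N} x in
      \<exists>\<sigma> j a b c \<gamma>1 \<gamma>2 \<delta>.
        \<sigma> \<in> oriented_lines \<and>
        {line_start \<sigma>, line_end \<sigma>} =
          {p \<in> CP1. \<forall>g \<in> subspace_loops M dN (\<pi> x). psl_CP1_act (\<rho> g) p = p} \<and>
        j < fst K \<and> a \<noteq> b \<and> edge_between K j a b = E \<and>
        continuous_on {0<..<1} c \<and> c ` {0<..<1} \<subseteq> H3 \<and>
        (\<forall>s\<in>{0<..<1}. \<pi> (c s) = edge_path K j a b s) \<and>
        \<gamma>1 \<in> \<Gamma> \<and> (\<forall>\<^sub>F s in at_right 0. c s \<in> psl_H3_act \<gamma>1 ` Nt) \<and>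
        \<gamma>2 \<in> \<Gamma> \<and> (\<forall>\<^sub>F s in at_left 1. c s \<in> psl_H3_act \<gamma>2 ` Nt) \<and>
        is_complex_distance
          (psl_line_act (\<rho> (deck_class \<pi> M x \<gamma>1)) \<sigma>)
          (psl_line_act (\<rho> (deck_class \<pi> M x \<gamma>2)) \<sigma>) \<delta> \<and>
        w = cosh \<delta>)"

text \<open>The edges are enumerated by \<open>e\<close>, so that \<open>\<complex>\<^sup>n\<close> has one coordinate for each edge. The definite
  description expresses that \<open>is_ortho_cosh\<close> does not depend on the choices made in it.\<close>

definition Orth ::
    "mat2 set set \<Rightarrow> (complex \<times> real \<Rightarrow> 'm::topological_space) \<Rightarrow> 'm set \<Rightarrow> 'm set \<Rightarrow> 'm set \<Rightarrow>
     complex \<times> real \<Rightarrow> 'm ideal_cells \<Rightarrow> ('n::finite \<Rightarrow> 'm set) \<Rightarrow>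
     ((real \<Rightarrow> 'm) set \<Rightarrow> mat2 set) \<Rightarrow> complex^'n" where
  "Orth \<Gamma> \<pi> M N dN x K e \<rho> = (\<chi> i. THE w. is_ortho_cosh \<Gamma> \<pi> M N dN x K \<rho> (e i) w)"

definition ortholength_space :: "'m ideal_cells \<Rightarrow> ('n::finite \<Rightarrow> 'm set) \<Rightarrow> (complex^'n) set" where
  "ortholength_space K e = {x. \<forall>j < fst K.
     det (\<chi> a b. if a = b then 1 else x $ (THE i. e i = edge_between K j a b) :: complex^4^4) = 0}"

end

theory Submission
  imports Defs
begin

text \<open>The peripheral subgroup is abelian, since the stabilizer of a horoball consists of parabolics,
  and the condition on traces excludes that lifts of its generators anticommute; so all lifts of its
  elements commute with \<open>h\<close>, hence with the line \<open>\<sigma>\<close> for which \<open>h = (tr h / 2) + k \<sigma>\<close>. Lifting the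
  loop of an edge generator to \<open>H3\<close> shows that the edge has a lift from the horoball at the base-point
  to its image under the corresponding deck-transformation, so the \<open>i\<close>-th coordinate is the pairing of \<open>\<sigma>\<close>
  with its image under \<open>g i\<close>, and the formula is an identity for traces of 2 by 2 matrices. Lifting a whole
  tetrahedron expresses the hextet equation as the vanishing of the Gram determinant of four vectors
  in the three-dimensional space of traceless matrices.\<close>

section \<open>Oriented lines and their complex distance\<close>

lemmas mat2_simps = vec_eq_iff forall_2 matrix_matrix_mult_def sum_2 mat_def trace_def det_2
  matrix_vector_mult_def vector_2 vec_lambda_beta

definition adjugate2 :: "mat2 \<Rightarrow> mat2" where
  "adjugate2 A = vector [vector [A$2$2, - A$1$2], vector [- A$2$1, A$1$1]]"

lemma mult_adjugate2: "A ** adjugate2 A = mat (det A)" "adjugate2 A ** A = mat (det A)"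
  by (auto simp: mat2_simps adjugate2_def algebra_simps)

lemma matrix_inv_det_1:
  assumes "det A = 1"
  shows "matrix_inv A = adjugate2 A"
proof -
  have "A ** adjugate2 A = mat 1 \<and> adjugate2 A ** A = mat 1"
    using assms by (simp add: mult_adjugate2)
  then have "A ** matrix_inv A = mat 1 \<and> matrix_inv A ** A = mat 1"
    unfolding matrix_inv_def by (rule someI)
  then show ?thesis
    by (metis assms matrix_mul_assoc matrix_mul_lid matrix_mul_rid mult_adjugate2(2))
qed

lemma matrix_inv_cancel:
  assumes "det (A :: mat2) = 1"
  shows "A ** matrix_inv A = mat 1" "matrix_inv A ** A = mat 1" "det (matrix_inv A) = 1"
  using assms by (simp_all add: matrix_inv_det_1 mult_adjugate2)
    (simp add: det_2 adjugate2_def mult.commute)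

lemma matrix_inv_inv: "det (A :: mat2) = 1 \<Longrightarrow> matrix_inv (matrix_inv A) = A"
  using matrix_inv_cancel(3)[of A]
  by (simp add: matrix_inv_det_1[of "matrix_inv A"])
     (simp add: matrix_inv_det_1, simp add: adjugate2_def mat2_simps)

lemma adjugate2_mult: "adjugate2 (A ** B) = adjugate2 B ** adjugate2 A"
  by (auto simp: mat2_simps adjugate2_def algebra_simps)

lemma adjugate2_uminus: "adjugate2 (- A) = - adjugate2 A"
  by (auto simp: mat2_simps adjugate2_def)

lemma matrix_mult_uminus:
  fixes A B :: mat2
  shows "(- A) ** B = - (A ** B)" "A ** (- B) = - (A ** B)"
  by (auto simp: mat2_simps)

lemma det_uminus2: "det (- A) = det (A :: mat2)"
  by (simp add: det_2)

lemma trace_uminus: "trace (- A) = - trace (A :: mat2)"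
  by (simp add: mat2_simps)

lemma line_act_mult:
  assumes "det A = 1" "det B = 1"
  shows "line_act (A ** B) l = line_act A (line_act B l)"
  using assms
  by (simp add: line_act_def matrix_inv_det_1 det_mul adjugate2_mult matrix_mul_assoc)

lemma line_act_uminus: "line_act A (- l) = - line_act A l"
  by (simp add: line_act_def matrix_mult_uminus)

lemma line_act_uminus_left: "det A = 1 \<Longrightarrow> line_act (- A) l = line_act A l"
  by (simp add: line_act_def matrix_inv_det_1 det_uminus2 adjugate2_uminus matrix_mult_uminus)

lemma line_act_one: "line_act (mat 1) l = l"
  by (simp add: line_act_def matrix_inv_det_1) (simp add: mat2_simps adjugate2_def)

lemma line_act_in_lines:
  assumes "det A = 1" "l \<in> oriented_lines"
  shows "line_act A l \<in> oriented_lines"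
  using assms unfolding oriented_lines_def line_act_def
  by (auto simp: det_mul matrix_inv_cancel matrix_mul_assoc trace_mul_sym[of "A ** l"])

lemma trace_line_act:
  assumes "det A = 1"
  shows "trace (line_act A l ** line_act A m) = trace (l ** m)"
proof -
  have "line_act A l ** line_act A m = A ** l ** (matrix_inv A ** A) ** m ** matrix_inv A"
    by (simp add: line_act_def matrix_mul_assoc)
  also have "\<dots> = A ** (l ** m) ** matrix_inv A"
    using assms by (simp add: matrix_inv_cancel matrix_mul_assoc)
  finally show ?thesis
    using assms by (simp add: matrix_mul_assoc matrix_inv_cancel trace_mul_sym[of "A ** l ** m"])
qed

lemma line_act_eq_iff:
  assumes "det A = 1"
  shows "line_act A l = l \<longleftrightarrow> A ** l = l ** A"
proof
  assume "line_act A l = l"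
  then have "A ** l ** (matrix_inv A ** A) = l ** A"
    by (simp add: line_act_def matrix_mul_assoc)
  then show "A ** l = l ** A" using assms by (simp add: matrix_inv_cancel)
next
  assume "A ** l = l ** A"
  then have "line_act A l = l ** (A ** matrix_inv A)"
    by (simp add: line_act_def matrix_mul_assoc)
  then show "line_act A l = l" using assms by (simp add: matrix_inv_cancel)
qed

lemma line_square: "l \<in> oriented_lines \<Longrightarrow> l ** l = - mat 1"
  unfolding oriented_lines_def by (auto simp: mat2_simps; algebra)

lemma uminus_in_lines: "l \<in> oriented_lines \<Longrightarrow> - l \<in> oriented_lines"
  by (simp add: oriented_lines_def det_uminus2 trace_uminus)

lemma line_end_eq: "line_end l = line_start (- l)"
  unfolding line_end_def line_start_def
  by (intro Collect_cong) (simp add: mat2_simps, algebra)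

lemma line_start_uminus: "line_start (- l) = line_end l" "line_end (- l) = line_start l"
  by (simp_all add: line_end_eq)

lemma span_singleton_vec: "vec.span {u} = range (\<lambda>k::complex. k *s (u :: complex^2))"
  by (rule vec.span_singleton)

lemma line_start_span:
  assumes "l \<in> oriented_lines"
  obtains u where "u \<noteq> 0" "line_start l = vec.span {u}"
proof -
  define a b c where "a = l$1$1" and "b = l$1$2" and "c = l$2$1"
  have d: "l$2$2 = - a" and e: "a * a + b * c = - 1"
    using assms unfolding oriented_lines_def a_def b_def c_def
    by (auto simp: mat2_simps; algebra)+
  have mem: "v \<in> line_start l \<longleftrightarrow> (a + \<i>) * v$1 + b * v$2 = 0 \<and> c * v$1 + (\<i> - a) * v$2 = 0" for v
    unfolding line_start_def using d
    by (simp add: mat2_simps flip: a_def b_def c_def) (auto; algebra)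
  have sq: "\<i> * \<i> = - 1" by simp
  show ?thesis
  proof (cases "b = 0 \<and> a = \<i>")
    case False
    define u :: "complex^2" where "u = (if b = 0 then vector [2 * \<i>, - c] else vector [b, - (a + \<i>)])"
    have a: "a = - \<i>" if "b = 0"
      using that e False sq by algebra
    have "v \<in> line_start l \<longleftrightarrow> (\<exists>k. v = k *s u)" for v
    proof
      assume v: "v \<in> line_start l"
      show "\<exists>k. v = k *s u"
      proof (cases "b = 0")
        case True
        have "v = (v$1 / (2 * \<i>)) *s u"
          using v True a unfolding mem by (auto simp: u_def mat2_simps field_simps) 
             (simp add: eq_neg_iff_add_eq_0 algebra_simps)
        then show ?thesis ..
      next
        case f: False
        have "v = (v$1 / b) *s u"
          using v f unfolding mem by (auto simp: u_def mat2_simps field_simps) algebra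
        then show ?thesis ..
      qed
    next
      assume "\<exists>k. v = k *s u"
      then obtain k where k: "v = k *s u" ..
      show "v \<in> line_start l"
      proof (cases "b = 0")
        case True
        then show ?thesis unfolding mem k using a by (simp add: u_def mat2_simps)
      next
        case False
        have "c * (k * b) + (\<i> - a) * (k * - (a + \<i>)) = 0" using e sq by algebra
        then show ?thesis unfolding mem k using False by (simp add: u_def mat2_simps algebra_simps)
      qed
    qed
    moreover have "u \<noteq> 0" by (auto simp: u_def mat2_simps)
    ultimately show ?thesis
      using that[of u] unfolding span_singleton_vec by blast
  next
    case True
    define u :: "complex^2" where "u = vector [0, 1]"
    have "v \<in> line_start l \<longleftrightarrow> (\<exists>k. v = k *s u)" for v
      unfolding mem using True by (auto simp: u_def mat2_simps)
    moreover have "u \<noteq> 0" by (auto simp: u_def mat2_simps)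
    ultimately show ?thesis
      using that[of u] unfolding span_singleton_vec by blast
  qed
qed

lemma line_start_CP1: "l \<in> oriented_lines \<Longrightarrow> line_start l \<in> CP1"
  unfolding CP1_def by (metis (mono_tags, lifting) line_start_span mem_Collect_eq)

lemma line_end_CP1: "l \<in> oriented_lines \<Longrightarrow> line_end l \<in> CP1"
  by (simp add: line_end_eq line_start_CP1 uminus_in_lines)

lemma CP1_eq_span:
  assumes "p \<in> CP1" "u \<in> p" "u \<noteq> 0"
  shows "p = vec.span {u}"
proof -
  obtain v where v: "p = vec.span {v}" "v \<noteq> 0" using assms unfolding CP1_def by auto
  then obtain k where k: "u = k *s v" using assms(2) by (auto simp: span_singleton_vec)
  then have "k \<noteq> 0" using assms by auto
  then have "j *s v = (j / k) *s u" for j by (simp add: k)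
  moreover have "j *s u = (j * k) *s v" for j by (simp add: k)
  ultimately show ?thesis unfolding v span_singleton_vec by (metis (no_types, lifting) rangeE rangeI subsetI subset_antisym)
qed

lemma CP1_ex_nonzero: "p \<in> CP1 \<Longrightarrow> \<exists>u\<in>p. u \<noteq> 0"
  unfolding CP1_def using vec.span_base by blast

lemma det_1_mult_nonzero:
  assumes "det (A :: mat2) = 1" "u \<noteq> 0" shows "A *v u \<noteq> 0"
  by (metis assms matrix_inv_cancel(2) matrix_vector_mul_assoc matrix_vector_mul_lid
      matrix_vector_mult_0_right)

lemma CP1_act_fixed_iff:
  assumes "det A = 1" "p \<in> CP1" "u \<in> p" "u \<noteq> 0"
  shows "CP1_act A p = p \<longleftrightarrow> (\<exists>k. A *v u = k *s u)"
proof
  assume "CP1_act A p = p"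
  then have "A *v u \<in> p" using assms by (auto simp: CP1_act_def)
  then show "\<exists>k. A *v u = k *s u"
    using CP1_eq_span[OF assms(2-4)] by (auto simp: span_singleton_vec)
next
  assume "\<exists>k. A *v u = k *s u"
  then obtain k where k: "A *v u = k *s u" ..
  have "k \<noteq> 0" using det_1_mult_nonzero[OF assms(1,4)] k by auto
  have *: "A *v (j *s u) = (j * k) *s u" for j
    by (simp add: vector_scalar_commute k)
  have "j *s u = A *v ((j / k) *s u)" for j
    using \<open>k \<noteq> 0\<close> by (simp add: *)
  then have "range (\<lambda>j. j *s u) \<subseteq> range (\<lambda>j. A *v (j *s u))" by blast
  moreover have "range (\<lambda>j. A *v (j *s u)) \<subseteq> range (\<lambda>j. j *s u)" using * by blast
  ultimately show "CP1_act A p = p"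
    unfolding CP1_act_def CP1_eq_span[OF assms(2-4)] span_singleton_vec image_image by blast
qed

lemma CP1_act_uminus:
  assumes "p \<in> CP1" shows "CP1_act (- A) p = CP1_act A p"
proof -
  obtain u where p: "p = vec.span {u}" using assms by (auto simp: CP1_def)
  have *: "(- A) *v v = A *v (- v)" for v by (simp add: mat2_simps)
  have "v \<in> p \<Longrightarrow> - v \<in> p" for v by (simp add: p vec.span_neg)
  then have "uminus ` p = p" by (force simp: image_iff intro: bexI[of _ "- _"])
  have "CP1_act (- A) p = (*v) A ` uminus ` p"
    unfolding CP1_act_def image_image by (simp add: *)
  then show ?thesis by (simp add: \<open>uminus ` p = p\<close> CP1_act_def)
qed

lemma det_eq_0_of_kernel:
  assumes "(B :: mat2) *v u = 0" "u \<noteq> 0" shows "det B = 0"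
proof -
  have "mat (det B) *v u = 0"
    by (metis assms(1) matrix_vector_mul_assoc matrix_vector_mult_0_right mult_adjugate2(2))
  then show ?thesis using assms(2) by (auto simp: mat2_simps)
qed

lemma eigenvalue_trace:
  assumes "det (B :: mat2) = 1" "B *v u = k *s u" "u \<noteq> 0"
  shows "k * k - trace B * k + 1 = 0"
proof -
  have "(B - mat k) *v u = 0" using assms(2) by (auto simp: mat2_simps algebra_simps)
  then have "det (B - mat k) = 0" using assms(3) det_eq_0_of_kernel by blast
  then show ?thesis using assms(1) by (simp add: mat2_simps; algebra)
qed

lemma eigenvector_exists:
  assumes "k * k - trace (B :: mat2) * k + det B = 0"
  obtains u where "u \<noteq> 0" "B *v u = k *s u"
proof (cases "B - mat k = 0")
  case True
  then have "B = mat k" by simp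
  then have "B *v vector [1,0] = k *s vector [1,0]" by (simp add: mat2_simps)
  moreover have "vector [1,0] \<noteq> (0::complex^2)" by (simp add: mat2_simps)
  ultimately show ?thesis using that by blast
next
  case False
  define C where "C = adjugate2 (B - mat k)"
  have "(B - mat k) ** C = mat 0"
    unfolding C_def mult_adjugate2 using assms by (simp add: mat2_simps; algebra)
  then have *: "B *v (C *v w) = k *s (C *v w)" for w
  proof -
    have "(B - mat k) *v (C *v w) = 0"
      by (simp add: matrix_vector_mul_assoc \<open>(B - mat k) ** C = mat 0\<close>)
    then show ?thesis by (simp add: mat2_simps algebra_simps)
  qed
  have "C \<noteq> 0" using False by (auto simp: C_def adjugate2_def mat2_simps)
  then obtain w where "C *v w \<noteq> 0" by (metis matrix_eq matrix_vector_mult_0)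
  then show ?thesis using * that by blast
qed

lemma independent_kernel:
  assumes "(B :: mat2) *v u = 0" "B *v v = 0" "u$1 * v$2 - u$2 * v$1 \<noteq> 0"
  shows "B = 0"
proof -
  have "B$1$1 * (u$1 * v$2 - u$2 * v$1) = 0" "B$1$2 * (u$1 * v$2 - u$2 * v$1) = 0"
    "B$2$1 * (u$1 * v$2 - u$2 * v$1) = 0" "B$2$2 * (u$1 * v$2 - u$2 * v$1) = 0"
    using assms(1,2) by (simp_all only: mat2_simps zero_index) algebra+
  then show ?thesis using assms(3) by (simp add: mat2_simps)
qed

lemma dependent_pair:
  assumes "u$1 * v$2 - u$2 * v$1 = 0" "u \<noteq> (0 :: complex^2)"
  obtains c where "v = c *s u"
proof (cases "u$1 = 0")
  case True
  then have "u$2 \<noteq> 0" "v$1 = 0" using assms by (auto simp: mat2_simps)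
  then have "v = (v$2 / u$2) *s u" using True by (simp add: mat2_simps)
  then show ?thesis using that by blast
next
  case False
  then have "v = (v$1 / u$1) *s u" using assms(1) by (simp add: mat2_simps field_simps)
  then show ?thesis using that by blast
qed

lemma eigenvectors_independent:
  assumes "B *v u = j *s u" "B *v v = k *s v" "j \<noteq> k" "u \<noteq> 0" "v \<noteq> (0 :: complex^2)"
  shows "u$1 * v$2 - u$2 * v$1 \<noteq> 0"
proof
  assume z: "u$1 * v$2 - u$2 * v$1 = 0"
  obtain c where c: "v = c *s u" using dependent_pair[OF z assms(4)] .
  then have "B *v v = j *s v" using assms(1) by (simp add: vector_scalar_commute vec.scale_left_commute)
  then have "(j - k) *s v = 0" using assms(2) by (metis vector_sub_rdistrib diff_self)
  then have "j - k = 0 \<or> v = 0" by (simp only: vec.scale_eq_0_iff)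
  then show False using assms(3,5) by simp
qed

lemma fixes_ends_iff:
  assumes "l \<in> oriented_lines" "det A = 1"
  shows "CP1_act A (line_start l) = line_start l \<and> CP1_act A (line_end l) = line_end l
    \<longleftrightarrow> A ** l = l ** A"
proof
  assume ends: "CP1_act A (line_start l) = line_start l \<and> CP1_act A (line_end l) = line_end l"
  obtain u where u: "u \<in> line_start l" "u \<noteq> 0"
    using CP1_ex_nonzero line_start_CP1 assms by blast
  obtain v where v: "v \<in> line_end l" "v \<noteq> 0"
    using CP1_ex_nonzero line_end_CP1 assms by blast
  obtain j where j: "A *v u = j *s u"
    using ends CP1_act_fixed_iff[OF assms(2) line_start_CP1[OF assms(1)] u] by blast
  obtain k where k: "A *v v = k *s v"
    using ends CP1_act_fixed_iff[OF assms(2) line_end_CP1[OF assms(1)] v] by blast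
  have lu: "l *v u = (- \<i>) *s u" and lv: "l *v v = \<i> *s v"
    using u v by (simp_all add: line_start_def line_end_def)
  have "u$1 * v$2 - u$2 * v$1 \<noteq> 0"
    using eigenvectors_independent[OF lu lv] u v by (simp add: complex_eq_iff)
  moreover have "(A ** l - l ** A) *v u = 0" "(A ** l - l ** A) *v v = 0"
    by (simp_all only: matrix_vector_mult_diff_rdistrib matrix_vector_mul_assoc[symmetric]
        j k lu lv vector_scalar_commute vec.scale_left_commute diff_self)
  ultimately have "A ** l - l ** A = 0" using independent_kernel by blast
  then show "A ** l = l ** A" by simp
next
  assume comm: "A ** l = l ** A"
  have "CP1_act A p = p" if k: "p = {v. l *v v = k *s v}" and p: "p \<in> CP1" for p k
  proof -
    obtain u where u: "u \<in> p" "u \<noteq> 0" using p CP1_ex_nonzero by blast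
    then have "l *v (A *v u) = k *s (A *v u)"
      using k by (simp add: matrix_vector_mul_assoc comm[symmetric])
        (simp add: matrix_vector_mul_assoc[symmetric] vector_scalar_commute)
    then have "A *v u \<in> p" using k by simp
    then show ?thesis
      using CP1_act_fixed_iff[OF assms(2) p u] CP1_eq_span[OF p u] by (auto simp: span_singleton_vec)
  qed
  from this[OF line_start_def line_start_CP1] this[OF line_end_def line_end_CP1]
  show "CP1_act A (line_start l) = line_start l \<and> CP1_act A (line_end l) = line_end l"
    using assms(1) by blast
qed

lemma commuting_with_line:
  assumes "l \<in> oriented_lines" "A ** l = l ** A"
  obtains k where "A = mat (trace A / 2) + mat k ** l"
proof -
  define a b c where "a = l$1$1" and "b = l$1$2" and "c = l$2$1"
  have d: "l$2$2 = - a" and e: "a * a + b * c = - 1"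
    using assms(1) unfolding oriented_lines_def a_def b_def c_def
    by (auto simp: mat2_simps; algebra)+
  define p q r s where "p = A$1$1" and "q = A$1$2" and "r = A$2$1" and "s = A$2$2"
  have "q * c = b * r" "(p - s) * b = 2 * a * q" "2 * a * r = c * (p - s)"
    using assms(2) d unfolding p_def q_def r_def s_def a_def b_def c_def
    by (simp_all only: mat2_simps) algebra+
  moreover define k where "k = - (p * a + q * c + (r * b - s * a)) / 2"
  ultimately have "2 * p = p + s + 2 * (k * a)" "q = k * b" "r = k * c" "2 * s = p + s - 2 * (k * a)"
    using e by algebra+
  then have "A = mat (trace A / 2) + mat k ** l"
    by (auto simp: mat2_simps d field_simps simp flip: p_def q_def r_def s_def a_def b_def c_def)
  then show ?thesis using that by blast
qed

lemma det_scalar_plus_line: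
  assumes "l \<in> oriented_lines"
  shows "det (mat a + mat k ** l) = a\<^sup>2 + k\<^sup>2" "trace (mat a + mat k ** l) = 2 * a"
proof -
  have "l$1$1 * l$2$2 - l$1$2 * l$2$1 = 1" "l$1$1 + l$2$2 = 0"
    using assms unfolding oriented_lines_def by (auto simp: det_2 trace_def sum_2)
  then show "det (mat a + mat k ** l) = a\<^sup>2 + k\<^sup>2" "trace (mat a + mat k ** l) = 2 * a"
    by (simp_all add: mat2_simps; algebra)+
qed

lemma line_of_matrix:
  assumes "det (h :: mat2) = 1" "(trace h)\<^sup>2 \<noteq> 4"
  obtains l k where "l \<in> oriented_lines" "k \<noteq> 0" "h = mat (trace h / 2) + mat k ** l"
proof -
  define k where "k = csqrt (1 - (trace h / 2)\<^sup>2)"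
  have k2: "k\<^sup>2 = 1 - (trace h / 2)\<^sup>2" by (simp add: k_def)
  have k0: "k \<noteq> 0" using assms(2) k2 by (auto simp: power2_eq_square field_simps)
  define l where "l = mat (1 / k) ** (h - mat (trace h / 2))"
  have "det l * k\<^sup>2 = k\<^sup>2"
    using assms(1) k0 unfolding k2[symmetric] l_def
    by (simp add: mat2_simps power2_eq_square field_simps)
       (use assms(1) k2 in \<open>simp add: mat2_simps field_simps power2_eq_square\<close>; algebra)
  then have "l \<in> oriented_lines"
    using k0 by (simp add: oriented_lines_def) (simp add: l_def mat2_simps field_simps)
  moreover have "h = mat (trace h / 2) + mat k ** l"
    using k0 by (simp add: l_def matrix_mul_assoc) (simp add: mat2_simps)
  ultimately show ?thesis using that k0 by blast
qed

lemma scalar_plus_line_commute: "(mat a + mat k ** l) ** l = l ** (mat a + mat k ** (l :: mat2))"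
  by (simp add: mat2_simps algebra_simps)

lemma fixed_points_scalar_plus_line:
  assumes l: "l \<in> oriented_lines" and h: "h = mat a + mat k ** l" "det h = 1" and k: "k \<noteq> 0"
  shows "{p \<in> CP1. CP1_act h p = p} = {line_start l, line_end l}"
proof -
  have "CP1_act h (line_start l) = line_start l \<and> CP1_act h (line_end l) = line_end l"
    using fixes_ends_iff[OF l h(2)] h(1) scalar_plus_line_commute by blast
  moreover have "p = line_start l \<or> p = line_end l" if p: "p \<in> CP1" "CP1_act h p = p" for p
  proof -
    obtain u where u: "u \<in> p" "u \<noteq> 0" using p CP1_ex_nonzero by blast
    obtain j where j: "h *v u = j *s u" using CP1_act_fixed_iff[OF h(2) p(1) u] p(2) by blast
    define \<mu> where "\<mu> = (j - a) / k"
    have "l *v u = \<mu> *s u"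
      using j k unfolding h \<mu>_def by (simp add: mat2_simps field_simps)
    moreover from this have "\<mu> * \<mu> + 1 = 0"
      using eigenvalue_trace[of l u \<mu>] l u(2) by (simp add: oriented_lines_def)
    then have "(\<mu> - \<i>) * (\<mu> + \<i>) = 0" by (simp add: algebra_simps)
    then have "\<mu> = \<i> \<or> \<mu> = - \<i>" by (simp add: eq_neg_iff_add_eq_0)
    ultimately have "u \<in> line_start l \<or> u \<in> line_end l"
      by (auto simp: line_start_def line_end_def)
    then show ?thesis
      using CP1_eq_span[OF p(1) u] CP1_eq_span[OF line_start_CP1[OF l] _ u(2)]
        CP1_eq_span[OF line_end_CP1[OF l] _ u(2)] by blast
  qed
  ultimately show ?thesis using line_start_CP1[OF l] line_end_CP1[OF l] by blast
qed

lemma commuting_lines_unique: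
  assumes h: "det h = 1" "(trace h)\<^sup>2 \<noteq> 4"
    and l: "l \<in> oriented_lines" "h ** l = l ** h" and m: "m \<in> oriented_lines" "h ** m = m ** h"
  shows "m = l \<or> m = - l"
proof -
  obtain j where j: "h = mat (trace h / 2) + mat j ** l" using commuting_with_line l by blast
  obtain k where k: "h = mat (trace h / 2) + mat k ** m" using commuting_with_line m by blast
  have j2: "(trace h / 2)\<^sup>2 + j\<^sup>2 = 1" using det_scalar_plus_line(1)[OF l(1)] h(1) j by metis
  have "(trace h / 2)\<^sup>2 + k\<^sup>2 = 1" using det_scalar_plus_line(1)[OF m(1)] h(1) k by metis
  then have "(k - j) * (k + j) = 0" using j2 by algebra
  then have kj: "k = j \<or> k = - j" by (auto simp: add_eq_0_iff)
  have j0: "j \<noteq> 0" using j2 h(2) by (auto simp: power2_eq_square field_simps)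
  have "mat j ** l = mat k ** m" using j k by (metis add_left_cancel)
  moreover have "mat (- j) ** m = mat j ** (- m)" by (simp add: mat2_simps)
  ultimately have "mat j ** l = mat j ** m \<or> mat j ** l = mat j ** (- m)" using kj by auto
  moreover have "a = b" if "mat j ** a = mat j ** b" for a b :: mat2
    using that j0 by (simp add: mat2_simps)
  ultimately show ?thesis by fastforce
qed

lemma ortholength_trace_formula:
  assumes h: "det h = 1" "(trace h)\<^sup>2 \<noteq> 4"
    and l: "l \<in> oriented_lines" "h ** l = l ** h" and g: "det g = 1"
  shows "- trace (l ** line_act g l) / 2 =
    2 * ((trace (h ** g) * trace (matrix_inv h ** g) - (trace g)\<^sup>2) / ((trace h)\<^sup>2 - 4)) - 1"
proof -
  obtain k where k: "h = mat (trace h / 2) + mat k ** l" using commuting_with_line l by blast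
  have k2: "(trace h)\<^sup>2 - 4 = - 4 * k\<^sup>2"
  proof -
    have "(trace h / 2)\<^sup>2 + k\<^sup>2 = 1"
      using det_scalar_plus_line(1)[OF l(1), of "trace h / 2" k] h(1) k by simp
    then show ?thesis by (simp add: power2_eq_square) algebra
  qed
  then have k0: "k \<noteq> 0" using h(2) by auto
  have inv: "matrix_inv h = mat (trace h / 2) + mat (- k) ** l"
  proof -
    have "matrix_inv h = mat (trace h) - h"
      by (simp add: matrix_inv_det_1 h(1)) (simp add: adjugate2_def mat2_simps)
    also have "\<dots> = mat (trace h / 2) + mat (- k) ** l"
      by (subst (2) k) (simp add: mat2_simps field_simps)
    finally show ?thesis .
  qed
  have tr: "trace ((mat a + mat b ** l) ** g) = a * trace g + b * trace (l ** g)" for a b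
    by (simp add: mat2_simps algebra_simps)
  have "trace (h ** g) * trace (matrix_inv h ** g) - (trace g)\<^sup>2
      = (trace h / 2 * trace g + k * trace (l ** g)) * (trace h / 2 * trace g - k * trace (l ** g)) - (trace g)\<^sup>2"
    using tr[of "trace h / 2" k] tr[of "trace h / 2" "- k"] k inv by simp
  also have "\<dots> = ((trace h)\<^sup>2 - 4) * ((trace g)\<^sup>2 + (trace (l ** g))\<^sup>2) / 4"
  proof -
    have "k\<^sup>2 = 1 - (trace h)\<^sup>2 / 4" using k2 by (simp add: field_simps)
    moreover have "(trace h / 2 * x + k * y) * (trace h / 2 * x - k * y) = (trace h)\<^sup>2 / 4 * x\<^sup>2 - k\<^sup>2 * y\<^sup>2"
      for x y by (simp add: power2_eq_square field_simps)
    ultimately show ?thesis by (simp add: right_diff_distrib left_diff_distrib distrib_left)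
  qed
  finally have num: "trace (h ** g) * trace (matrix_inv h ** g) - (trace g)\<^sup>2
      = ((trace h)\<^sup>2 - 4) * ((trace g)\<^sup>2 + (trace (l ** g))\<^sup>2) / 4" .
  have *: "2 * ((trace (h ** g) * trace (matrix_inv h ** g) - (trace g)\<^sup>2) / ((trace h)\<^sup>2 - 4)) - 1
      = ((trace g)\<^sup>2 + (trace (l ** g))\<^sup>2) / 2 - 1"
  proof -
    have "2 * (d * s / 4 / d) - 1 = s / 2 - 1" if "d \<noteq> 0" for d s :: complex
      using that by simp
    moreover have "(trace h)\<^sup>2 - 4 \<noteq> 0" using h(2) by simp
    ultimately show ?thesis unfolding num by blast
  qed
  have "g$1$1 * g$2$2 - g$1$2 * g$2$1 = 1" using g by (simp add: det_2)
  moreover have "l$1$1 * l$2$2 - l$1$2 * l$2$1 = 1" "l$1$1 + l$2$2 = 0"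
    using l(1) unfolding oriented_lines_def by (auto simp: det_2 trace_def sum_2)
  ultimately have "- trace (l ** (g ** l ** adjugate2 g)) = (trace g)\<^sup>2 + (trace (l ** g))\<^sup>2 - 2"
    unfolding adjugate2_def by (simp only: mat2_simps) algebra
  then show ?thesis unfolding * line_act_def matrix_inv_det_1[OF g] by (simp add: field_simps)
qed

lemma gram_det_eq_0:
  fixes L :: "4 \<Rightarrow> mat2"
  assumes "\<And>a. trace (L a) = 0"
  shows "det (\<chi> a b. - trace (L a ** L b) / 2 :: complex^4^4) = 0"
proof -
  define X :: "complex^4^4" where "X = (\<chi> a i. if i = 1 then L a $1$1 else if i = 2 then L a $1$2
    else if i = 3 then L a $2$1 else 0)"
  define Y :: "complex^4^4" where "Y = (\<chi> i b. if i = 1 then - (L b $1$1) else if i = 2 then - (L b $2$1) / 2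
    else if i = 3 then - (L b $1$2) / 2 else 0)"
  have tr: "L a $2$2 = - (L a $1$1)" for a
    using assms[of a] by (simp add: trace_def sum_2 add_eq_0_iff)
  have "(\<chi> a b. - trace (L a ** L b) / 2 :: complex^4^4) = X ** Y"
    unfolding X_def Y_def
    by (simp add: vec_eq_iff matrix_matrix_mult_def sum_4 trace_def sum_2 tr field_simps)
  moreover have "column 4 X = 0"
    by (simp add: X_def column_def vec_eq_iff)
  ultimately show ?thesis by (simp add: det_mul det_zero_column)
qed

lemma trace_of_common_end:
  assumes "l \<in> oriented_lines" "m \<in> oriented_lines" "u \<noteq> 0"
    and "l *v u = j *s u" "m *v u = k *s u" "(j * k)\<^sup>2 = 1"
  shows "trace (l ** m) = 2 * (j * k)"
proof -
  have "(l ** m) *v u = (j * k) *s u"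
    using assms(4,5) by (simp add: matrix_vector_mul_assoc[symmetric] vector_scalar_commute mult.commute)
  then have "(j * k) * (j * k) - trace (l ** m) * (j * k) + 1 = 0"
    using eigenvalue_trace[of "l ** m" u "j * k"] assms(1-3) by (simp add: det_mul oriented_lines_def)
  then show ?thesis using assms(6) unfolding power2_eq_square by algebra
qed

lemma det_screw_motion: "det (screw_motion \<delta>) = 1"
  by (simp add: screw_motion_def det_2 flip: exp_add)

lemma screwed_base_line:
  "line_act (screw_motion \<delta>) base_line = vector [vector [0, \<i> * exp \<delta>], vector [\<i> * exp (- \<delta>), 0]]"
proof -
  have "exp (\<delta> / 2) * exp (\<delta> / 2) = exp \<delta>" "exp (- \<delta> / 2) * exp (- \<delta> / 2) = exp (- \<delta>)"
    by (simp_all flip: exp_add)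
  then show ?thesis
    by (simp add: line_act_def matrix_inv_det_1 det_screw_motion)
       (simp add: screw_motion_def base_line_def adjugate2_def mat2_simps ac_simps)
qed

lemma is_complex_distance_cosh:
  assumes l: "l \<in> oriented_lines" and m: "m \<in> oriented_lines" and "is_complex_distance l m \<delta>"
  shows "cosh \<delta> = - trace (l ** m) / 2"
  using assms(3) unfolding is_complex_distance_def
proof (elim disjE conjE bexE)
  fix A assume A: "A \<in> carrier SL2" "line_act A l = base_line"
    "line_act A m = line_act (screw_motion \<delta>) base_line"
  then have "trace (l ** m) = trace (base_line ** line_act (screw_motion \<delta>) base_line)"
    using trace_line_act[of A l m] by (simp add: SL2_def)
  also have "\<dots> = - 2 * cosh \<delta>"
    unfolding screwed_base_line by (simp add: base_line_def mat2_simps cosh_field_def)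
  finally show ?thesis by simp
next
  have start: "trace (l ** m) = - 2" if "line_start l = line_start m" "l \<in> oriented_lines" "m \<in> oriented_lines" for l m
  proof -
    obtain u where "u \<in> line_start l" "u \<noteq> 0" using CP1_ex_nonzero line_start_CP1 \<open>l \<in> oriented_lines\<close> by blast
    then show ?thesis using trace_of_common_end[OF that(2,3), of u "- \<i>" "- \<i>"] that(1)
      by (auto simp: line_start_def)
  qed
  { assume "line_start l = line_start m" "\<delta> = 0"
    then show ?thesis using start[OF _ l m] by simp }
  { assume "line_end l = line_end m" "\<delta> = 0"
    then show ?thesis using start[of "- l" "- m"] l m uminus_in_lines
      by (simp add: line_start_uminus matrix_mult_uminus) }
  { assume "line_start l = line_end m" "\<delta> = \<i> * of_real pi"
    then show ?thesis using start[of l "- m"] l m uminus_in_lines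
      by (simp add: line_start_uminus matrix_mult_uminus trace_uminus cosh_field_def exp_minus) }
  { assume "line_end l = line_start m" "\<delta> = \<i> * of_real pi"
    then show ?thesis using start[of "- l" m] l m uminus_in_lines
      by (simp add: line_start_uminus matrix_mult_uminus trace_uminus cosh_field_def exp_minus) }
qed

lemma line_start_eqI:
  assumes "l \<in> oriented_lines" "m \<in> oriented_lines" "u \<noteq> 0" "u \<in> line_start l" "u \<in> line_start m"
  shows "line_start l = line_start m"
  using assms CP1_eq_span line_start_CP1 by metis

text \<open>If \<open>l m u = - u\<close> then \<open>m u = l u\<close>, since \<open>l\<^sup>2 = - 1\<close>, and \<open>l u\<close> is again an eigenvector of \<open>l m\<close>;
  so \<open>u\<close> is an eigenvector of \<open>l\<close> and of \<open>m\<close> unless \<open>l m = - 1\<close>.\<close>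

lemma common_end_of_trace:
  assumes l: "l \<in> oriented_lines" and m: "m \<in> oriented_lines" and "trace (l ** m) = - 2"
  shows "line_start l = line_start m \<or> line_end l = line_end m"
proof (cases "l ** m = - mat 1")
  case True
  then have "l ** (l ** m) = l ** l ** l" by (simp add: line_square l matrix_mult_uminus)
  then have "- m = - l" using l by (simp add: matrix_mul_assoc line_square matrix_mult_uminus)
  then show ?thesis by simp
next
  case False
  have "(- 1) * (- 1) - trace (l ** m) * (- 1) + det (l ** m) = 0"
    using assms by (simp add: det_mul oriented_lines_def)
  then obtain u where u: "u \<noteq> 0" "(l ** m) *v u = (- 1) *s u" by (rule eigenvector_exists)
  have sq: "l *v (l *v v) = - v" "m *v (m *v v) = - v" for v
    using l m by (simp_all add: matrix_vector_mul_assoc line_square) (simp_all add: mat2_simps)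
  have neg: "l *v (- v) = - (l *v v)" for v by (simp add: mat2_simps)
  have lmu: "l *v (m *v u) = - u" using u(2) by (simp add: matrix_vector_mul_assoc)
  then have "l *v (l *v (m *v u)) = - (l *v u)" by (simp add: neg)
  then have mu: "m *v u = l *v u" by (simp add: sq)
  then have "m *v (l *v u) = - u" by (metis sq(2))
  then have "(l ** m + mat 1) *v (l *v u) = 0"
    by (simp add: matrix_vector_mult_add_rdistrib matrix_vector_mul_assoc[symmetric] neg)
  moreover have "(l ** m + mat 1) *v u = 0"
    by (simp add: matrix_vector_mult_add_rdistrib matrix_vector_mul_assoc[symmetric] lmu)
  ultimately have "u$1 * (l *v u)$2 - u$2 * (l *v u)$1 = 0"
    using independent_kernel[of "l ** m + mat 1" u "l *v u"] False by (metis eq_neg_iff_add_eq_0)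
  then obtain c where c: "l *v u = c *s u" using dependent_pair u(1) by blast
  have "c * c + 1 = 0" using eigenvalue_trace[OF _ c u(1)] l by (simp add: oriented_lines_def)
  then have "(c - \<i>) * (c + \<i>) = 0" by (simp add: algebra_simps)
  then consider "c = \<i>" | "c = - \<i>" by (auto simp: eq_neg_iff_add_eq_0)
  then show ?thesis
  proof cases
    case 1
    then have "u \<in> line_end l" "u \<in> line_end m" using c mu by (simp_all add: line_end_def)
    then show ?thesis
      using line_start_eqI[of "- l" "- m" u] l m u uminus_in_lines by (simp add: line_end_eq)
  next
    case 2
    then have "u \<in> line_start l" "u \<in> line_start m" using c mu by (simp_all add: line_start_def)
    then show ?thesis using line_start_eqI l m u by blast
  qed
qed

lemma cosh_surj_Re_nonneg: obtains \<delta> :: complex where "Re \<delta> \<ge> 0" "cosh \<delta> = w"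
proof -
  obtain s where s: "s\<^sup>2 = w\<^sup>2 - 1" by (metis power2_csqrt)
  have p: "(w + s) * (w - s) = 1" using s by (simp add: power2_eq_square algebra_simps)
  have ex: "\<exists>\<delta>. Re \<delta> \<ge> 0 \<and> cosh \<delta> = w" if "(w + s) * (w - s) = 1" "cmod (w + s) \<ge> 1" for s
  proof -
    have nz: "w + s \<noteq> 0" using that by auto
    define \<delta> where "\<delta> = Ln (w + s)"
    have "exp \<delta> = w + s" using nz by (simp add: \<delta>_def)
    moreover have "exp (- \<delta>) = w - s"
      using that(1) nz by (simp add: exp_minus calculation inverse_eq_divide divide_eq_eq mult.commute)
    moreover have "Re \<delta> \<ge> 0" using that(2) nz by (simp add: \<delta>_def)
    ultimately show ?thesis by (auto simp: cosh_field_def intro!: exI[of _ \<delta>])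
  qed
  have "cmod (w + s) * cmod (w - s) = 1" using p by (metis norm_mult norm_one)
  then have "cmod (w + s) \<ge> 1 \<or> cmod (w - s) \<ge> 1"
    by (smt (verit) mult_le_one norm_ge_zero mult_less_cancel_left2 mult_nonneg_nonneg mult_left_le)
  then show ?thesis using ex[of s] ex[of "- s"] p that by (auto simp: mult.commute)
qed

lemma complex_distance_exists:
  assumes l: "l \<in> oriented_lines" and m: "m \<in> oriented_lines"
  obtains \<delta> where "is_complex_distance l m \<delta>"
proof -
  obtain \<delta> where \<delta>: "Re \<delta> \<ge> 0" "cosh \<delta> = - trace (l ** m) / 2" by (rule cosh_surj_Re_nonneg)
  define e where "e = exp (- \<delta>)"
  have e: "exp \<delta> = 1 / e" "e \<noteq> 0" by (simp_all add: e_def exp_minus inverse_eq_divide)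
  have tr: "trace (l ** m) = - (e + 1 / e)" using \<delta>(2) by (simp add: cosh_field_def e flip: e_def) (simp add: algebra_simps eq_neg_iff_add_eq_0)
  consider "e = 1" | "e = - 1" | "e \<noteq> 1" "e \<noteq> - 1" by blast
  then show ?thesis
  proof cases
    case 1
    then show ?thesis using common_end_of_trace[OF l m] tr that unfolding is_complex_distance_def by auto
  next
    case 2
    then have "trace (l ** (- m)) = - 2" using tr by (simp add: matrix_mult_uminus trace_uminus)
    then have "line_start l = line_end m \<or> line_end l = line_start m"
      using common_end_of_trace[OF l uminus_in_lines[OF m]] by (simp add: line_start_uminus)
    then show ?thesis using that unfolding is_complex_distance_def by blast
  next
    case 3
    then have e2: "- e \<noteq> - 1 / e" using e(2) by (auto simp: field_simps square_eq_1_iff)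
    have sq: "l *v (l *v v) = - v" "m *v (m *v v) = - v" for v
      using l m by (simp_all add: matrix_vector_mul_assoc line_square) (simp_all add: mat2_simps)
    have neg: "l *v (- v) = - (l *v v)" "m *v (- v) = - (m *v v)" for v by (simp_all add: mat2_simps)
    have scal: "l *v (c *s v) = c *s (l *v v)" "m *v (c *s v) = c *s (m *v v)" for c v
      by (simp_all add: vector_scalar_commute)
    have "(- e) * (- e) - trace (l ** m) * (- e) + det (l ** m) = 0"
      using tr e l m by (simp add: det_mul oriented_lines_def field_simps)
    then obtain u0 where u0: "u0 \<noteq> 0" "(l ** m) *v u0 = (- e) *s u0" by (rule eigenvector_exists)
    have "l *v (l *v (m *v u0)) = - e *s (l *v u0)"
      using u0(2) by (simp add: matrix_vector_mul_assoc[symmetric] neg scal)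
    then have mu0: "m *v u0 = e *s (l *v u0)" by (simp add: sq)
    then have "m *v (e *s (l *v u0)) = - u0" by (metis sq(2))
    then have mlu0: "m *v (l *v u0) = (- 1 / e) *s u0"
      using e(2) by (simp add: scal) (simp add: mat2_simps field_simps)
    then have "(l ** m) *v (l *v u0) = (- 1 / e) *s (l *v u0)"
      by (simp add: matrix_vector_mul_assoc[symmetric] neg scal)
    moreover have "l *v u0 \<noteq> 0" using u0(1) sq(1)[of u0] by (auto simp: mat2_simps)
    ultimately have D: "u0$1 * (l *v u0)$2 - u0$2 * (l *v u0)$1 \<noteq> 0"
      using eigenvectors_independent[OF u0(2) _ e2 u0(1)] by blast
    define r where "r = csqrt (1 / (- \<i> * (u0$1 * (l *v u0)$2 - u0$2 * (l *v u0)$1)))"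
    define u where "u = r *s u0"
    define v where "v = l *v u"
    have r2: "r * r * (- \<i> * (u0$1 * (l *v u0)$2 - u0$2 * (l *v u0)$1)) = 1"
      unfolding r_def power2_eq_square[symmetric] power2_csqrt using D by (simp add: field_simps)
    have det: "- \<i> * (u$1 * v$2 - u$2 * v$1) = 1"
      using r2 unfolding v_def u_def scal by (simp add: algebra_simps)
    have lv: "l *v u = v" "l *v v = - u" by (simp_all add: v_def sq)
    have mv: "m *v u = e *s v" "m *v v = (- 1 / e) *s u"
      by (simp_all add: v_def u_def scal mu0 mlu0 vec.scale_left_commute)
    define B :: mat2 where "B = vector [vector [u$1, - \<i> * v$1], vector [u$2, - \<i> * v$2]]"
    have detB: "det B = 1" using det by (simp add: B_def det_2 algebra_simps)
    obtain j :: complex where j: "j * j = - 1" "\<i> = j" by simp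
    have lB: "l ** B = B ** base_line"
    proof -
      have c: "l$1$1 * u$1 + l$1$2 * u$2 = v$1" "l$2$1 * u$1 + l$2$2 * u$2 = v$2"
        "l$1$1 * v$1 + l$1$2 * v$2 = - u$1" "l$2$1 * v$1 + l$2$2 * v$2 = - u$2"
        using lv by (simp_all add: mat2_simps)
      have "v$1 = - (j * v$1 * j)" "v$2 = - (j * v$2 * j)" using j(1) by algebra+
      moreover have "- (l$1$1 * (j * v$1)) - l$1$2 * (j * v$2) = u$1 * j" using c(3) by algebra
      moreover have "- (l$2$1 * (j * v$1)) - l$2$2 * (j * v$2) = u$2 * j" using c(4) by algebra
      ultimately show ?thesis using c(1,2) unfolding B_def base_line_def j(2)
        by (simp add: mat2_simps)
    qed
    have mB: "m ** B = B ** line_act (screw_motion \<delta>) base_line"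
    proof -
      obtain f where f: "e * f = 1" "1 / e = f" using e(2) by (metis nonzero_eq_divide_eq mult.commute)
      have c: "m$1$1 * u$1 + m$1$2 * u$2 = e * v$1" "m$2$1 * u$1 + m$2$2 * u$2 = e * v$2"
        "m$1$1 * v$1 + m$1$2 * v$2 = - f * u$1" "m$2$1 * v$1 + m$2$2 * v$2 = - f * u$2"
        using mv by (simp_all add: mat2_simps flip: f(2))
      have "e * v$1 = - (j * v$1 * (j * e))" "e * v$2 = - (j * v$2 * (j * e))" using j(1) by algebra+
      moreover have "- (m$1$1 * (j * v$1)) - m$1$2 * (j * v$2) = u$1 * (j * f)" using c(3) by algebra
      moreover have "- (m$2$1 * (j * v$1)) - m$2$2 * (j * v$2) = u$2 * (j * f)" using c(4) by algebra
      ultimately show ?thesis using c(1,2) unfolding B_def screwed_base_line e(1) f(2) e_def[symmetric] j(2)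
        by (simp add: mat2_simps)
    qed
    have conj: "line_act (matrix_inv B) n = b" if "n ** B = B ** b" for n b
    proof -
      have "line_act (matrix_inv B) n = matrix_inv B ** (n ** B)"
        unfolding line_act_def using detB
        by (simp add: matrix_inv_inv matrix_mul_assoc)
      then show ?thesis using that detB by (simp add: matrix_mul_assoc matrix_inv_cancel)
    qed
    have "is_complex_distance l m \<delta>"
      unfolding is_complex_distance_def
      using \<delta>(1) conj[OF lB] conj[OF mB] matrix_inv_cancel(3)[OF detB] by (auto simp: SL2_def)
    then show ?thesis using that by blast
  qed
qed

section \<open>The action on upper half-space\<close>

lemma SL2_simps [simp]:
  "carrier SL2 = {A. det A = 1}" "monoid.mult SL2 = (**)" "one SL2 = mat 1"
  by (simp_all add: SL2_def)

lemma group_SL2: "group SL2"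
proof (rule groupI)
  fix A assume "A \<in> carrier SL2"
  then show "\<exists>B\<in>carrier SL2. B \<otimes>\<^bsub>SL2\<^esub> A = \<one>\<^bsub>SL2\<^esub>"
    using matrix_inv_cancel[of A] by auto
qed (auto simp: det_mul matrix_mul_assoc)

lemma centre_normal_SL2: "{mat 1, - mat 1} \<lhd> SL2"
proof -
  interpret group SL2 by (rule group_SL2)
  have inv: "inv\<^bsub>SL2\<^esub> (- mat 1) = - mat 1"
    by (rule inv_equality) (auto simp: matrix_mult_uminus det_uminus2)
  have "subgroup {mat 1, - mat 1} SL2"
    using inv_one inv by (intro subgroupI) (auto simp: matrix_mult_uminus det_uminus2)
  then show ?thesis
    unfolding normal_inv_iff using r_inv by (auto simp: matrix_mult_uminus)
qed

lemma group_PSL2: "group PSL2"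
  unfolding PSL2_def by (rule normal.factorgroup_is_group[OF centre_normal_SL2])

lemma carrier_PSL2: "carrier PSL2 = {{A, - A} |A. det A = 1}"
  unfolding PSL2_def carrier_FactGroup by (auto simp: r_coset_def matrix_mult_uminus image_iff)

lemma one_PSL2: "\<one>\<^bsub>PSL2\<^esub> = {mat 1, - mat 1}"
  by (simp add: PSL2_def)

lemma mult_PSL2: "P \<otimes>\<^bsub>PSL2\<^esub> Q = {A ** B |A B. A \<in> P \<and> B \<in> Q}"
  by (auto simp: PSL2_def set_mult_def)

lemma PSL2_memD:
  assumes "P \<in> carrier PSL2" "A \<in> P"
  shows "det A = 1" "P = {A, - A}"
  using assms unfolding carrier_PSL2 by (auto simp: det_uminus2)

lemma PSL2_nonempty: "P \<in> carrier PSL2 \<Longrightarrow> \<exists>A. A \<in> P"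
  by (auto simp: carrier_PSL2)

lemma psl_lift_eq:
  assumes "P \<in> carrier PSL2" "A \<in> P" "f (- A) = f A"
  shows "psl_lift f P = f A"
  using PSL2_memD(2)[OF assms(1,2)] assms(3) by (simp add: psl_lift_def)

lemma psl_trace_sq_eq: "P \<in> carrier PSL2 \<Longrightarrow> A \<in> P \<Longrightarrow> psl_trace_sq P = (trace A)\<^sup>2"
  unfolding psl_trace_sq_def by (rule psl_lift_eq) (auto simp: trace_uminus)

lemma psl_CP1_act_eq:
  "P \<in> carrier PSL2 \<Longrightarrow> A \<in> P \<Longrightarrow> p \<in> CP1 \<Longrightarrow> psl_CP1_act P p = CP1_act A p"
  unfolding psl_CP1_act_def by (rule psl_lift_eq) (auto simp: CP1_act_uminus)

lemma psl_line_act_eq: "P \<in> carrier PSL2 \<Longrightarrow> A \<in> P \<Longrightarrow> psl_line_act P l = line_act A l"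
  unfolding psl_line_act_def
  by (rule psl_lift_eq) (auto simp: line_act_uminus_left PSL2_memD)

lemma H3_act_uminus: "H3_act (- A) x = H3_act A x"
proof -
  have n: "cmod (- a - b) = cmod (a + b)" for a b by (metis minus_add_distrib norm_minus_cancel uminus_add_conv_diff add.commute)
  show ?thesis by (simp add: H3_act_def Let_def n) (simp add: algebra_simps)
qed

lemma psl_H3_act_eq: "P \<in> carrier PSL2 \<Longrightarrow> A \<in> P \<Longrightarrow> psl_H3_act P x = H3_act A x"
  unfolding psl_H3_act_def by (rule psl_lift_eq) (auto simp: H3_act_uminus)

lemma psl_line_act_mult:
  assumes "P \<in> carrier PSL2" "Q \<in> carrier PSL2"
  shows "psl_line_act (P \<otimes>\<^bsub>PSL2\<^esub> Q) l = psl_line_act P (psl_line_act Q l)"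
proof -
  obtain A B where AB: "A \<in> P" "B \<in> Q" using assms PSL2_nonempty by blast
  then have "A ** B \<in> P \<otimes>\<^bsub>PSL2\<^esub> Q" by (auto simp: mult_PSL2)
  moreover have "P \<otimes>\<^bsub>PSL2\<^esub> Q \<in> carrier PSL2"
    using assms group_PSL2 by (simp add: group.subgroup_self subgroup.m_closed)
  ultimately show ?thesis
    using assms AB PSL2_memD by (simp add: psl_line_act_eq line_act_mult)
qed

text \<open>The denominator \<open>D\<close> in the definition of the action.\<close>

definition H3_denom :: "mat2 \<Rightarrow> complex \<times> real \<Rightarrow> real" where
  "H3_denom A x = (cmod (A$2$1 * fst x + A$2$2))\<^sup>2 + (cmod (A$2$1))\<^sup>2 * (snd x)\<^sup>2"

lemma H3_denom_pos:
  assumes "det A = 1" "x \<in> H3" shows "H3_denom A x > 0"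
proof (cases "A$2$1 = 0")
  case True
  then have "A$2$2 \<noteq> 0" using assms(1) by (auto simp: det_2)
  then show ?thesis using True by (simp add: H3_denom_def)
next
  case False
  then show ?thesis using assms(2) unfolding H3_denom_def H3_def
    by (intro add_nonneg_pos) auto
qed

lemma snd_H3_act: "snd (H3_act A x) = snd x / H3_denom A x"
  by (simp add: H3_act_def H3_denom_def Let_def)

lemma H3_act_in_H3: "det A = 1 \<Longrightarrow> x \<in> H3 \<Longrightarrow> H3_act A x \<in> H3"
  using H3_denom_pos[of A x] snd_H3_act[of A x] by (simp add: H3_def)

lemma H3_denom_eq:
  "complex_of_real (H3_denom A x) = (A$2$1 * fst x + A$2$2) * cnj (A$2$1 * fst x + A$2$2)
     + A$2$1 * cnj (A$2$1) * (of_real (snd x))\<^sup>2"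
  by (simp only: H3_denom_def of_real_add of_real_mult complex_norm_square) simp

lemma fst_H3_act:
  "fst (H3_act A x) = ((A$1$1 * fst x + A$1$2) * cnj (A$2$1 * fst x + A$2$2)
     + A$1$1 * cnj (A$2$1) * (of_real (snd x))\<^sup>2) / of_real (H3_denom A x)"
  by (simp add: H3_act_def H3_denom_def Let_def)

lemma H3_act_mult:
  assumes A: "det A = 1" and B: "det B = 1" and x: "x \<in> H3"
  shows "H3_act (A ** B) x = H3_act A (H3_act B x)"
proof -
  define a b c d where "a = A$1$1" and "b = A$1$2" and "c = A$2$1" and "d = A$2$2"
  define a' b' c' d' where "a' = B$1$1" and "b' = B$1$2" and "c' = B$2$1" and "d' = B$2$2"
  note entries = a_def[symmetric] b_def[symmetric] c_def[symmetric] d_def[symmetric]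
    a'_def[symmetric] b'_def[symmetric] c'_def[symmetric] d'_def[symmetric]
  have dets: "a * d - b * c = 1" "a' * d' - b' * c' = 1"
    using A B by (simp_all add: det_2 entries)
  then have cdets: "cnj a * cnj d - cnj b * cnj c = 1" "cnj a' * cnj d' - cnj b' * cnj c' = 1"
    by (metis complex_cnj_diff complex_cnj_mult complex_cnj_one)+
  define z t where "z = fst x" and "t = complex_of_real (snd x)"
  define D where "D = complex_of_real (H3_denom B x)"
  define E where "E = complex_of_real (H3_denom (A ** B) x)"
  define F where "F = complex_of_real (H3_denom A (H3_act B x))"
  have D0: "D \<noteq> 0" and E0: "E \<noteq> 0" and F0: "F \<noteq> 0"
    unfolding D_def E_def F_def
    using H3_denom_pos[OF B x] H3_denom_pos[OF A H3_act_in_H3[OF B x]] H3_denom_pos[of "A ** B" x] A B x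
    by (simp_all add: det_mul)
  define w where "w = c' * z + d'"
  define v where "v = a' * z + b'"
  have ab: "(A ** B)$1$1 = a * a' + b * c'" "(A ** B)$1$2 = a * b' + b * d'"
    "(A ** B)$2$1 = c * a' + d * c'" "(A ** B)$2$2 = c * b' + d * d'"
    by (simp_all add: matrix_matrix_mult_def sum_2 entries)
  have Dw: "D = w * cnj w + c' * cnj c' * t\<^sup>2"
    by (simp add: D_def H3_denom_eq entries w_def z_def t_def)
  have "cnj t = t" by (simp add: t_def)
  have cD: "cnj D = D" by (simp add: D_def)
  define y where "y = v * cnj w + a' * cnj c' * t\<^sup>2"
  have fy: "fst (H3_act B x) = y / D"
    by (simp add: fst_H3_act entries y_def v_def w_def z_def t_def D_def)
  have sy: "complex_of_real (snd (H3_act B x)) = t / D"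
    by (simp add: snd_H3_act t_def D_def)
  have Ew: "E = (c * v + d * w) * cnj (c * v + d * w) + (c * a' + d * c') * cnj (c * a' + d * c') * t\<^sup>2"
    unfolding E_def H3_denom_eq ab by (simp add: v_def w_def z_def t_def algebra_simps)
  have Fw: "F * (D * D) = (c * y + d * D) * cnj (c * y + d * D) + c * cnj c * t\<^sup>2"
    unfolding F_def H3_denom_eq fy sy entries using D0 cD by (simp add: field_simps power2_eq_square)
  have vw: "a' * w - c' * v = 1" using dets(2) unfolding v_def w_def by algebra
  then have cvw: "cnj a' * cnj w - cnj c' * cnj v = 1"
    by (metis complex_cnj_diff complex_cnj_mult complex_cnj_one)
  have cy: "cnj y = cnj v * w + cnj a' * c' * t\<^sup>2" by (simp add: y_def t_def)
  have "F * D * D = E * D"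
    unfolding mult.assoc Fw unfolding Ew complex_cnj_add complex_cnj_mult cD cy 
    unfolding y_def Dw using vw cvw by algebra
  then have FD: "F * D = E" using D0 by simp
  have "snd (H3_act (A ** B) x) = snd (H3_act A (H3_act B x))"
    unfolding snd_H3_act[of _ "H3_act B x"] snd_H3_act
    using FD unfolding D_def E_def F_def of_real_mult[symmetric] of_real_eq_iff by (metis divide_divide_eq_left mult.commute)
  moreover have "fst (H3_act (A ** B) x) = fst (H3_act A (H3_act B x))"
  proof -
    have l: "fst (H3_act (A ** B) x) * E = (a * v + b * w) * cnj (c * v + d * w) + (a * a' + b * c') * cnj (c * a' + d * c') * t\<^sup>2"
      unfolding fst_H3_act ab using E0
      by (simp add: E_def[symmetric]) (simp add: v_def w_def z_def t_def algebra_simps)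
    have r: "fst (H3_act A (H3_act B x)) * F * (D * D) = (a * y + b * D) * cnj (c * y + d * D) + a * cnj c * t\<^sup>2"
      unfolding fst_H3_act[of A] fy sy entries F_def[symmetric] using D0 cD F0
      by (simp add: field_simps power2_eq_square)
    have "fst (H3_act A (H3_act B x)) * F * (D * D) = fst (H3_act (A ** B) x) * E * D"
      unfolding r l complex_cnj_add complex_cnj_mult cD cy unfolding y_def Dw using vw cvw by algebra
    then have "fst (H3_act A (H3_act B x)) * (F * D) * D = fst (H3_act (A ** B) x) * E * D" by (simp add: mult.assoc)
    then show ?thesis using D0 E0 unfolding FD by simp
  qed
  ultimately show ?thesis by (rule prod_eqI[rotated])
qed

lemma H3_act_one: "H3_act (mat 1) x = x"
  by (simp add: H3_act_def mat_def)

lemma H3_act_inverse: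
  assumes "det A = 1" "x \<in> H3"
  shows "H3_act (matrix_inv A) (H3_act A x) = x" "H3_act A (H3_act (matrix_inv A) x) = x"
  using assms H3_act_mult[of "matrix_inv A" A x] H3_act_mult[of A "matrix_inv A" x]
  by (simp_all add: matrix_inv_cancel H3_act_one)

lemma psl_H3_act_mult:
  assumes "P \<in> carrier PSL2" "Q \<in> carrier PSL2" "x \<in> H3"
  shows "psl_H3_act (P \<otimes>\<^bsub>PSL2\<^esub> Q) x = psl_H3_act P (psl_H3_act Q x)"
proof -
  obtain A B where AB: "A \<in> P" "B \<in> Q" using assms PSL2_nonempty by blast
  then have "A ** B \<in> P \<otimes>\<^bsub>PSL2\<^esub> Q" by (auto simp: mult_PSL2)
  moreover have "P \<otimes>\<^bsub>PSL2\<^esub> Q \<in> carrier PSL2"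
    using assms group_PSL2 by (simp add: group.subgroup_self subgroup.m_closed)
  ultimately show ?thesis
    using assms AB PSL2_memD by (simp add: psl_H3_act_eq H3_act_mult)
qed

lemma psl_H3_act_one: "psl_H3_act \<one>\<^bsub>PSL2\<^esub> x = x"
  using psl_H3_act_eq[of "\<one>\<^bsub>PSL2\<^esub>" "mat 1"] group.is_monoid[OF group_PSL2]
  by (simp add: H3_act_one one_PSL2 monoid.one_closed flip: one_PSL2) (simp add: one_PSL2)

lemma continuous_H3_act:
  assumes "det A = 1" shows "continuous_on H3 (H3_act A)"
proof -
  have "H3_denom A x \<noteq> 0" if "x \<in> H3" for x using H3_denom_pos[OF assms that] by simp
  then have nz: "(cmod (A$2$1 * fst x + A$2$2))\<^sup>2 + (cmod (A$2$1))\<^sup>2 * (snd x)\<^sup>2 \<noteq> 0" if "x \<in> H3" for x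
    using that unfolding H3_denom_def by blast
  then have nz': "complex_of_real ((cmod (A$2$1 * fst x + A$2$2))\<^sup>2 + (cmod (A$2$1))\<^sup>2 * (snd x)\<^sup>2) \<noteq> 0" if "x \<in> H3" for x
    using that of_real_eq_0_iff by blast
  show ?thesis
    unfolding H3_act_def Let_def by (intro continuous_intros ballI; erule nz nz')
qed

lemma psl_H3_act_in_H3: "P \<in> carrier PSL2 \<Longrightarrow> x \<in> H3 \<Longrightarrow> psl_H3_act P x \<in> H3"
  using PSL2_nonempty PSL2_memD H3_act_in_H3 psl_H3_act_eq by metis

lemma continuous_psl_H3_act: "P \<in> carrier PSL2 \<Longrightarrow> continuous_on H3 (psl_H3_act P)"
  using PSL2_nonempty PSL2_memD continuous_H3_act psl_H3_act_eq by (metis (no_types, lifting) ext)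

lemma H3_open_convex: "open H3" "convex H3"
proof -
  have "H3 = UNIV \<times> {0<..}" by (auto simp: H3_def)
  then show "open H3" "convex H3"
    by (metis open_Times open_UNIV open_greaterThan) (metis \<open>H3 = _\<close> convex_Times convex_UNIV convex_real_interval(3))
qed

section \<open>Horoballs\<close>

lemma horoball_subset_H3: "det A = 1 \<Longrightarrow> horoball A \<subseteq> H3"
  unfolding horoball_def using H3_act_in_H3 by (force simp: H3_def)

lemma horosphere_subset_horoball: "horosphere A \<subseteq> horoball A"
  unfolding horoball_def horosphere_def by auto

lemma mem_horoball_iff:
  assumes "det A = 1" "y \<in> H3"
  shows "y \<in> horoball A \<longleftrightarrow> snd (H3_act (matrix_inv A) y) \<ge> 1"
proof
  assume "y \<in> horoball A"
  then obtain w where "y = H3_act A w" "snd w \<ge> 1" unfolding horoball_def by auto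
  then show "snd (H3_act (matrix_inv A) y) \<ge> 1"
    using H3_act_inverse(1)[OF assms(1), of w] by (simp add: H3_def)
next
  assume "snd (H3_act (matrix_inv A) y) \<ge> 1"
  then show "y \<in> horoball A"
    unfolding horoball_def using H3_act_inverse(2)[OF assms] by (auto intro!: image_eqI)
qed

lemma mem_horosphere_iff:
  assumes "det A = 1" "y \<in> H3"
  shows "y \<in> horosphere A \<longleftrightarrow> snd (H3_act (matrix_inv A) y) = 1"
proof
  assume "y \<in> horosphere A"
  then obtain w where "y = H3_act A w" "snd w = 1" unfolding horosphere_def by auto
  then show "snd (H3_act (matrix_inv A) y) = 1"
    using H3_act_inverse(1)[OF assms(1), of w] by (simp add: H3_def)
next
  assume "snd (H3_act (matrix_inv A) y) = 1"
  then show "y \<in> horosphere A"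
    unfolding horosphere_def using H3_act_inverse(2)[OF assms] by (auto intro!: image_eqI)
qed

lemma H3_act_image_horoball:
  assumes "det A = 1" "det B = 1"
  shows "H3_act A ` horoball B = horoball (A ** B)"
  unfolding horoball_def image_image
  by (rule image_cong) (use assms H3_act_mult in \<open>auto simp: H3_def\<close>)

lemma connected_horoball: "det A = 1 \<Longrightarrow> connected (horoball A)"
proof -
  assume A: "det A = 1"
  have e: "{x. snd x \<ge> (1::real)} = (UNIV :: complex set) \<times> {1..}" by auto
  have "connected {x :: complex \<times> real. snd x \<ge> 1}"
    unfolding e by (intro connected_Times convex_connected) auto
  moreover have "continuous_on {x. snd x \<ge> 1} (H3_act A)"
    by (rule continuous_on_subset[OF continuous_H3_act[OF A]]) (auto simp: H3_def)
  ultimately show ?thesis unfolding horoball_def by (rule connected_continuous_image[rotated])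
qed

lemma mem_horoball_inv_iff:
  assumes "det C = 1" "(z, t) \<in> H3" "c = matrix_inv C$2$1" "d = matrix_inv C$2$2"
  shows "(z, t) \<in> horoball C \<longleftrightarrow> (cmod (c * z + d))\<^sup>2 + (cmod c)\<^sup>2 * t\<^sup>2 \<le> t"
proof -
  have "H3_denom (matrix_inv C) (z, t) > 0"
    using H3_denom_pos assms matrix_inv_cancel(3) by blast
  then show ?thesis
    using mem_horoball_iff[OF assms(1,2)] assms(3,4)
    by (simp add: snd_H3_act H3_denom_def field_simps)
qed

lemma horoball_standard: "horoball (mat 1) = {x. snd x \<ge> 1}"
  by (simp add: horoball_def H3_act_one)

lemma cmod_affine: "c \<noteq> 0 \<Longrightarrow> (cmod (c * z + d))\<^sup>2 = (cmod c)\<^sup>2 * (cmod (z - (- d / c)))\<^sup>2"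
proof -
  assume "c \<noteq> 0"
  then have "c * z + d = c * (z - (- d / c))" by (simp add: distrib_left)
  then show ?thesis by (metis norm_mult power_mult_distrib)
qed

lemma horoball_disjoint_standard:
  assumes "det C = 1" "horoball C \<inter> horoball (mat 1) = {}"
  obtains p r where "r > 1"
    "\<forall>z t. (z, t) \<in> H3 \<longrightarrow> ((z, t) \<in> horoball C \<longleftrightarrow> r * ((cmod (z - p))\<^sup>2 + t\<^sup>2) \<le> t)"
proof -
  define c d where "c = matrix_inv C$2$1" and "d = matrix_inv C$2$2"
  have mem: "(z, t) \<in> horoball C \<longleftrightarrow> (cmod (c * z + d))\<^sup>2 + (cmod c)\<^sup>2 * t\<^sup>2 \<le> t"
    if "(z, t) \<in> H3" for z t
    using mem_horoball_inv_iff[OF assms(1) that] c_def d_def by blast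
  have c: "c \<noteq> 0"
  proof
    assume "c = 0"
    define t where "t = max 1 ((cmod d)\<^sup>2)"
    then have "(0, t) \<in> horoball C" using mem[of 0 t] \<open>c = 0\<close> by (simp add: H3_def)
    moreover have "(0, t) \<in> horoball (mat 1)" by (simp add: horoball_standard t_def)
    ultimately show False using assms(2) by blast
  qed
  have mem': "(z, t) \<in> horoball C \<longleftrightarrow> (cmod c)\<^sup>2 * ((cmod (z - (- d / c)))\<^sup>2 + t\<^sup>2) \<le> t"
    if "(z, t) \<in> H3" for z t
    using mem[OF that] unfolding cmod_affine[OF c] by (simp add: distrib_left)
  have "(cmod c)\<^sup>2 > 1"
  proof (rule ccontr)
    assume "\<not> (cmod c)\<^sup>2 > 1"
    then have "(- d / c, 1) \<in> horoball C" using mem'[of "- d / c" 1] by (simp add: H3_def)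
    moreover have "(- d / c, 1) \<in> horoball (mat 1)" by (simp add: horoball_standard)
    ultimately show False using assms(2) by blast
  qed
  with mem' show ?thesis using that by blast
qed

text \<open>A horoball disjoint from \<open>{(z, t). t \<ge> 1}\<close> which comes near \<open>(z, 1)\<close> is a Euclidean ball
  of diameter almost \<open>1\<close> resting on the plane near \<open>z\<close>, so it contains \<open>(z, 1/2)\<close>. Hence no two
  such balls are disjoint.\<close>

lemma horoball_near_standard:
  assumes "det C = 1" "horoball C \<inter> horoball (mat 1) = {}"
    and "(z', t') \<in> horoball C" "cmod (z' - z) < 1/10" "t' > 9/10"
  shows "(z, 1/2) \<in> horoball C"
proof -
  obtain p r where r: "r > 1"
    and mem: "\<forall>z t. (z, t) \<in> H3 \<longrightarrow> ((z, t) \<in> horoball C \<longleftrightarrow> r * ((cmod (z - p))\<^sup>2 + t\<^sup>2) \<le> t)"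
    by (rule horoball_disjoint_standard[OF assms(1,2)])
  define s where "s = cmod (z' - p)"
  have H: "(z', t') \<in> H3" "(z, 1/2) \<in> H3" using assms(5) by (auto simp: H3_def)
  have 1: "r * (s\<^sup>2 + t'\<^sup>2) \<le> t'" using mem H(1) assms(3) by (simp add: s_def)
  have t1: "t' < 1" using assms(2,3) by (force simp: horoball_standard)
  have "1 * (s\<^sup>2 + t'\<^sup>2) \<le> r * (s\<^sup>2 + t'\<^sup>2)" using r by (intro mult_right_mono) auto
  then have "s\<^sup>2 \<le> t' * (1 - t')" using 1 by (simp add: power2_eq_square algebra_simps)
  also have "\<dots> \<le> 1 * (1 - t')" using t1 by (intro mult_right_mono) auto
  also have "\<dots> < 1/10" using assms(5) by simp
  finally have "s\<^sup>2 < 1/10" .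
  then have s: "s < 1/3" using power2_less_imp_less[of s "1/3"] by (simp add: power2_eq_square)
  have "r * t' * t' \<le> 1 * t'" using 1 r
    by (smt (verit) distrib_left mult.assoc mult_nonneg_nonneg power2_eq_square zero_le_power2 mult_1)
  then have "r * t' \<le> 1" using assms(5) by (simp add: mult_le_cancel_right)
  moreover have "r * (9/10) \<le> r * t'" using r assms(5) by (intro mult_left_mono) auto
  ultimately have r': "r \<le> 10/9" by simp
  have "cmod (z - p) \<le> cmod (z - z') + s" unfolding s_def by (rule norm_triangle_sub[of "z - p" "z' - p", simplified, THEN order_trans]) simp
  then have "cmod (z - p) < 13/30" using s assms(4) by (simp add: norm_minus_commute)
  then have "(cmod (z - p))\<^sup>2 \<le> (13/30)\<^sup>2" by (intro power_mono) auto
  then have "(cmod (z - p))\<^sup>2 + (1/2)\<^sup>2 \<le> 0.45" by (simp add: power2_eq_square)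
  then have "r * ((cmod (z - p))\<^sup>2 + (1/2)\<^sup>2) \<le> 10/9 * 0.45" using r' r by (intro mult_mono) auto
  then show ?thesis using mem H(2) by simp
qed

lemma horoballs_locally_finite_standard:
  assumes det: "\<And>C. C \<in> S \<Longrightarrow> det C = 1"
    and disj: "\<And>C. C \<in> S \<Longrightarrow> horoball C = horoball (mat 1) \<or> horoball C \<inter> horoball (mat 1) = {}"
      "\<And>C C'. C \<in> S \<Longrightarrow> C' \<in> S \<Longrightarrow> horoball C = horoball C' \<or> horoball C \<inter> horoball C' = {}"
    and y: "snd y \<ge> 1"
  shows "\<exists>U. open U \<and> y \<in> U \<and> U \<subseteq> H3 \<and> (\<forall>C\<in>S. U \<inter> horoball C \<subseteq> horoball (mat 1))"
proof -
  define V where "V = ball (fst y) (1/10) \<times> {9/10 :: real <..}"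
  have V: "open V" "y \<in> V" "V \<subseteq> H3"
    using y by (auto simp: V_def H3_def open_Times mem_Times_iff)
  have near: "(fst y, 1/2) \<in> horoball C"
    if "C \<in> S" "horoball C \<noteq> horoball (mat 1)" "w \<in> V" "w \<in> horoball C" for C w
  proof -
    have "horoball C \<inter> horoball (mat 1) = {}" using disj(1) that(1,2) by blast
    then show ?thesis
      using horoball_near_standard[OF det[OF that(1)], of "fst w" "snd w" "fst y"] that(3,4)
      by (auto simp: V_def dist_norm norm_minus_commute)
  qed
  have cl: "closed (horoball C \<inter> {w. snd w \<ge> 9/10})" if C: "C \<in> S" for C
  proof -
    define c d where "c = matrix_inv C$2$1" and "d = matrix_inv C$2$2"
    have "horoball C \<inter> {w. snd w \<ge> 9/10}
        = {w. (cmod (c * fst w + d))\<^sup>2 + (cmod c)\<^sup>2 * (snd w)\<^sup>2 \<le> snd w} \<inter> {w. 9/10 \<le> snd w}"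
      using mem_horoball_inv_iff[OF det[OF C] _ c_def d_def] by (auto simp: H3_def)
    also have "closed \<dots>" by (intro closed_Int closed_Collect_le continuous_intros)
    finally show ?thesis .
  qed
  show ?thesis
  proof (cases "\<exists>C\<in>S. horoball C \<noteq> horoball (mat 1) \<and> V \<inter> horoball C \<noteq> {}")
    case False
    then show ?thesis using V by blast
  next
    case True
    then obtain C where C: "C \<in> S" "horoball C \<noteq> horoball (mat 1)" "V \<inter> horoball C \<noteq> {}" by blast
    define U where "U = V - (horoball C \<inter> {w. snd w \<ge> 9/10})"
    have UV: "U = V - horoball C" by (auto simp: U_def V_def)
    have "open U" unfolding U_def using V(1) cl[OF C(1)] by (rule open_Diff)
    moreover have "y \<in> U"
      using disj(1)[OF C(1)] C(2) V(2) y by (auto simp: UV horoball_standard)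
    moreover have "U \<inter> horoball C' \<subseteq> horoball (mat 1)" if C': "C' \<in> S" for C'
    proof (cases "horoball C' = horoball (mat 1)")
      case False
      have "horoball C' = horoball C" if "w \<in> V" "w \<in> horoball C'" for w
        using near[OF C' False that] near[OF C(1,2)] C(3) disj(2)[OF C' C(1)] by blast
      then show ?thesis by (auto simp: UV)
    qed auto
    ultimately show ?thesis using V(3) UV by blast
  qed
qed

lemma closedin_horoball:
  assumes "det A = 1" shows "closedin (top_of_set H3) (horoball A)"
proof -
  have "horoball A = H3 \<inter> (\<lambda>y. snd (H3_act (matrix_inv A) y)) -` {1..}"
    using mem_horoball_iff[OF assms] horoball_subset_H3[OF assms] by auto
  moreover have "continuous_on H3 (\<lambda>y. snd (H3_act (matrix_inv A) y))"
    by (intro continuous_on_snd continuous_H3_act matrix_inv_cancel assms)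
  ultimately show ?thesis by (metis closed_atLeast continuous_closedin_preimage)
qed

lemma horoballs_locally_finite:
  assumes A: "det A = 1"
    and det: "\<And>C. C \<in> S \<Longrightarrow> det C = 1"
    and disj: "\<And>C. C \<in> S \<Longrightarrow> horoball C = horoball A \<or> horoball C \<inter> horoball A = {}"
      "\<And>C C'. C \<in> S \<Longrightarrow> C' \<in> S \<Longrightarrow> horoball C = horoball C' \<or> horoball C \<inter> horoball C' = {}"
    and y: "y \<in> horoball A"
  shows "\<exists>U. open U \<and> y \<in> U \<and> U \<subseteq> H3 \<and> (\<forall>C\<in>S. U \<inter> horoball C \<subseteq> horoball A)"
proof -
  define A' where "A' = matrix_inv A"
  have A': "det A' = 1" "A' ** A = mat 1" using A by (simp_all add: A'_def matrix_inv_cancel)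
  have im: "horoball (A' ** C) = H3_act A' ` horoball C" if "det C = 1" for C
    using H3_act_image_horoball[OF A'(1) that] by simp
  have inj: "inj_on (H3_act A') H3"
    using H3_act_inverse(2)[OF A] unfolding A'_def by (intro inj_onI) metis
  have sub: "horoball C \<subseteq> H3" if "C \<in> S" for C using horoball_subset_H3 det that by blast
  have tr: "horoball (A' ** C) = horoball (A' ** C') \<or> horoball (A' ** C) \<inter> horoball (A' ** C') = {}"
    if "det C = 1" "det C' = 1" "horoball C = horoball C' \<or> horoball C \<inter> horoball C' = {}" for C C'
    using that(3) inj_on_image_Int[OF inj horoball_subset_H3[OF that(1)] horoball_subset_H3[OF that(2)]]
    unfolding im[OF that(1)] im[OF that(2)] by auto
  have "\<exists>U. open U \<and> H3_act A' y \<in> U \<and> U \<subseteq> H3 \<and> (\<forall>C\<in>(\<lambda>C. A' ** C) ` S. U \<inter> horoball C \<subseteq> horoball (mat 1))"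
  proof (rule horoballs_locally_finite_standard)
    show "snd (H3_act A' y) \<ge> 1"
      using mem_horoball_iff[OF A, of y] y horoball_subset_H3[OF A] A'_def by blast
    show "det D = 1" if "D \<in> (\<lambda>C. A' ** C) ` S" for D
      using that det A' by (auto simp: det_mul)
    show "horoball D = horoball (mat 1) \<or> horoball D \<inter> horoball (mat 1) = {}" if D: "D \<in> (\<lambda>C. A' ** C) ` S" for D
    proof -
      obtain C where C: "C \<in> S" "D = A' ** C" using D by blast
      show ?thesis using tr[OF det[OF C(1)] A disj(1)[OF C(1)]] unfolding C(2) A'(2) .
    qed
    show "horoball D = horoball D' \<or> horoball D \<inter> horoball D' = {}"
      if D: "D \<in> (\<lambda>C. A' ** C) ` S" "D' \<in> (\<lambda>C. A' ** C) ` S" for D D'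
    proof -
      obtain C C' where C: "C \<in> S" "D = A' ** C" "C' \<in> S" "D' = A' ** C'" using D by blast
      show ?thesis using tr[OF det[OF C(1)] det[OF C(3)] disj(2)[OF C(1,3)]] unfolding C .
    qed
  qed
  then obtain U where U: "open U" "H3_act A' y \<in> U" "U \<subseteq> H3"
    "\<And>C. C \<in> S \<Longrightarrow> U \<inter> horoball (A' ** C) \<subseteq> horoball (A' ** A)" unfolding A'(2) by blast
  define V where "V = H3 \<inter> H3_act A' -` U"
  have "open V" unfolding V_def
    by (rule continuous_open_preimage) (use continuous_H3_act A' H3_open_convex U in auto)
  moreover have "y \<in> V" using U(2) y horoball_subset_H3[OF A] by (auto simp: V_def)
  moreover have "w \<in> horoball A" if "C \<in> S" "w \<in> V" "w \<in> horoball C" for C w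
  proof -
    have "H3_act A' w \<in> U \<inter> horoball (A' ** C)"
      using that im[OF det] by (auto simp: V_def)
    then have "H3_act A' w \<in> H3_act A' ` horoball A" using U(4) that(1) im[OF A] by blast
    then show ?thesis
      using inj horoball_subset_H3[OF A] sub that by (auto simp: inj_on_def)
  qed
  moreover have "V \<subseteq> H3" by (simp add: V_def)
  ultimately show ?thesis by (intro exI[of _ V]) blast
qed

lemma horoball_family_component:
  assumes A: "det A = 1" "A \<in> S"
    and det: "\<And>C. C \<in> S \<Longrightarrow> det C = 1"
    and disj: "\<And>C C'. C \<in> S \<Longrightarrow> C' \<in> S \<Longrightarrow> horoball C = horoball C' \<or> horoball C \<inter> horoball C' = {}"
    and x: "x \<in> horoball A"
  shows "connected_component_set (\<Union>C\<in>S. horoball C) x = horoball A"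
proof
  show "horoball A \<subseteq> connected_component_set (\<Union>C\<in>S. horoball C) x"
    by (rule connected_component_maximal) (use A x connected_horoball in auto)
next
  define T where "T = connected_component_set (\<Union>C\<in>S. horoball C) x"
  have T: "connected T" "T \<subseteq> (\<Union>C\<in>S. horoball C)"
    unfolding T_def by (rule connected_connected_component, rule connected_component_subset)
  have TH: "T \<subseteq> H3" using T(2) horoball_subset_H3 det by blast
  have xT: "x \<in> T" unfolding T_def using A x by auto
  define W where "W = {U. open U \<and> U \<subseteq> H3 \<and> (\<forall>C\<in>S. U \<inter> horoball C \<subseteq> horoball A)}"
  have "\<exists>U\<in>W. y \<in> U" if y: "y \<in> horoball A" for y
  proof -
    obtain U where "open U" "y \<in> U" "U \<subseteq> H3" "\<forall>C\<in>S. U \<inter> horoball C \<subseteq> horoball A"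
      using horoballs_locally_finite[where S = S, OF A(1) det disj[OF _ A(2)] disj y] by auto
    then have "U \<in> W" by (simp add: W_def)
    then show ?thesis using \<open>y \<in> U\<close> ..
  qed
  moreover have "y \<in> horoball A" if "y \<in> T" "U \<in> W" "y \<in> U" for y U
  proof -
    obtain C where "C \<in> S" "y \<in> horoball C" using T(2) \<open>y \<in> T\<close> by blast
    moreover from this have "U \<inter> horoball C \<subseteq> horoball A" using \<open>U \<in> W\<close> by (simp add: W_def)
    ultimately show ?thesis using \<open>y \<in> U\<close> by blast
  qed
  ultimately have "T \<inter> horoball A = T \<inter> \<Union>W" by auto
  moreover have "open (\<Union>W)" by (auto simp: W_def)
  ultimately have "openin (top_of_set T) (T \<inter> horoball A)" by (metis openin_open_Int)
  moreover have "closedin (top_of_set T) (T \<inter> horoball A)"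
  proof -
    obtain K where K: "closed K" "horoball A = H3 \<inter> K"
      using closedin_horoball[OF A(1)] by (auto simp: closedin_closed)
    then have "T \<inter> horoball A = T \<inter> K" using TH by blast
    then show ?thesis using K(1) by (simp add: closedin_closed_Int)
  qed
  ultimately have "T \<inter> horoball A = {} \<or> T \<inter> horoball A = T" using T(1) connected_clopen by blast
  then show "T \<subseteq> horoball A" using xT x by blast
qed

lemma stabilizer_standard_horoball:
  assumes C: "det C = 1" and im: "horoball C = horoball (mat 1)"
  shows "C$2$1 = 0" "cmod (C$1$1) = 1"
proof -
  have low: "(B$2$1) = 0 \<and> cmod (B$2$2) \<le> 1" if B: "det B = 1" "horoball (matrix_inv B) = horoball (mat 1)" for B
  proof -
    define c d where "c = B$2$1" and "d = B$2$2"
    have mem: "(cmod (c * z + d))\<^sup>2 + (cmod c)\<^sup>2 * t\<^sup>2 \<le> t" if "t \<ge> 1" for z t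
      using mem_horoball_inv_iff[of "matrix_inv B" z t c d] that B
      by (simp add: H3_def matrix_inv_cancel matrix_inv_inv c_def d_def horoball_standard)
    have "c = 0"
    proof (rule ccontr)
      assume c: "c \<noteq> 0"
      define t where "t = 1 + 1 / (cmod c)\<^sup>2"
      have "t \<ge> 1" by (simp add: t_def)
      then have "(cmod c)\<^sup>2 * t\<^sup>2 \<le> t" using mem[of t "- d / c"] c by simp
      then have "(cmod c)\<^sup>2 * t \<le> 1" using \<open>t \<ge> 1\<close> by (simp add: power2_eq_square)
      moreover have "(cmod c)\<^sup>2 * t = (cmod c)\<^sup>2 + 1" using c by (simp add: t_def distrib_left)
      ultimately show False using c by simp
    qed
    moreover from this have "cmod d \<le> 1" using mem[of 1 0] by (simp add: power2_eq_square abs_square_le_1 flip: power2_eq_square)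
    ultimately show ?thesis by (simp add: c_def d_def)
  qed
  have inv: "horoball (matrix_inv C) = horoball (mat 1)"
    using H3_act_image_horoball[OF matrix_inv_cancel(3)[OF C] C] H3_act_image_horoball[OF matrix_inv_cancel(3)[OF C], of "mat 1"] im
    by (simp add: matrix_inv_cancel C)
  have 1: "C$2$1 = 0" "cmod (C$2$2) \<le> 1" using low[OF C inv] by simp_all
  have "cmod (C$1$1) \<le> 1"
    using low[of "matrix_inv C"] C im
    by (simp add: matrix_inv_inv matrix_inv_cancel) (simp add: matrix_inv_det_1 adjugate2_def)
  moreover have "cmod (C$1$1) * cmod (C$2$2) = 1"
    using C 1 by (simp add: det_2 flip: norm_mult)
  moreover have "cmod (C$1$1) * cmod (C$2$2) \<le> cmod (C$1$1) * 1"
    using 1(2) by (intro mult_left_mono) auto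
  ultimately show "C$2$1 = 0" "cmod (C$1$1) = 1" using 1(1) by auto
qed

text \<open>An element with unimodular diagonal \<open>(a, 1/a)\<close>, \<open>a\<^sup>2 \<noteq> 1\<close>, is a rotation about a vertical
  line and so has a fixed point.\<close>

lemma upper_triangular_fixed_point:
  assumes C: "det C = 1" "C$2$1 = 0" "cmod (C$1$1) = 1" and ne: "(C$1$1)\<^sup>2 \<noteq> 1"
  obtains w where "w \<in> H3" "H3_act C w = w"
proof -
  define a b where "a = C$1$1" and "b = C$1$2"
  have a: "a \<noteq> 0" "cmod a = 1" "a\<^sup>2 \<noteq> 1" using assms by (auto simp: a_def)
  have d: "C$2$2 = 1 / a" using C a by (simp add: det_2 a_def field_simps)
  define z where "z = a * b / (1 - a\<^sup>2)"
  have "cnj (1 / a) = a" using a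
    by (metis complex_cnj_divide complex_cnj_one complex_div_cnj div_by_1 complex_cnj_cnj of_real_1 power_one divide_inverse mult_1 complex_cnj_inverse)
  moreover have "(a * z + b) * a = z"
    using a(3) unfolding z_def by (simp add: field_simps power2_eq_square)
  ultimately have "H3_act C (z, 1) = (z, 1)"
    using C a d unfolding H3_act_def Let_def
    by (simp add: norm_divide flip: a_def b_def)
  then show ?thesis using that[of "(z, 1)"] by (simp add: H3_def)
qed

section \<open>Fundamental groups and deck-transformations\<close>

definition loops_at :: "'m::topological_space set \<Rightarrow> 'm \<Rightarrow> (real \<Rightarrow> 'm) set" where
  "loops_at M y = {p. path p \<and> path_image p \<subseteq> M \<and> pathstart p = y \<and> pathfinish p = y}"

lemma loop_class_eq: "homotopic_paths M p q \<Longrightarrow> loop_class M p = loop_class M q"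
  unfolding loop_class_def
  by (intro Collect_cong iffI) (blast intro: homotopic_paths_sym homotopic_paths_trans)+

lemma carrier_fundamental_group:
  "carrier (fundamental_group M y) = loop_class M ` loops_at M y"
  by (auto simp: fundamental_group_def loops_at_def)

lemma subspace_loops_eq: "subspace_loops M S y = loop_class M ` loops_at S y"
  by (auto simp: subspace_loops_def loops_at_def)

lemma mult_fundamental_group:
  assumes "path p" "path_image p \<subseteq> M" "path q" "path_image q \<subseteq> M" "pathfinish p = pathstart q"
  shows "loop_class M p \<otimes>\<^bsub>fundamental_group M y\<^esub> loop_class M q = loop_class M (p +++ q)"
proof -
  have "loop_class M (p' +++ q') = loop_class M (p +++ q)"
    if "homotopic_paths M p p'" "homotopic_paths M q q'" for p' q'
    using homotopic_paths_join[OF that assms(5)] loop_class_eq homotopic_paths_sym by metis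
  moreover have "p \<in> loop_class M p" "q \<in> loop_class M q"
    using assms by (simp_all add: loop_class_def)
  ultimately have "(\<Union>p'\<in>loop_class M p. \<Union>q'\<in>loop_class M q. loop_class M (p' +++ q')) = loop_class M (p +++ q)"
    unfolding loop_class_def[of M p] loop_class_def[of M q] by blast
  then show ?thesis by (simp add: fundamental_group_def)
qed

lemma mult_fundamental_group_loops:
  "p \<in> loops_at M y \<Longrightarrow> q \<in> loops_at M y \<Longrightarrow>
    loop_class M p \<otimes>\<^bsub>fundamental_group M y\<^esub> loop_class M q = loop_class M (p +++ q)"
  by (rule mult_fundamental_group) (auto simp: loops_at_def)

lemma covering_space_pullback:
  fixes p :: "'b::topological_space \<Rightarrow> 'a::topological_space" and f :: "'c::topological_space \<Rightarrow> 'a"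
  assumes cov: "covering_space C p S" and f: "continuous_on U f" "f \<in> U \<rightarrow> S"
  shows "covering_space {w \<in> U \<times> C. f (fst w) = p (snd w)} fst U"
proof
  define E where "E = {w \<in> U \<times> C. f (fst w) = p (snd w)}"
  show "continuous_on E fst" by (intro continuous_intros)
  have surj: "p ` C = S" using cov by (rule covering_space_imp_surjective)
  show "fst ` E = U"
  proof
    show "U \<subseteq> fst ` E"
    proof
      fix u assume "u \<in> U"
      then obtain c where "c \<in> C" "f u = p c" using f(2) surj by blast
      then have "(u, c) \<in> E" using \<open>u \<in> U\<close> by (simp add: E_def)
      then show "u \<in> fst ` E" by force
    qed
  qed (auto simp: E_def)
  fix u assume u: "u \<in> U"
  then have "f u \<in> S" using f(2) by blast
  then obtain T v where T: "f u \<in> T" "openin (top_of_set S) T" and v: "\<Union>v = C \<inter> p -` T"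
    "\<And>V. V \<in> v \<Longrightarrow> openin (top_of_set C) V" "pairwise disjnt v"
    "\<And>V. V \<in> v \<Longrightarrow> \<exists>q. homeomorphism V T p q"
    using cov unfolding covering_space_def by meson
  define T' where "T' = U \<inter> f -` T"
  define W where "W V = {w \<in> E. snd w \<in> V}" for V
  have W: "W V = {w \<in> T' \<times> V. f (fst w) = p (snd w)}" if "V \<in> v" for V
    using v(1) that by (auto simp: W_def E_def T'_def)
  have "\<Union>(W ` v) = E \<inter> fst -` T'"
    using v(1) by (auto simp: W_def E_def T'_def)
  moreover have "\<forall>V'\<in>W ` v. openin (top_of_set E) V'"
  proof
    fix V' assume V': "V' \<in> W ` v"
    obtain V where V: "V \<in> v" "V' = W V" using V' by blast
    have "V' = E \<inter> snd -` V" using V by (auto simp: W_def)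
    moreover have "continuous_on E snd" by (intro continuous_intros)
    moreover have "snd \<in> E \<rightarrow> C" by (auto simp: E_def)
    ultimately show "openin (top_of_set E) V'" using v(2)[OF V(1)] by (metis continuous_openin_preimage)
  qed
  moreover have "pairwise disjnt (W ` v)"
    using v(3) by (fastforce simp: pairwise_def disjnt_def W_def)
  moreover have "\<forall>V'\<in>W ` v. \<exists>q. homeomorphism V' T' fst q"
  proof
    fix V' assume V': "V' \<in> W ` v"
    obtain V where V: "V \<in> v" "V' = W V" using V' by blast
    obtain q where q: "homeomorphism V T p q" using v(4) V(1) by blast
    have VE: "V \<subseteq> C" using v(1) V(1) by blast
    have cont: "continuous_on T' (\<lambda>t. (t, q (f t)))"
    proof (intro continuous_on_Pair continuous_on_id)
      have "continuous_on T' f" using f(1) by (rule continuous_on_subset) (simp add: T'_def)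
      moreover have "continuous_on (f ` T') q"
        using homeomorphism_cont2[OF q] by (rule continuous_on_subset) (auto simp: T'_def)
      ultimately show "continuous_on T' (\<lambda>t. q (f t))"
        using continuous_on_compose[of T' f q] by (simp add: o_def)
    qed
    have "homeomorphism V' T' fst (\<lambda>t. (t, q (f t)))"
      unfolding V(2) W[OF V(1)]
    proof (rule homeomorphismI[OF _ cont])
      show "continuous_on {w \<in> T' \<times> V. f (fst w) = p (snd w)} fst" by (intro continuous_intros)
    qed (use homeomorphism_apply1[OF q] homeomorphism_apply2[OF q] homeomorphism_image2[OF q] in
      \<open>auto simp: T'_def\<close>)
    then show "\<exists>q. homeomorphism V' T' fst q" by (rule exI[of _ "\<lambda>t. (t, q (f t))"])
  qed
  moreover have "openin (top_of_set U) T'"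
    unfolding T'_def using f T(2) by (metis continuous_openin_preimage)
  moreover have "u \<in> T'" using u T(1) by (simp add: T'_def)
  ultimately show "\<exists>T. u \<in> T \<and> openin (top_of_set U) T \<and>
      (\<exists>v. \<Union>v = E \<inter> fst -` T \<and> (\<forall>u\<in>v. openin (top_of_set E) u) \<and>
        pairwise disjnt v \<and> (\<forall>u\<in>v. \<exists>q. homeomorphism u T fst q))"
    by (intro exI[of _ T'] exI[of _ "W ` v"] conjI)
qed

text \<open>The lifting theorems of the library need a normed space below the covering; the pullback
  to the convex domain \<open>U\<close> provides one.\<close>

lemma covering_space_lift_convex:
  fixes p :: "'b::real_normed_vector \<Rightarrow> 'a::topological_space" and f :: "'c::real_normed_vector \<Rightarrow> 'a"
  assumes cov: "covering_space C p S" and U: "convex U" "z \<in> U" and a: "a \<in> C" "f z = p a"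
    and f: "continuous_on U f" "f \<in> U \<rightarrow> S"
  obtains g where "continuous_on U g" "g \<in> U \<rightarrow> C" "g z = a" "\<And>y. y \<in> U \<Longrightarrow> p (g y) = f y"
proof -
  define E where "E = {w \<in> U \<times> C. f (fst w) = p (snd w)}"
  have cov': "covering_space E fst U" unfolding E_def by (rule covering_space_pullback[OF cov f])
  have "(z, a) \<in> E" using U a by (simp add: E_def)
  moreover have "(\<lambda>y. y) \<in> U \<rightarrow> U" by simp
  moreover have "z = fst (z, a)" by simp
  ultimately obtain k where k: "continuous_on U k" "k \<in> U \<rightarrow> E" "k z = (z, a)" "\<And>y. y \<in> U \<Longrightarrow> fst (k y) = y"
    by (rule covering_space_lift_strong[OF cov' _ U(2) convex_imp_simply_connected[OF U(1)]
        convex_imp_locally_path_connected[OF U(1)] continuous_on_id]) auto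
  show ?thesis
  proof (rule that)
    show "continuous_on U (snd \<circ> k)" using k(1) by (intro continuous_intros) (auto intro: continuous_intros)
    show "snd \<circ> k \<in> U \<rightarrow> C" "(snd \<circ> k) z = a" using k(2,3) by (auto simp: E_def Pi_iff)
    show "p ((snd \<circ> k) y) = f y" if "y \<in> U" for y
      using k(2,4) that by (auto simp: E_def Pi_iff)
  qed
qed

locale hyperbolic_quotient =
  fixes \<Gamma> :: "mat2 set set" and \<pi> :: "complex \<times> real \<Rightarrow> 'm::topological_space" and M :: "'m set"
  assumes hyperbolic: "hyperbolic_3_manifold \<Gamma> \<pi> M"
begin

lemma subgroup: "subgroup \<Gamma> PSL2"
  and free: "\<gamma> \<in> \<Gamma> \<Longrightarrow> y \<in> H3 \<Longrightarrow> psl_H3_act \<gamma> y = y \<Longrightarrow> \<gamma> = \<one>\<^bsub>PSL2\<^esub>"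
  and covering: "covering_space H3 \<pi> M"
  and orbits: "y \<in> H3 \<Longrightarrow> z \<in> H3 \<Longrightarrow> \<pi> y = \<pi> z \<longleftrightarrow> (\<exists>\<gamma>\<in>\<Gamma>. z = psl_H3_act \<gamma> y)"
  using hyperbolic unfolding hyperbolic_3_manifold_def by blast+

lemma in_PSL2: "\<gamma> \<in> \<Gamma> \<Longrightarrow> \<gamma> \<in> carrier PSL2"
  using subgroup.mem_carrier[OF subgroup] .

lemmas mult_closed = subgroup.m_closed[OF subgroup]
lemmas one_closed = subgroup.one_closed[OF subgroup]
lemmas inv_closed = subgroup.m_inv_closed[OF subgroup]

lemma act_in_H3: "\<gamma> \<in> \<Gamma> \<Longrightarrow> y \<in> H3 \<Longrightarrow> psl_H3_act \<gamma> y \<in> H3"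
  using in_PSL2 psl_H3_act_in_H3 by blast

lemma act_mult: "\<gamma> \<in> \<Gamma> \<Longrightarrow> \<eta> \<in> \<Gamma> \<Longrightarrow> y \<in> H3 \<Longrightarrow>
    psl_H3_act (\<gamma> \<otimes>\<^bsub>PSL2\<^esub> \<eta>) y = psl_H3_act \<gamma> (psl_H3_act \<eta> y)"
  using in_PSL2 psl_H3_act_mult by blast

lemma act_inv: "\<gamma> \<in> \<Gamma> \<Longrightarrow> y \<in> H3 \<Longrightarrow> psl_H3_act (inv\<^bsub>PSL2\<^esub> \<gamma>) (psl_H3_act \<gamma> y) = y"
  "\<gamma> \<in> \<Gamma> \<Longrightarrow> y \<in> H3 \<Longrightarrow> psl_H3_act \<gamma> (psl_H3_act (inv\<^bsub>PSL2\<^esub> \<gamma>) y) = y"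
  using act_mult[of "inv\<^bsub>PSL2\<^esub> \<gamma>" \<gamma> y] act_mult[of \<gamma> "inv\<^bsub>PSL2\<^esub> \<gamma>" y] inv_closed in_PSL2 group_PSL2
  by (simp_all add: group.l_inv group.r_inv psl_H3_act_one)

lemma act_inj: "\<gamma> \<in> \<Gamma> \<Longrightarrow> inj_on (psl_H3_act \<gamma>) H3"
  using act_inv(1) by (intro inj_onI) metis

lemma proj_act: "\<gamma> \<in> \<Gamma> \<Longrightarrow> y \<in> H3 \<Longrightarrow> \<pi> (psl_H3_act \<gamma> y) = \<pi> y"
  using orbits[of y "psl_H3_act \<gamma> y"] act_in_H3 by auto

lemma proj_in: "y \<in> H3 \<Longrightarrow> \<pi> y \<in> M"
  using covering_space_imp_surjective[OF covering] by blast

lemma continuous_proj: "continuous_on H3 \<pi>"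
  by (rule covering_space_imp_continuous[OF covering])

lemma lift_path:
  assumes "path p" "path_image p \<subseteq> M" "y \<in> H3" "pathstart p = \<pi> y"
  obtains q where "path q" "path_image q \<subseteq> H3" "pathstart q = y" "\<And>t. t \<in> {0..1} \<Longrightarrow> \<pi> (q t) = p t"
proof -
  obtain q where "continuous_on {0..1} q" "q \<in> {0..1} \<rightarrow> H3" "q 0 = y" "\<And>t. t \<in> {0..1} \<Longrightarrow> \<pi> (q t) = p t"
    using covering_space_lift_convex[OF covering, of "{0..1::real}" 0 y p] assms
    by (auto simp: path_def path_image_def pathstart_def image_subset_iff_funcset)
  then show ?thesis using that by (auto simp: path_def path_image_def pathstart_def)
qed

lemma deck_class_eq:
  assumes "path q" "path_image q \<subseteq> H3" "pathstart q = x" "pathfinish q = psl_H3_act \<gamma> x"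
  shows "deck_class \<pi> M x \<gamma> = loop_class M (\<pi> \<circ> q)"
proof -
  have "loop_class M (\<pi> \<circ> q') = loop_class M (\<pi> \<circ> q)"
    if q': "path q'" "path_image q' \<subseteq> H3" "pathstart q' = x" "pathfinish q' = psl_H3_act \<gamma> x" for q'
  proof (rule loop_class_eq)
    have "closed_segment (q' t) (q t) \<subseteq> H3" if "t \<in> {0..1}" for t
      using assms(2) q'(2) that H3_open_convex(2)
      by (intro closed_segment_subset) (auto simp: path_image_def)
    then have "homotopic_paths H3 q' q"
      using assms q' by (intro homotopic_paths_linear) auto
    then show "homotopic_paths M (\<pi> \<circ> q') (\<pi> \<circ> q)"
      using continuous_proj by (rule homotopic_paths_continuous_image) (simp add: proj_in)
  qed
  then show ?thesis unfolding deck_class_def using assms by blast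
qed

lemma deck_class_loop:
  assumes "x \<in> H3" "\<gamma> \<in> \<Gamma>"
  obtains q where "path q" "path_image q \<subseteq> H3" "pathstart q = x" "pathfinish q = psl_H3_act \<gamma> x"
    "\<pi> \<circ> q \<in> loops_at M (\<pi> x)" "deck_class \<pi> M x \<gamma> = loop_class M (\<pi> \<circ> q)"
proof -
  define q where "q = linepath x (psl_H3_act \<gamma> x)"
  have q: "path q" "path_image q \<subseteq> H3" "pathstart q = x" "pathfinish q = psl_H3_act \<gamma> x"
    using assms act_in_H3 H3_open_convex(2) by (auto simp: q_def closed_segment_subset)
  moreover have "\<pi> \<circ> q \<in> loops_at M (\<pi> x)"
    using q assms proj_act proj_in continuous_on_subset[OF continuous_proj q(2)]
    by (auto simp: loops_at_def path_image_compose path_continuous_image pathstart_compose pathfinish_compose)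
  ultimately show ?thesis using that deck_class_eq by blast
qed

lemma deck_class_carrier:
  "x \<in> H3 \<Longrightarrow> \<gamma> \<in> \<Gamma> \<Longrightarrow> deck_class \<pi> M x \<gamma> \<in> carrier (fundamental_group M (\<pi> x))"
  by (metis deck_class_loop carrier_fundamental_group imageI)

lemma deck_class_mult:
  assumes x: "x \<in> H3" and "\<gamma> \<in> \<Gamma>" "\<eta> \<in> \<Gamma>"
  shows "deck_class \<pi> M x (\<gamma> \<otimes>\<^bsub>PSL2\<^esub> \<eta>) =
    deck_class \<pi> M x \<gamma> \<otimes>\<^bsub>fundamental_group M (\<pi> x)\<^esub> deck_class \<pi> M x \<eta>"
proof -
  obtain p where p: "path p" "path_image p \<subseteq> H3" "pathstart p = x" "pathfinish p = psl_H3_act \<gamma> x"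
    "\<pi> \<circ> p \<in> loops_at M (\<pi> x)" "deck_class \<pi> M x \<gamma> = loop_class M (\<pi> \<circ> p)"
    using deck_class_loop x assms(2) .
  obtain q where q: "path q" "path_image q \<subseteq> H3" "pathstart q = x" "pathfinish q = psl_H3_act \<eta> x"
    "\<pi> \<circ> q \<in> loops_at M (\<pi> x)" "deck_class \<pi> M x \<eta> = loop_class M (\<pi> \<circ> q)"
    using deck_class_loop x assms(3) .
  define r where "r = psl_H3_act \<gamma> \<circ> q"
  have r: "path r" "path_image r \<subseteq> H3" "pathstart r = psl_H3_act \<gamma> x"
    "pathfinish r = psl_H3_act (\<gamma> \<otimes>\<^bsub>PSL2\<^esub> \<eta>) x"
    using q assms act_in_H3 continuous_on_subset[OF continuous_psl_H3_act[OF in_PSL2] q(2)] act_mult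
    by (auto simp: r_def path_image_compose path_continuous_image pathstart_compose pathfinish_compose)
  have "path (p +++ r)" "path_image (p +++ r) \<subseteq> H3" "pathstart (p +++ r) = x"
    "pathfinish (p +++ r) = psl_H3_act (\<gamma> \<otimes>\<^bsub>PSL2\<^esub> \<eta>) x"
    using p r by (auto simp: path_image_join)
  then have 1: "deck_class \<pi> M x (\<gamma> \<otimes>\<^bsub>PSL2\<^esub> \<eta>) = loop_class M ((\<pi> \<circ> p) +++ (\<pi> \<circ> r))"
    using deck_class_eq[of "p +++ r"] by (simp add: path_compose_join)
  have eq: "\<pi> (q t) = \<pi> (r t)" if "t \<in> {0..1}" for t
  proof -
    have "q t \<in> H3" using q(2) that by (auto simp: path_image_def)
    then show ?thesis using proj_act[OF assms(2)] by (simp add: r_def)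
  qed
  have hpath: "homotopic_paths M (\<pi> \<circ> q) (\<pi> \<circ> r)"
    using q(5) eq by (intro homotopic_paths_eq) (auto simp: loops_at_def)
  have 2: "loop_class M (\<pi> \<circ> q) = loop_class M (\<pi> \<circ> r)" using hpath by (rule loop_class_eq)
  have "\<pi> \<circ> r \<in> loops_at M (\<pi> x)"
    using hpath q(5) homotopic_paths_imp_path[OF hpath] homotopic_paths_imp_subset[OF hpath]
      homotopic_paths_imp_pathstart[OF hpath] homotopic_paths_imp_pathfinish[OF hpath]
    by (simp add: loops_at_def)
  then show ?thesis
    unfolding 1 p(6) q(6) 2 using mult_fundamental_group_loops[OF p(5)] by metis
qed

lemma loop_lift:
  assumes x: "x \<in> H3" and p: "p \<in> loops_at M (\<pi> x)"
  obtains q \<gamma> where "path q" "path_image q \<subseteq> H3" "pathstart q = x" "\<gamma> \<in> \<Gamma>"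
    "pathfinish q = psl_H3_act \<gamma> x" "\<And>t. t \<in> {0..1} \<Longrightarrow> \<pi> (q t) = p t"
    "loop_class M p = deck_class \<pi> M x \<gamma>"
proof -
  obtain q where q: "path q" "path_image q \<subseteq> H3" "pathstart q = x" "\<And>t. t \<in> {0..1} \<Longrightarrow> \<pi> (q t) = p t"
    using p x by (auto simp: loops_at_def elim: lift_path)
  have "\<pi> (pathfinish q) = \<pi> x" using q(4)[of 1] p by (simp add: loops_at_def pathfinish_def)
  then obtain \<gamma> where \<gamma>: "\<gamma> \<in> \<Gamma>" "pathfinish q = psl_H3_act \<gamma> x"
    using orbits[OF x, of "pathfinish q"] q(2) by auto
  have "homotopic_paths M p (\<pi> \<circ> q)"
    using p q(4) by (intro homotopic_paths_eq) (auto simp: loops_at_def)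
  then have "loop_class M p = deck_class \<pi> M x \<gamma>"
    using deck_class_eq q \<gamma> loop_class_eq by metis
  then show ?thesis using that q \<gamma> by blast
qed

lemma deck_class_hom: "x \<in> H3 \<Longrightarrow> deck_class \<pi> M x \<in> hom (PSL2\<lparr>carrier := \<Gamma>\<rparr>) (fundamental_group M (\<pi> x))"
  using deck_class_carrier deck_class_mult by (simp add: hom_def)

lemma deck_class_surj:
  assumes x: "x \<in> H3"
  shows "deck_class \<pi> M x ` \<Gamma> = carrier (fundamental_group M (\<pi> x))"
proof
  show "carrier (fundamental_group M (\<pi> x)) \<subseteq> deck_class \<pi> M x ` \<Gamma>"
    unfolding carrier_fundamental_group
  proof (rule image_subsetI)
    fix p assume "p \<in> loops_at M (\<pi> x)"
    then obtain \<gamma> where "\<gamma> \<in> \<Gamma>" "loop_class M p = deck_class \<pi> M x \<gamma>" by (rule loop_lift[OF x])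
    then show "loop_class M p \<in> deck_class \<pi> M x ` \<Gamma>" by blast
  qed
qed (use deck_class_carrier[OF x] in blast)

lemma deck_class_one: "x \<in> H3 \<Longrightarrow> deck_class \<pi> M x \<one>\<^bsub>PSL2\<^esub> = \<one>\<^bsub>fundamental_group M (\<pi> x)\<^esub>"
  using deck_class_eq[of "linepath x x" x "\<one>\<^bsub>PSL2\<^esub>"]
  by (simp add: psl_H3_act_one fundamental_group_def o_def)

lemma group_fundamental_group: 
  assumes "x \<in> H3" shows "group (fundamental_group M (\<pi> x))"
proof -
  have "group (fundamental_group M (\<pi> x)\<lparr>carrier := deck_class \<pi> M x ` carrier (PSL2\<lparr>carrier := \<Gamma>\<rparr>),
      one := deck_class \<pi> M x \<one>\<^bsub>PSL2\<lparr>carrier := \<Gamma>\<rparr>\<^esub>\<rparr>)"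
    using subgroup.subgroup_is_group[OF subgroup group_PSL2] deck_class_hom[OF assms]
    by (rule group.hom_imp_img_group)
  then show ?thesis using assms by (simp add: deck_class_surj deck_class_one)
qed

end

section \<open>The cusp\<close>

definition translation2 :: "complex \<Rightarrow> mat2" where
  "translation2 b = vector [vector [1, b], vector [0, 1]]"

lemma translation2_commute: "translation2 b ** translation2 c = translation2 c ** translation2 b"
  by (simp add: translation2_def mat2_simps)

lemma det_translation2: "det (translation2 b) = 1"
  by (simp add: translation2_def det_2)

lemma H3_act_translation2: "H3_act (translation2 b) y = (fst y + b, snd y)"
  by (simp add: translation2_def H3_act_def Let_def)

locale cusped_quotient = hyperbolic_quotient \<Gamma> \<pi> M
  for \<Gamma> and \<pi> :: "complex \<times> real \<Rightarrow> 'm::topological_space" and M +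
  fixes A :: mat2 and x :: "complex \<times> real"
  assumes cusp: "cusp_horoball \<Gamma> A" and base: "x \<in> horosphere A"
begin

definition cusp_stabilizer :: "mat2 set set" where
  "cusp_stabilizer = {\<gamma> \<in> \<Gamma>. psl_H3_act \<gamma> ` horoball A = horoball A}"

definition cusp_preimage :: "(complex \<times> real) set" where
  "cusp_preimage = {y \<in> H3. \<pi> y \<in> \<pi> ` horoball A}"

lemma det_A: "det A = 1" and translate_disjoint:
  "\<gamma> \<in> \<Gamma> \<Longrightarrow> psl_H3_act \<gamma> ` horoball A = horoball A \<or> psl_H3_act \<gamma> ` horoball A \<inter> horoball A = {}"
  using cusp by (auto simp: cusp_horoball_def)

lemma horoball_H3: "horoball A \<subseteq> H3"
  by (rule horoball_subset_H3[OF det_A])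

lemma base_horoball: "x \<in> horoball A"
  using base horosphere_subset_horoball by blast

lemma base_H3: "x \<in> H3"
  using base_horoball horoball_H3 by blast

lemma translate_eq:
  assumes "\<gamma> \<in> \<Gamma>" "g \<in> \<gamma>" shows "psl_H3_act \<gamma> ` horoball A = horoball (g ** A)"
proof -
  have "psl_H3_act \<gamma> = H3_act g" using psl_H3_act_eq in_PSL2 assms by blast
  then show ?thesis using H3_act_image_horoball PSL2_memD(1) in_PSL2 assms det_A by metis
qed

lemma translate_comp:
  assumes "\<gamma> \<in> \<Gamma>" "\<eta> \<in> \<Gamma>"
  shows "psl_H3_act \<gamma> ` psl_H3_act \<eta> ` horoball A = psl_H3_act (\<gamma> \<otimes>\<^bsub>PSL2\<^esub> \<eta>) ` horoball A"
  unfolding image_image by (rule image_cong) (use assms act_mult horoball_H3 in auto)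

lemma translates_disjoint:
  assumes "\<gamma> \<in> \<Gamma>" "\<eta> \<in> \<Gamma>" "psl_H3_act \<gamma> ` horoball A \<inter> psl_H3_act \<eta> ` horoball A \<noteq> {}"
  shows "psl_H3_act \<gamma> ` horoball A = psl_H3_act \<eta> ` horoball A"
    "inv\<^bsub>PSL2\<^esub> \<gamma> \<otimes>\<^bsub>PSL2\<^esub> \<eta> \<in> cusp_stabilizer"
proof -
  define \<zeta> where "\<zeta> = inv\<^bsub>PSL2\<^esub> \<gamma> \<otimes>\<^bsub>PSL2\<^esub> \<eta>"
  have \<zeta>: "\<zeta> \<in> \<Gamma>" using assms inv_closed mult_closed by (simp add: \<zeta>_def)
  have "\<gamma> \<otimes>\<^bsub>PSL2\<^esub> \<zeta> = \<eta>"
    using assms in_PSL2 group_PSL2 inv_closed unfolding \<zeta>_def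
    by (metis group.inv_solve_left group.is_monoid monoid.m_closed)
  then have im: "psl_H3_act \<eta> ` horoball A = psl_H3_act \<gamma> ` psl_H3_act \<zeta> ` horoball A"
    using translate_comp[OF assms(1) \<zeta>] by simp
  obtain b c where bc: "b \<in> horoball A" "c \<in> psl_H3_act \<zeta> ` horoball A" "psl_H3_act \<gamma> b = psl_H3_act \<gamma> c"
    using assms(3) unfolding im by blast
  have "c \<in> H3" using bc(2) horoball_H3 act_in_H3[OF \<zeta>] by blast
  then have "b = c" using act_inj[OF assms(1)] bc horoball_H3 by (auto simp: inj_on_def)
  then have *: "psl_H3_act \<zeta> ` horoball A = horoball A" using translate_disjoint[OF \<zeta>] bc by blast
  then show "psl_H3_act \<gamma> ` horoball A = psl_H3_act \<eta> ` horoball A" unfolding im by simp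
  show "inv\<^bsub>PSL2\<^esub> \<gamma> \<otimes>\<^bsub>PSL2\<^esub> \<eta> \<in> cusp_stabilizer"
    using * \<zeta> by (simp add: cusp_stabilizer_def \<zeta>_def)
qed

lemma cusp_preimage_eq: "cusp_preimage = (\<Union>\<gamma>\<in>\<Gamma>. psl_H3_act \<gamma> ` horoball A)"
proof
  show "cusp_preimage \<subseteq> (\<Union>\<gamma>\<in>\<Gamma>. psl_H3_act \<gamma> ` horoball A)"
  proof
    fix y assume "y \<in> cusp_preimage"
    then obtain b where "y \<in> H3" "b \<in> horoball A" "\<pi> b = \<pi> y" by (auto simp: cusp_preimage_def)
    then show "y \<in> (\<Union>\<gamma>\<in>\<Gamma>. psl_H3_act \<gamma> ` horoball A)" using orbits[of b y] horoball_H3 by blast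
  qed
  show "(\<Union>\<gamma>\<in>\<Gamma>. psl_H3_act \<gamma> ` horoball A) \<subseteq> cusp_preimage"
    unfolding cusp_preimage_def using horoball_H3 act_in_H3 proj_act by fastforce
qed

lemma cusp_component:
  assumes "b \<in> horoball A"
  shows "connected_component_set cusp_preimage b = horoball A"
proof -
  define S where "S = {g ** A |g. g \<in> \<Union>\<Gamma>}"
  have hS: "\<exists>\<gamma>\<in>\<Gamma>. psl_H3_act \<gamma> ` horoball A = horoball C" if "C \<in> S" for C
  proof -
    obtain g \<gamma> where "g \<in> \<gamma>" "\<gamma> \<in> \<Gamma>" "C = g ** A" using \<open>C \<in> S\<close> by (auto simp: S_def)
    then show ?thesis using translate_eq by blast
  qed
  have "mat 1 \<in> \<Union>\<Gamma>" using one_closed one_PSL2 by blast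
  moreover have "A = mat 1 ** A" by simp
  ultimately have "A \<in> S" unfolding S_def by blast
  have "cusp_preimage = (\<Union>C\<in>S. horoball C)"
  proof
    show "cusp_preimage \<subseteq> (\<Union>C\<in>S. horoball C)"
      unfolding cusp_preimage_eq
    proof (rule UN_least)
      fix \<gamma> assume \<gamma>: "\<gamma> \<in> \<Gamma>"
      obtain g where "g \<in> \<gamma>" using PSL2_nonempty in_PSL2 \<gamma> by blast
      then show "psl_H3_act \<gamma> ` horoball A \<subseteq> (\<Union>C\<in>S. horoball C)"
        using translate_eq[OF \<gamma>] \<gamma> by (auto simp: S_def)
    qed
    show "(\<Union>C\<in>S. horoball C) \<subseteq> cusp_preimage"
      unfolding cusp_preimage_eq using hS by blast
  qed
  moreover have "connected_component_set (\<Union>C\<in>S. horoball C) b = horoball A"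
  proof (rule horoball_family_component[OF det_A \<open>A \<in> S\<close> _ _ assms])
    show "det C = 1" if "C \<in> S" for C
    proof -
      obtain g \<gamma> where g: "g \<in> \<gamma>" "\<gamma> \<in> \<Gamma>" "C = g ** A" using \<open>C \<in> S\<close> by (auto simp: S_def)
      then have "det g = 1" using PSL2_memD(1)[OF in_PSL2] by blast
      then show ?thesis by (simp add: g(3) det_mul det_A)
    qed
    show "horoball C = horoball C' \<or> horoball C \<inter> horoball C' = {}" if CC: "C \<in> S" "C' \<in> S" for C C'
      using hS[OF CC(1)] hS[OF CC(2)] translates_disjoint(1) by metis
  qed
  ultimately show ?thesis by simp
qed

lemma connected_in_translate:
  assumes "connected T" "T \<subseteq> cusp_preimage" "\<gamma> \<in> \<Gamma>" "T \<inter> psl_H3_act \<gamma> ` horoball A \<noteq> {}"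
  shows "T \<subseteq> psl_H3_act \<gamma> ` horoball A"
proof -
  define \<eta> where "\<eta> = inv\<^bsub>PSL2\<^esub> \<gamma>"
  have \<eta>: "\<eta> \<in> \<Gamma>" using assms(3) inv_closed by (simp add: \<eta>_def)
  obtain b where b: "b \<in> horoball A" "psl_H3_act \<gamma> b \<in> T" using assms(4) by blast
  have TH: "T \<subseteq> H3" using assms(2) by (auto simp: cusp_preimage_def)
  have "connected (psl_H3_act \<eta> ` T)"
    using continuous_on_subset[OF continuous_psl_H3_act[OF in_PSL2[OF \<eta>]] TH] assms(1)
    by (rule connected_continuous_image)
  moreover have "psl_H3_act \<eta> ` T \<subseteq> cusp_preimage"
    using assms(2) \<eta> act_in_H3 proj_act by (auto simp: cusp_preimage_def)
  moreover have "b \<in> psl_H3_act \<eta> ` T"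
    using b act_inv(1)[OF assms(3)] horoball_H3 unfolding \<eta>_def by (metis image_eqI subsetD)
  ultimately have "psl_H3_act \<eta> ` T \<subseteq> horoball A"
    using connected_component_maximal cusp_component[OF b(1)] by metis
  show ?thesis
  proof
    fix y assume "y \<in> T"
    then have "psl_H3_act \<eta> y \<in> horoball A" "psl_H3_act \<gamma> (psl_H3_act \<eta> y) = y"
      using \<open>psl_H3_act \<eta> ` T \<subseteq> horoball A\<close> act_inv(2)[OF assms(3), of y] TH unfolding \<eta>_def by blast+
    then show "y \<in> psl_H3_act \<gamma> ` horoball A" by (metis image_eqI)
  qed
qed

lemma cusp_stabilizer_parabolic:
  assumes "\<gamma> \<in> cusp_stabilizer"
  obtains b where "A ** translation2 b ** matrix_inv A \<in> \<gamma>"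
proof -
  have \<gamma>: "\<gamma> \<in> \<Gamma>" "psl_H3_act \<gamma> ` horoball A = horoball A"
    using assms by (auto simp: cusp_stabilizer_def)
  obtain g where g: "g \<in> \<gamma>" using PSL2_nonempty in_PSL2 \<gamma> by blast
  have dg: "det g = 1" using PSL2_memD(1) in_PSL2 \<gamma>(1) g by blast
  define C where "C = matrix_inv A ** (g ** A)"
  note inv = matrix_inv_cancel[OF det_A]
  have dC: "det C = 1" by (simp add: C_def det_mul inv dg det_A)
  have gA: "g ** A = A ** C" by (simp add: C_def matrix_mul_assoc inv)
  have gC: "g = A ** C ** matrix_inv A"
    unfolding gA[symmetric] by (simp add: inv flip: matrix_mul_assoc)
  have "horoball C = H3_act (matrix_inv A) ` horoball (g ** A)"
    unfolding C_def by (rule H3_act_image_horoball[symmetric]) (simp_all add: inv dg det_A det_mul)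
  also have "\<dots> = horoball (matrix_inv A ** A)"
    using translate_eq[OF \<gamma>(1) g] \<gamma>(2) H3_act_image_horoball[OF inv(3) det_A] by simp
  finally have hC: "horoball C = horoball (mat 1)" by (simp add: inv)
  note st = stabilizer_standard_horoball[OF dC hC]
  have "(C$1$1)\<^sup>2 = 1"
  proof (rule ccontr)
    assume ne: "(C$1$1)\<^sup>2 \<noteq> 1"
    obtain w where w: "w \<in> H3" "H3_act C w = w" by (rule upper_triangular_fixed_point[OF dC st ne])
    have "H3_act g (H3_act A w) = H3_act A w"
      using H3_act_mult[OF dg det_A w(1)] H3_act_mult[OF det_A dC w(1)] gA w(2) by simp
    then have "\<gamma> = \<one>\<^bsub>PSL2\<^esub>"
      using free[OF \<gamma>(1) H3_act_in_H3[OF det_A w(1)]] psl_H3_act_eq[OF in_PSL2[OF \<gamma>(1)] g] by simp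
    then have "g = mat 1 \<or> g = - mat 1" using g one_PSL2 by auto
    then have "C = mat 1 \<or> C = - mat 1" by (auto simp: C_def inv matrix_mult_uminus)
    then show False using ne by (auto simp: mat_def)
  qed
  then consider "C$1$1 = 1" | "C$1$1 = - 1" by (auto simp: power2_eq_1_iff)
  then show ?thesis
  proof cases
    case 1
    then have "C = translation2 (C$1$2)" using dC st by (simp add: translation2_def mat2_simps)
    then show ?thesis using that g gC by metis
  next
    case 2
    then have "C = - translation2 (- C$1$2)" using dC st
      by (simp add: translation2_def mat2_simps minus_equation_iff)
    then have "- g = A ** translation2 (- C$1$2) ** matrix_inv A"
      using gC by (metis add.inverse_inverse matrix_mult_uminus)
    moreover have "- g \<in> \<gamma>" using PSL2_memD(2)[OF in_PSL2[OF \<gamma>(1)] g] by blast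
    ultimately show ?thesis using that by metis
  qed
qed

lemma cusp_stabilizer_commute:
  assumes "\<gamma> \<in> cusp_stabilizer" "\<eta> \<in> cusp_stabilizer"
  shows "\<gamma> \<otimes>\<^bsub>PSL2\<^esub> \<eta> = \<eta> \<otimes>\<^bsub>PSL2\<^esub> \<gamma>"
proof -
  obtain b c where b: "A ** translation2 b ** matrix_inv A \<in> \<gamma>" and c: "A ** translation2 c ** matrix_inv A \<in> \<eta>"
    using cusp_stabilizer_parabolic assms by metis
  have conj: "(A ** T ** matrix_inv A) ** (A ** U ** matrix_inv A) = A ** (T ** U) ** matrix_inv A" for T U
  proof -
    have "(A ** T ** matrix_inv A) ** (A ** U ** matrix_inv A) = A ** T ** (matrix_inv A ** A) ** U ** matrix_inv A"
      by (simp only: matrix_mul_assoc)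
    then show ?thesis by (simp add: matrix_inv_cancel[OF det_A] matrix_mul_assoc)
  qed
  define w where "w = A ** (translation2 b ** translation2 c) ** matrix_inv A"
  have "w \<in> \<gamma> \<otimes>\<^bsub>PSL2\<^esub> \<eta>" using b c unfolding mult_PSL2 w_def conj[symmetric] by blast
  moreover have "w \<in> \<eta> \<otimes>\<^bsub>PSL2\<^esub> \<gamma>"
    using b c unfolding mult_PSL2 w_def translation2_commute[of b] conj[symmetric] by blast
  moreover have "\<gamma> \<otimes>\<^bsub>PSL2\<^esub> \<eta> \<in> carrier PSL2" "\<eta> \<otimes>\<^bsub>PSL2\<^esub> \<gamma> \<in> carrier PSL2"
    using assms mult_closed in_PSL2 by (auto simp: cusp_stabilizer_def)
  ultimately show ?thesis using PSL2_memD(2) by metis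
qed

lemma cusp_stabilizer_path:
  assumes "\<gamma> \<in> cusp_stabilizer"
  obtains q where "path q" "path_image q \<subseteq> horosphere A" "pathstart q = x" "pathfinish q = psl_H3_act \<gamma> x"
proof -
  obtain b where b: "A ** translation2 b ** matrix_inv A \<in> \<gamma>" using cusp_stabilizer_parabolic assms .
  have \<gamma>: "\<gamma> \<in> \<Gamma>" using assms by (simp add: cusp_stabilizer_def)
  note inv = matrix_inv_cancel[OF det_A]
  define y where "y = H3_act (matrix_inv A) x"
  have y: "snd y = 1" "y \<in> H3"
    using mem_horosphere_iff[OF det_A base_H3] base by (simp_all add: y_def H3_def)
  have xy: "x = H3_act A y" using H3_act_inverse(2)[OF det_A base_H3] by (simp add: y_def)
  have "psl_H3_act \<gamma> x = H3_act (A ** translation2 b ** matrix_inv A) x"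
    using psl_H3_act_eq[OF in_PSL2[OF \<gamma>] b] .
  also have "\<dots> = H3_act A (H3_act (translation2 b) y)"
    using base_H3 inv(3) det_A det_translation2 H3_act_in_H3
    by (simp add: H3_act_mult det_mul y_def)
  finally have \<gamma>x: "psl_H3_act \<gamma> x = H3_act A (fst y + b, 1)" by (simp add: H3_act_translation2 y)
  define q where "q = H3_act A \<circ> linepath y (fst y + b, 1)"
  have "convex {w :: complex \<times> real. snd w = 1}"
  proof -
    have "{w :: complex \<times> real. snd w = 1} = UNIV \<times> {1}" by auto
    then show ?thesis by (simp add: convex_Times)
  qed
  then have im: "path_image (linepath y (fst y + b, 1)) \<subseteq> {w. snd w = 1}"
    using y by (simp add: closed_segment_subset)
  then have "path q" unfolding q_def
    by (intro path_continuous_image path_linepath continuous_on_subset[OF continuous_H3_act[OF det_A]])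
      (auto simp: H3_def)
  moreover have "path_image q \<subseteq> horosphere A"
    unfolding q_def path_image_compose horosphere_def using im by (rule image_mono)
  moreover have "pathstart q = x" "pathfinish q = psl_H3_act \<gamma> x"
    by (simp_all add: q_def pathstart_compose pathfinish_compose \<gamma>x flip: xy)
  ultimately show ?thesis using that by blast
qed

lemma path_in_cusp_preimage:
  assumes "path q" "path_image q \<subseteq> H3" "\<And>t. t \<in> {0..1} \<Longrightarrow> \<pi> (q t) \<in> \<pi> ` horoball A"
    and "\<gamma> \<in> \<Gamma>" "t \<in> {0..1}" "q t \<in> psl_H3_act \<gamma> ` horoball A"
  shows "path_image q \<subseteq> psl_H3_act \<gamma> ` horoball A"
proof (rule connected_in_translate)
  show "connected (path_image q)" using assms(1) by (rule connected_path_image)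
  show "path_image q \<subseteq> cusp_preimage" using assms(2,3) by (auto simp: cusp_preimage_def path_image_def)
  show "path_image q \<inter> psl_H3_act \<gamma> ` horoball A \<noteq> {}" using assms(5,6) unfolding path_image_def by blast
qed (rule assms(4))

lemma one_translate: "psl_H3_act \<one>\<^bsub>PSL2\<^esub> ` horoball A = horoball A"
  by (simp add: psl_H3_act_one)

lemma peripheral_eq:
  "subspace_loops M (\<pi> ` horosphere A) (\<pi> x) = deck_class \<pi> M x ` cusp_stabilizer"
proof
  show "subspace_loops M (\<pi> ` horosphere A) (\<pi> x) \<subseteq> deck_class \<pi> M x ` cusp_stabilizer"
    unfolding subspace_loops_eq
  proof (rule image_subsetI)
    fix p assume p: "p \<in> loops_at (\<pi> ` horosphere A) (\<pi> x)"
    have "\<pi> ` horosphere A \<subseteq> M"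
      using horosphere_subset_horoball horoball_H3 proj_in by blast
    then have "p \<in> loops_at M (\<pi> x)" using p by (auto simp: loops_at_def)
    then obtain q \<gamma> where q: "path q" "path_image q \<subseteq> H3" "pathstart q = x" "\<gamma> \<in> \<Gamma>"
      "pathfinish q = psl_H3_act \<gamma> x" "\<And>t. t \<in> {0..1} \<Longrightarrow> \<pi> (q t) = p t"
      "loop_class M p = deck_class \<pi> M x \<gamma>" using loop_lift[OF base_H3] by metis
    have "\<pi> (q t) \<in> \<pi> ` horoball A" if "t \<in> {0..1}" for t
      using q(6)[OF that] p that horosphere_subset_horoball by (force simp: loops_at_def path_image_def)
    then have "path_image q \<subseteq> psl_H3_act \<one>\<^bsub>PSL2\<^esub> ` horoball A"
      using path_in_cusp_preimage[OF q(1,2) _ one_closed, of 0] q(3) base_horoball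
      by (simp add: one_translate pathstart_def)
    then have "psl_H3_act \<gamma> x \<in> horoball A"
      using q(5) pathfinish_in_path_image[of q] by (auto simp: one_translate)
    then have "\<gamma> \<in> cusp_stabilizer"
      using translate_disjoint[OF q(4)] base_horoball q(4) by (auto simp: cusp_stabilizer_def)
    then show "loop_class M p \<in> deck_class \<pi> M x ` cusp_stabilizer" using q(7) by blast
  qed
  show "deck_class \<pi> M x ` cusp_stabilizer \<subseteq> subspace_loops M (\<pi> ` horosphere A) (\<pi> x)"
  proof (rule image_subsetI)
    fix \<gamma> assume \<gamma>: "\<gamma> \<in> cusp_stabilizer"
    then obtain q where q: "path q" "path_image q \<subseteq> horosphere A" "pathstart q = x" "pathfinish q = psl_H3_act \<gamma> x"
      by (rule cusp_stabilizer_path)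
    have qH: "path_image q \<subseteq> H3" using q(2) horosphere_subset_horoball horoball_H3 by blast
    have "\<pi> \<circ> q \<in> loops_at (\<pi> ` horosphere A) (\<pi> x)"
      using q \<gamma> base_H3 proj_act continuous_on_subset[OF continuous_proj qH]
      by (auto simp: loops_at_def path_continuous_image path_image_compose pathstart_compose
          pathfinish_compose cusp_stabilizer_def)
    then show "deck_class \<pi> M x \<gamma> \<in> subspace_loops M (\<pi> ` horosphere A) (\<pi> x)"
      unfolding subspace_loops_eq deck_class_eq[OF q(1) qH q(3,4)] by blast
  qed
qed

end

section \<open>Edges of an ideal triangulation\<close>

lemma ideal_triangulation_cell:
  assumes "ideal_triangulation M K" "j < fst K"
  shows "continuous_on ideal_simplex (snd K j)" "snd K j \<in> ideal_simplex \<rightarrow> M"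
proof -
  obtain k \<Phi> where K: "K = (k, \<Phi>)" by (cases K)
  have "quotient_map (sum_topology (\<lambda>_. top_of_set ideal_simplex) {..<k}) (top_of_set M) (\<lambda>(j, x). \<Phi> j x)"
    using assms(1) unfolding ideal_triangulation_def K by auto
  then have "continuous_map (sum_topology (\<lambda>_. top_of_set ideal_simplex) {..<k}) (top_of_set M) (\<lambda>(j, x). \<Phi> j x)"
    by (rule quotient_imp_continuous_map)
  moreover have "continuous_map (top_of_set ideal_simplex) (sum_topology (\<lambda>_. top_of_set ideal_simplex) {..<k}) (Pair j)"
    using continuous_map_component_injection[of j "{..<k}" "\<lambda>_. top_of_set ideal_simplex"] assms(2) K by simp
  ultimately have "continuous_map (top_of_set ideal_simplex) (top_of_set M) ((\<lambda>(j, x). \<Phi> j x) \<circ> Pair j)"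
    by (rule continuous_map_compose[rotated])
  then show "continuous_on ideal_simplex (snd K j)" "snd K j \<in> ideal_simplex \<rightarrow> M"
    by (simp_all add: K o_def continuous_map_in_subtopology image_subset_iff_funcset)
qed

lemma convex_ideal_simplex: "convex ideal_simplex"
proof (rule convexI)
  fix x y :: "real^4" and u v :: real
  assume x: "x \<in> ideal_simplex" and y: "y \<in> ideal_simplex" and uv: "0 \<le> u" "0 \<le> v" "u + v = 1"
  define z where "z = u *\<^sub>R x + v *\<^sub>R y"
  have xs: "0 \<le> x$a" "(\<Sum>a\<in>UNIV. x$a) = 1" "x \<notin> range simplex_vertex" for a
    using x by (auto simp: ideal_simplex_def)
  have ys: "0 \<le> y$a" "(\<Sum>a\<in>UNIV. y$a) = 1" "y \<notin> range simplex_vertex" for a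
    using y by (auto simp: ideal_simplex_def)
  have z: "0 \<le> z$a" "(\<Sum>a\<in>UNIV. z$a) = 1" for a
  proof -
    show "0 \<le> z$a" using xs(1) ys(1) uv by (simp add: z_def)
    have "(\<Sum>a\<in>UNIV. z$a) = u * (\<Sum>a\<in>UNIV. x$a) + v * (\<Sum>a\<in>UNIV. y$a)"
      by (simp add: z_def sum.distrib sum_distrib_left)
    then show "(\<Sum>a\<in>UNIV. z$a) = 1" using xs(2) ys(2) uv(3) by simp
  qed
  have vertex: "w = simplex_vertex a" if "\<And>b. b \<noteq> a \<Longrightarrow> w$b = 0" "(\<Sum>b\<in>UNIV. w$b) = 1" for w a
  proof -
    have "(\<Sum>b\<in>UNIV. w$b) = w$a + (\<Sum>b\<in>UNIV - {a}. w$b)" by (rule sum.remove) auto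
    also have "(\<Sum>b\<in>UNIV - {a}. w$b) = 0" using that(1) by (intro sum.neutral) auto
    finally have "w$a = 1" using that(2) by simp
    then show ?thesis using that(1) by (auto simp: simplex_vertex_def vec_eq_iff axis_def)
  qed
  have "z \<notin> range simplex_vertex"
  proof
    assume "z \<in> range simplex_vertex"
    then obtain a where a: "z = simplex_vertex a" by blast
    have zero: "u * x$b = 0 \<and> v * y$b = 0" if "b \<noteq> a" for b
    proof -
      have "u * x$b + v * y$b = 0" using a that by (auto simp: z_def simplex_vertex_def vec_eq_iff axis_def)
      then show ?thesis using xs(1)[of b] ys(1)[of b] uv by (simp add: add_nonneg_eq_0_iff)
    qed
    show False
    proof (cases "u = 0")
      case True
      then have "y = simplex_vertex a" using zero uv(3) ys(2) by (intro vertex) auto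
      then show False using ys(3) by blast
    next
      case False
      then have "x = simplex_vertex a" using zero xs(2) by (intro vertex) auto
      then show False using xs(3) by blast
    qed
  qed
  then show "u *\<^sub>R x + v *\<^sub>R y \<in> ideal_simplex"
    using z unfolding z_def[symmetric] by (simp add: ideal_simplex_def)
qed

definition edge_point :: "4 \<Rightarrow> 4 \<Rightarrow> real \<Rightarrow> real^4" where
  "edge_point a b s = (1 - s) *\<^sub>R simplex_vertex a + s *\<^sub>R simplex_vertex b"

lemma edge_path_eq: "edge_path K j a b s = snd K j (edge_point a b s)"
  by (simp add: edge_path_def edge_point_def)

lemma edge_point_nth: "a \<noteq> b \<Longrightarrow> edge_point a b s $ c = (if c = a then 1 - s else if c = b then s else 0)"
  by (simp add: edge_point_def simplex_vertex_def axis_def)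

lemma edge_point_swap: "edge_point b a s = edge_point a b (1 - s)"
  by (simp add: edge_point_def add.commute)

lemma edge_point_in:
  assumes "a \<noteq> b" "s \<in> {0<..<1}" shows "edge_point a b s \<in> ideal_simplex"
proof -
  have "(\<Sum>c\<in>UNIV. edge_point a b s $ c) = (\<Sum>c\<in>{a, b}. edge_point a b s $ c)"
    by (rule sum.mono_neutral_right) (auto simp: edge_point_nth assms)
  also have "\<dots> = 1" using assms by (simp add: edge_point_nth)
  finally have "(\<Sum>c\<in>UNIV. edge_point a b s $ c) = 1" .
  moreover have "edge_point a b s \<noteq> simplex_vertex c" for c
  proof
    assume eq: "edge_point a b s = simplex_vertex c"
    have "edge_point a b s $ a \<in> {0, 1}" unfolding eq by (simp add: simplex_vertex_def axis_def)
    then show False using assms by (simp add: edge_point_nth)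
  qed
  ultimately show ?thesis using assms unfolding ideal_simplex_def
    by (auto simp: edge_point_nth)
qed

lemma edge_point_support:
  assumes "a \<noteq> b" "s \<in> {0<..<1}" shows "{c. edge_point a b s $ c \<noteq> 0} = {a, b}"
  using assms by (auto simp: edge_point_nth)

lemma continuous_edge_point: "continuous_on S (edge_point a b)"
  unfolding edge_point_def by (intro continuous_intros)

lemma glued_edge_step:
  assumes "face_pairing k glue" "glued k glue (j, edge_point a b s) (j', y)" "a \<noteq> b" "s \<in> {0<..<1}"
  obtains a' b' where "a' \<noteq> b'" "y = edge_point a' b' s"
    "\<And>u. u \<in> {0<..<1} \<Longrightarrow> glued k glue (j, edge_point a b u) (j', edge_point a' b' u)"
proof -
  obtain c \<sigma> where c: "j < k" "edge_point a b s $ c = 0" "glue (j, c) = (j', \<sigma>)"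
    "\<And>d. y $ \<sigma> d = edge_point a b s $ d"
    using assms(2) by (auto simp: glued_def)
  have "case glue (j, c) of (j', s) \<Rightarrow> j' < k \<and> bij s \<and> (j', s c) \<noteq> (j, c) \<and>
      glue (j', s c) = (j, inv_into UNIV s)"
    using assms(1)[unfolded face_pairing_def, rule_format, OF c(1), of c] .
  then have bij: "bij \<sigma>" by (simp add: c(3))
  have cab: "c \<noteq> a" "c \<noteq> b" using c(2) assms(3,4) by (auto simp: edge_point_nth)
  have ne: "\<sigma> a \<noteq> \<sigma> b" using bij assms(3) by (meson bij_is_inj inj_eq)
  have nth: "edge_point (\<sigma> a) (\<sigma> b) u $ \<sigma> d = edge_point a b u $ d" for u d
    using bij by (simp add: edge_point_nth assms(3) ne bij_is_inj inj_eq)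
  have "y $ d = edge_point (\<sigma> a) (\<sigma> b) s $ d" for d
    using c(4) nth bij by (metis bij_pointE)
  then have y: "y = edge_point (\<sigma> a) (\<sigma> b) s" by (simp add: vec_eq_iff)
  have glued: "glued k glue (j, edge_point a b u) (j', edge_point (\<sigma> a) (\<sigma> b) u)" if "u \<in> {0<..<1}" for u
    unfolding glued_def using c(1,3) edge_point_in[OF assms(3) that] cab nth
    by (auto simp: edge_point_nth assms(3) intro!: exI[of _ c])
  show ?thesis by (rule that[OF ne y glued])
qed

lemma glued_edge_chain:
  assumes "face_pairing k glue" "(glued k glue)\<^sup>*\<^sup>* (j, edge_point a b s) w" "a \<noteq> b" "s \<in> {0<..<1}"
  shows "\<exists>j' a' b'. a' \<noteq> b' \<and> w = (j', edge_point a' b' s) \<and>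
    (\<forall>u\<in>{0<..<1}. (glued k glue)\<^sup>*\<^sup>* (j, edge_point a b u) (j', edge_point a' b' u))"
  using assms(2)
proof induction
  case base
  then show ?case using assms(3) by blast
next
  case (step v w)
  then obtain j' a' b' where v: "a' \<noteq> b'" "v = (j', edge_point a' b' s)"
    "\<forall>u\<in>{0<..<1}. (glued k glue)\<^sup>*\<^sup>* (j, edge_point a b u) (j', edge_point a' b' u)" by blast
  obtain j'' y where w: "w = (j'', y)" by (cases w)
  obtain a'' b'' where "a'' \<noteq> b''" "y = edge_point a'' b'' s"
    "\<And>u. u \<in> {0<..<1} \<Longrightarrow> glued k glue (j', edge_point a' b' u) (j'', edge_point a'' b'' u)"
    using glued_edge_step[OF assms(1) _ v(1) assms(4)] step.hyps(2) unfolding v(2) w by metis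
  then show ?case using v(3) w by (metis rtranclp.rtrancl_into_rtrancl)
qed

text \<open>Face pairings are affine, so two parametrizations of an edge agree up to reversal.\<close>

lemma edge_between_eqD:
  assumes "ideal_triangulation M K" "j < fst K" "j' < fst K" "a \<noteq> b" "a' \<noteq> b'"
    and eq: "edge_between K j a b = edge_between K j' a' b'"
  shows "(\<forall>s\<in>{0<..<1}. edge_path K j a b s = edge_path K j' a' b' s) \<or>
    (\<forall>s\<in>{0<..<1}. edge_path K j a b s = edge_path K j' a' b' (1 - s))"
proof -
  obtain k \<Phi> where K: "K = (k, \<Phi>)" by (cases K)
  obtain glue where glue: "face_pairing k glue"
    "\<And>j j' x y. j < k \<Longrightarrow> j' < k \<Longrightarrow> x \<in> ideal_simplex \<Longrightarrow> y \<in> ideal_simplex \<Longrightarrow>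
      \<Phi> j x = \<Phi> j' y \<longleftrightarrow> (glued k glue)\<^sup>*\<^sup>* (j, x) (j', y)"
    using assms(1) unfolding ideal_triangulation_def K by auto
  have jk: "j < k" "j' < k" using assms K by auto
  have "edge_path K j a b (1/2) \<in> edge_between K j a b"
    unfolding edge_between_def by (rule imageI) simp
  then obtain s where s: "s \<in> {0<..<1}" "edge_path K j a b (1/2) = edge_path K j' a' b' s"
    unfolding eq by (auto simp: edge_between_def)
  then have "(glued k glue)\<^sup>*\<^sup>* (j, edge_point a b (1/2)) (j', edge_point a' b' s)"
    using glue(2)[OF jk edge_point_in edge_point_in] assms(4,5) by (simp add: edge_path_eq K)
  then obtain a'' b'' where ab: "a'' \<noteq> b''" "edge_point a' b' s = edge_point a'' b'' (1/2)"
    "\<forall>u\<in>{0<..<1}. (glued k glue)\<^sup>*\<^sup>* (j, edge_point a b u) (j', edge_point a'' b'' u)"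
    using glued_edge_chain[OF glue(1) _ assms(4), of j "1/2" "(j', edge_point a' b' s)"] by auto
  have path: "edge_path K j a b u = edge_path K j' a'' b'' u" if "u \<in> {0<..<1}" for u
    using ab(3) that glue(2)[OF jk edge_point_in[OF assms(4) that] edge_point_in[OF ab(1) that]]
    by (simp add: edge_path_eq K)
  have "{a', b'} = {a'', b''}"
    using edge_point_support[OF assms(5) s(1)] edge_point_support[OF ab(1), of "1/2"] ab(2) by simp
  then have "a'' = a' \<and> b'' = b' \<or> a'' = b' \<and> b'' = a'" by (auto simp: doubleton_eq_iff)
  then show ?thesis
  proof
    assume "a'' = a' \<and> b'' = b'"
    then show ?thesis using path by blast
  next
    assume "a'' = b' \<and> b'' = a'"
    then show ?thesis using path by (simp add: edge_path_eq edge_point_swap[of b' a'])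
  qed
qed

context cusped_quotient
begin

definition edge_lift ::
    "'m ideal_cells \<Rightarrow> nat \<Rightarrow> 4 \<Rightarrow> 4 \<Rightarrow> (real \<Rightarrow> complex \<times> real) \<Rightarrow> mat2 set \<Rightarrow> mat2 set \<Rightarrow> bool" where
  "edge_lift K j a b c \<gamma>1 \<gamma>2 \<longleftrightarrow> j < fst K \<and> a \<noteq> b \<and>
     continuous_on {0<..<1} c \<and> c ` {0<..<1} \<subseteq> H3 \<and>
     (\<forall>s\<in>{0<..<1}. \<pi> (c s) = edge_path K j a b s) \<and>
     \<gamma>1 \<in> \<Gamma> \<and> (\<forall>\<^sub>F s in at_right 0. c s \<in> psl_H3_act \<gamma>1 ` horoball A) \<and>
     \<gamma>2 \<in> \<Gamma> \<and> (\<forall>\<^sub>F s in at_left 1. c s \<in> psl_H3_act \<gamma>2 ` horoball A)"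

lemma edge_lift_reverse:
  assumes "edge_lift K j a b c \<gamma>1 \<gamma>2"
  shows "edge_lift K j b a (\<lambda>s. c (1 - s)) \<gamma>2 \<gamma>1"
proof -
  note d = assms[unfolded edge_lift_def]
  have "continuous_on {0<..<1} (\<lambda>s. c (1 - s))"
  proof (rule continuous_on_compose2[of "{0<..<1}" c])
    show "continuous_on {0<..<1} ((-) (1::real))" by (intro continuous_intros)
  qed (use d in auto)
  moreover have "\<forall>\<^sub>F s in at_right 0. c (1 - s) \<in> psl_H3_act \<gamma>2 ` horoball A"
  proof -
    obtain r where "r < 1" "\<And>y. r < y \<Longrightarrow> y < 1 \<Longrightarrow> c y \<in> psl_H3_act \<gamma>2 ` horoball A"
      using d eventually_at_left[of 0 "1::real"] by auto
    then show ?thesis unfolding eventually_at_right[of 0 "1::real", simplified]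
      by (intro exI[of _ "1 - r"]) auto
  qed
  moreover have "\<forall>\<^sub>F s in at_left 1. c (1 - s) \<in> psl_H3_act \<gamma>1 ` horoball A"
  proof -
    obtain r where "r > 0" "\<And>y. 0 < y \<Longrightarrow> y < r \<Longrightarrow> c y \<in> psl_H3_act \<gamma>1 ` horoball A"
      using d eventually_at_right[of 0 "1::real"] by auto
    then show ?thesis unfolding eventually_at_left[of 0 "1::real", simplified]
      by (intro exI[of _ "1 - r"]) auto
  qed
  moreover have "\<pi> (c (1 - s)) = edge_path K j b a s" if "s \<in> {0<..<1}" for s
    using d that by (simp add: edge_path_eq edge_point_swap[of b a])
  ultimately show ?thesis using d unfolding edge_lift_def by auto
qed

lemma edge_lift_unique_same:
  assumes 1: "edge_lift K j a b c \<gamma>1 \<gamma>2" and 2: "edge_lift K j' a' b' c' \<gamma>1' \<gamma>2'"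
    and eq: "\<And>s. s \<in> {0<..<1} \<Longrightarrow> edge_path K j a b s = edge_path K j' a' b' s"
  obtains \<eta> \<zeta>1 \<zeta>2 where "\<eta> \<in> \<Gamma>" "\<zeta>1 \<in> cusp_stabilizer" "\<zeta>2 \<in> cusp_stabilizer"
    "\<gamma>1' = \<eta> \<otimes>\<^bsub>PSL2\<^esub> \<gamma>1 \<otimes>\<^bsub>PSL2\<^esub> \<zeta>1" "\<gamma>2' = \<eta> \<otimes>\<^bsub>PSL2\<^esub> \<gamma>2 \<otimes>\<^bsub>PSL2\<^esub> \<zeta>2"
proof -
  note d = 1[unfolded edge_lift_def] and d' = 2[unfolded edge_lift_def]
  have cH: "c s \<in> H3" "c' s \<in> H3" if "s \<in> {0<..<1}" for s using d d' that by auto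
  have same: "\<pi> (c s) = \<pi> (c' s)" if "s \<in> {0<..<1}" for s using d d' eq that by simp
  obtain \<eta> where \<eta>: "\<eta> \<in> \<Gamma>" "c' (1/2) = psl_H3_act \<eta> (c (1/2))"
    using orbits[OF cH, of "1/2" "1/2"] same[of "1/2"] by auto
  have c': "psl_H3_act \<eta> (c s) = c' s" if s: "s \<in> {0<..<1}" for s
  proof (rule covering_space_lift_unique[OF covering, where T = "{0<..<1::real}" and a = "1/2" and f = "\<pi> \<circ> c'"])
    show "continuous_on {0<..<1} (\<pi> \<circ> c')"
    proof (rule continuous_on_compose)
      show "continuous_on {0<..<1} c'" using d' by blast
      show "continuous_on (c' ` {0<..<1}) \<pi>" using d' by (intro continuous_on_subset[OF continuous_proj]) blast
    qed
    show "continuous_on {0<..<1} (\<lambda>s. psl_H3_act \<eta> (c s))"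
      by (rule continuous_on_compose2[OF continuous_psl_H3_act[OF in_PSL2[OF \<eta>(1)]], of "{0<..<1}" c])
        (use d in blast)+
    show "(\<pi> \<circ> c') s = \<pi> (psl_H3_act \<eta> (c s))" if "s \<in> {0<..<1}" for s
      using same[OF that] proj_act[OF \<eta>(1) cH(1)[OF that]] by simp
    show "\<pi> \<circ> c' \<in> {0<..<1} \<rightarrow> M" using cH(2) proj_in by (intro funcsetI) (simp only: o_def)
    show "(\<lambda>s. psl_H3_act \<eta> (c s)) \<in> {0<..<1} \<rightarrow> H3" using cH(1) act_in_H3[OF \<eta>(1)] by (intro funcsetI) blast
  qed (use \<eta> d' cH s in auto)
  have end_eq: "\<exists>\<zeta>\<in>cusp_stabilizer. \<gamma>' = \<eta> \<otimes>\<^bsub>PSL2\<^esub> \<gamma> \<otimes>\<^bsub>PSL2\<^esub> \<zeta>"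
    if \<gamma>: "\<gamma> \<in> \<Gamma>" "\<gamma>' \<in> \<Gamma>" and s: "s \<in> {0<..<1}" "c s \<in> psl_H3_act \<gamma> ` horoball A" "c' s \<in> psl_H3_act \<gamma>' ` horoball A"
    for \<gamma> \<gamma>' s
  proof -
    have "c' s \<in> psl_H3_act (\<eta> \<otimes>\<^bsub>PSL2\<^esub> \<gamma>) ` horoball A"
      unfolding translate_comp[OF \<eta>(1) \<gamma>(1), symmetric] c'[OF s(1), symmetric] using s(2) by (rule imageI)
    then have st: "inv\<^bsub>PSL2\<^esub> (\<eta> \<otimes>\<^bsub>PSL2\<^esub> \<gamma>) \<otimes>\<^bsub>PSL2\<^esub> \<gamma>' \<in> cusp_stabilizer"
      using translates_disjoint(2)[OF mult_closed[OF \<eta>(1) \<gamma>(1)] \<gamma>(2)] s(3) by blast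
    moreover have "\<gamma>' = \<eta> \<otimes>\<^bsub>PSL2\<^esub> \<gamma> \<otimes>\<^bsub>PSL2\<^esub> (inv\<^bsub>PSL2\<^esub> (\<eta> \<otimes>\<^bsub>PSL2\<^esub> \<gamma>) \<otimes>\<^bsub>PSL2\<^esub> \<gamma>')"
      using in_PSL2[OF mult_closed[OF \<eta>(1) \<gamma>(1)]] in_PSL2[OF \<gamma>(2)] group_PSL2
      by (metis group.inv_closed group.inv_solve_left group.is_monoid monoid.m_closed)
    ultimately show ?thesis by blast
  qed
  have "\<forall>\<^sub>F s in at_right 0. c s \<in> psl_H3_act \<gamma>1 ` horoball A \<and> c' s \<in> psl_H3_act \<gamma>1' ` horoball A"
    using d d' by (auto intro: eventually_conj)
  then have "\<forall>\<^sub>F s in at_right 0. s \<in> {0<..<1} \<and> c s \<in> psl_H3_act \<gamma>1 ` horoball A \<and> c' s \<in> psl_H3_act \<gamma>1' ` horoball A"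
    using eventually_at_right_real[of 0 1] by (auto elim: eventually_elim2)
  then obtain s1 where "s1 \<in> {0<..<1}" "c s1 \<in> psl_H3_act \<gamma>1 ` horoball A" "c' s1 \<in> psl_H3_act \<gamma>1' ` horoball A"
    using eventually_happens'[OF trivial_limit_at_right_real] by blast
  then obtain \<zeta>1 where "\<zeta>1 \<in> cusp_stabilizer" "\<gamma>1' = \<eta> \<otimes>\<^bsub>PSL2\<^esub> \<gamma>1 \<otimes>\<^bsub>PSL2\<^esub> \<zeta>1"
    using end_eq d d' by blast
  moreover have "\<forall>\<^sub>F s in at_left 1. c s \<in> psl_H3_act \<gamma>2 ` horoball A \<and> c' s \<in> psl_H3_act \<gamma>2' ` horoball A"
    using d d' by (auto intro: eventually_conj)
  then have "\<forall>\<^sub>F s in at_left 1. s \<in> {0<..<1} \<and> c s \<in> psl_H3_act \<gamma>2 ` horoball A \<and> c' s \<in> psl_H3_act \<gamma>2' ` horoball A"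
    using eventually_at_left_real[of 0 1] by (auto elim: eventually_elim2)
  then obtain s2 where "s2 \<in> {0<..<1}" "c s2 \<in> psl_H3_act \<gamma>2 ` horoball A" "c' s2 \<in> psl_H3_act \<gamma>2' ` horoball A"
    using eventually_happens'[OF trivial_limit_at_left_real] by blast
  then obtain \<zeta>2 where "\<zeta>2 \<in> cusp_stabilizer" "\<gamma>2' = \<eta> \<otimes>\<^bsub>PSL2\<^esub> \<gamma>2 \<otimes>\<^bsub>PSL2\<^esub> \<zeta>2"
    using end_eq d d' by blast
  ultimately show ?thesis using that \<eta>(1) by blast
qed

lemma simplex_lift:
  assumes "ideal_triangulation M K" "j < fst K" "z \<in> ideal_simplex" "w \<in> H3" "snd K j z = \<pi> w"
  obtains F where "continuous_on ideal_simplex F" "F \<in> ideal_simplex \<rightarrow> H3" "F z = w"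
    "\<And>y. y \<in> ideal_simplex \<Longrightarrow> \<pi> (F y) = snd K j y"
  using covering_space_lift_convex[where f = "snd K j" and p = \<pi> and z = z and a = w,
      OF covering convex_ideal_simplex assms(3,4,5) ideal_triangulation_cell[OF assms(1,2)]] by blast

lemma simplex_lift_corner:
  assumes "meets_nicely K (\<pi> ` horoball A)" "j < fst K"
    and F: "continuous_on ideal_simplex F" "F \<in> ideal_simplex \<rightarrow> H3"
      "\<And>y. y \<in> ideal_simplex \<Longrightarrow> \<pi> (F y) = snd K j y"
  obtains \<gamma> U where "\<gamma> \<in> \<Gamma>" "open U" "simplex_vertex a \<in> U"
    "\<And>y. y \<in> U \<Longrightarrow> y \<in> ideal_simplex \<Longrightarrow> F y \<in> psl_H3_act \<gamma> ` horoball A"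
proof -
  obtain C where C: "components {y \<in> ideal_simplex. snd K j y \<in> \<pi> ` horoball A} = range C"
    "\<And>a. \<exists>U. open U \<and> simplex_vertex a \<in> U \<and> U \<inter> ideal_simplex \<subseteq> C a"
    using assms(1,2) unfolding meets_nicely_def by meson
  obtain U where U: "open U" "simplex_vertex a \<in> U" "U \<inter> ideal_simplex \<subseteq> C a" using C(2) by blast
  have Ca: "C a \<in> components {y \<in> ideal_simplex. snd K j y \<in> \<pi> ` horoball A}" using C(1) by blast
  then have sub: "C a \<subseteq> ideal_simplex" "C a \<subseteq> {y. snd K j y \<in> \<pi> ` horoball A}"
    using in_components_subset by fastforce+
  have conn: "connected (F ` C a)"
    using continuous_on_subset[OF F(1) sub(1)] in_components_connected[OF Ca] by (rule connected_continuous_image)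
  have pre: "F ` C a \<subseteq> cusp_preimage"
  proof (rule image_subsetI)
    fix y assume "y \<in> C a"
    then have "y \<in> ideal_simplex" "snd K j y \<in> \<pi> ` horoball A" using sub by blast+
    then show "F y \<in> cusp_preimage" unfolding cusp_preimage_def using F(2,3) by auto
  qed
  obtain y where "y \<in> C a" using in_components_nonempty[OF Ca] by blast
  then obtain \<gamma> where \<gamma>: "\<gamma> \<in> \<Gamma>" "F y \<in> psl_H3_act \<gamma> ` horoball A"
    using pre unfolding cusp_preimage_eq by blast
  then have "F ` C a \<subseteq> psl_H3_act \<gamma> ` horoball A"
    using connected_in_translate[OF conn pre] \<open>y \<in> C a\<close> by blast
  then show ?thesis using that[of \<gamma> U] \<gamma>(1) U by blast
qed

lemma simplex_edge_lifts:
  assumes "ideal_triangulation M K" "meets_nicely K (\<pi> ` horoball A)" "j < fst K"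
  obtains \<gamma> :: "4 \<Rightarrow> mat2 set" where "\<And>a. \<gamma> a \<in> \<Gamma>" "\<And>a b. a \<noteq> b \<Longrightarrow> \<exists>c. edge_lift K j a b c (\<gamma> a) (\<gamma> b)"
proof -
  define z where "z = edge_point 1 2 (1/2)"
  have z: "z \<in> ideal_simplex" unfolding z_def by (rule edge_point_in) auto
  have "snd K j z \<in> M" using ideal_triangulation_cell(2)[OF assms(1,3)] z by blast
  then obtain w where "w \<in> H3" "snd K j z = \<pi> w" using covering_space_imp_surjective[OF covering] by auto
  then obtain F where F: "continuous_on ideal_simplex F" "F \<in> ideal_simplex \<rightarrow> H3"
    "\<And>y. y \<in> ideal_simplex \<Longrightarrow> \<pi> (F y) = snd K j y"
    using simplex_lift[OF assms(1,3) z] by metis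
  have "\<exists>\<gamma> U. \<gamma> \<in> \<Gamma> \<and> open U \<and> simplex_vertex a \<in> U \<and>
      (\<forall>y\<in>U. y \<in> ideal_simplex \<longrightarrow> F y \<in> psl_H3_act \<gamma> ` horoball A)" for a
    using simplex_lift_corner[OF assms(2,3) F] by metis
  then obtain \<gamma> U where \<gamma>: "\<And>a. \<gamma> a \<in> \<Gamma>" "\<And>a. open (U a)" "\<And>a. simplex_vertex a \<in> U a"
    "\<And>a y. y \<in> U a \<Longrightarrow> y \<in> ideal_simplex \<Longrightarrow> F y \<in> psl_H3_act (\<gamma> a) ` horoball A" by metis
  have near0: "\<forall>\<^sub>F s in at_right 0. F (edge_point a b s) \<in> psl_H3_act (\<gamma> a) ` horoball A" if "a \<noteq> b" for a b
  proof -
    have "(edge_point a b \<longlongrightarrow> edge_point a b 0) (at_right 0)"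
      using continuous_edge_point[of UNIV a b]
      by (simp add: continuous_on_eq_continuous_at isCont_def filterlim_at_split)
    then have "\<forall>\<^sub>F s in at_right 0. edge_point a b s \<in> U a"
      by (rule topological_tendstoD[OF _ \<gamma>(2)]) (use \<gamma>(3) in \<open>simp add: edge_point_def\<close>)
    then show ?thesis using eventually_at_right_real[OF zero_less_one]
      by eventually_elim (rule \<gamma>(4), use edge_point_in that in auto)
  qed
  have "edge_lift K j a b (\<lambda>s. F (edge_point a b s)) (\<gamma> a) (\<gamma> b)" if ab: "a \<noteq> b" for a b
  proof -
    have "continuous_on {0<..<1} (\<lambda>s. F (edge_point a b s))"
      using F(1) by (rule continuous_on_compose2) (use continuous_edge_point edge_point_in ab in auto)
    moreover have "\<forall>\<^sub>F s in at_left 1. F (edge_point a b s) \<in> psl_H3_act (\<gamma> b) ` horoball A"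
    proof -
      obtain r where "r > 0" "\<And>y. 0 < y \<Longrightarrow> y < r \<Longrightarrow> F (edge_point b a y) \<in> psl_H3_act (\<gamma> b) ` horoball A"
        using near0[of b a] ab eventually_at_right[of 0 "1::real"] by auto
      then show ?thesis unfolding eventually_at_left[of 0 "1::real", simplified]
        by (intro exI[of _ "1 - r"]) (auto simp: edge_point_swap[of a b])
    qed
    ultimately show ?thesis
      using ab assms(3) \<gamma>(1) near0[OF ab] F edge_point_in[OF ab] unfolding edge_lift_def
      by (auto simp: edge_path_eq)
  qed
  then show ?thesis using that \<gamma>(1) by blast
qed

lemma edge_generator_lift:
  assumes K: "ideal_triangulation M K"
    and gen: "edge_generator M K (\<pi> ` horoball A) (\<pi> ` horosphere A) (\<pi> x) E \<alpha>"
  obtains j a b c \<gamma> where "edge_between K j a b = E" "edge_lift K j a b c \<one>\<^bsub>PSL2\<^esub> \<gamma>"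
    "\<alpha> = deck_class \<pi> M x \<gamma>"
proof -
  obtain j a b s t p q where j: "j < fst K" "a \<noteq> b" "edge_between K j a b = E"
    and st: "0 < s" "s < t" "t < 1"
    and e0: "edge_path K j a b ` {0<..s} \<subseteq> \<pi> ` horoball A" and e1: "edge_path K j a b ` {t..<1} \<subseteq> \<pi> ` horoball A"
    and p: "path p" "path_image p \<subseteq> \<pi> ` horosphere A" "pathstart p = \<pi> x" "pathfinish p = edge_path K j a b s"
    and q: "path q" "path_image q \<subseteq> \<pi> ` horosphere A" "pathstart q = edge_path K j a b t" "pathfinish q = \<pi> x"
    and \<alpha>: "\<alpha> = loop_class M (p +++ (edge_path K j a b \<circ> linepath s t) +++ q)"
    using gen unfolding edge_generator_def by metis
  have dN: "\<pi> ` horosphere A \<subseteq> \<pi> ` horoball A" "\<pi> ` horoball A \<subseteq> M"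
    using horosphere_subset_horoball horoball_H3 proj_in by blast+
  have s: "s \<in> {0<..<1}" and t: "t \<in> {0<..<1}" using st by auto
  have pM: "path_image p \<subseteq> M" and qM: "path_image q \<subseteq> M" using p(2) q(2) dN by blast+
  obtain p' where p': "path p'" "path_image p' \<subseteq> H3" "pathstart p' = x" "\<And>t. t \<in> {0..1} \<Longrightarrow> \<pi> (p' t) = p t"
    using lift_path[OF p(1) pM base_H3 p(3)] by blast
  have pN: "\<pi> (p' t) \<in> \<pi> ` horoball A" if "t \<in> {0..1}" for t
    using p'(4)[OF that] p(2) dN(1) that unfolding path_image_def by (metis image_eqI subsetD)
  have "path_image p' \<subseteq> psl_H3_act \<one>\<^bsub>PSL2\<^esub> ` horoball A"
    using p'(3) base_horoball
    by (intro path_in_cusp_preimage[OF p'(1,2) pN one_closed, of 0]) (auto simp: one_translate pathstart_def)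
  then have pB: "pathfinish p' \<in> horoball A" using pathfinish_in_path_image one_translate by blast
  have "snd K j (edge_point a b s) = \<pi> (pathfinish p')"
    using p(4) p'(4)[of 1] by (simp add: edge_path_eq pathfinish_def)
  then obtain F where F: "continuous_on ideal_simplex F" "F \<in> ideal_simplex \<rightarrow> H3"
    "F (edge_point a b s) = pathfinish p'" "\<And>y. y \<in> ideal_simplex \<Longrightarrow> \<pi> (F y) = snd K j y"
    using simplex_lift[OF K j(1) edge_point_in[OF j(2) s]] horoball_H3 pB by (metis subsetD)
  define c where "c = (\<lambda>s. F (edge_point a b s))"
  have c: "continuous_on {0<..<1} c"
    unfolding c_def using F(1) by (rule continuous_on_compose2) (use continuous_edge_point edge_point_in j(2) in auto)
  have cH: "c u \<in> H3" and c\<pi>: "\<pi> (c u) = edge_path K j a b u" if "u \<in> {0<..<1}" for u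
    using F(2,4) edge_point_in[OF j(2) that] by (auto simp: c_def edge_path_eq)
  have segment: "c ` I \<subseteq> psl_H3_act \<gamma> ` horoball A"
    if I: "connected I" "I \<subseteq> {0<..<1}" "edge_path K j a b ` I \<subseteq> \<pi> ` horoball A"
      and \<gamma>: "\<gamma> \<in> \<Gamma>" "u \<in> I" "c u \<in> psl_H3_act \<gamma> ` horoball A" for I u \<gamma>
  proof (rule connected_in_translate[OF _ _ \<gamma>(1)])
    show "connected (c ` I)" using continuous_on_subset[OF c I(2)] I(1) by (rule connected_continuous_image)
    show "c ` I \<subseteq> cusp_preimage"
    proof (rule image_subsetI)
      fix v assume v: "v \<in> I"
      then have "edge_path K j a b v \<in> \<pi> ` horoball A" using I(3) by blast
      then show "c v \<in> cusp_preimage" using cH[of v] c\<pi>[of v] v I(2) by (auto simp: cusp_preimage_def)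
    qed
    show "c ` I \<inter> psl_H3_act \<gamma> ` horoball A \<noteq> {}" using \<gamma>(2,3) by blast
  qed
  have cs: "c s = pathfinish p'" by (simp add: c_def F(3))
  have c0: "c ` {0<..s} \<subseteq> psl_H3_act \<one>\<^bsub>PSL2\<^esub> ` horoball A"
    by (rule segment[OF _ _ e0 one_closed, of s]) (use st cs pB in \<open>auto simp: one_translate\<close>)
  have "edge_path K j a b t \<in> \<pi> ` horoball A" using e1 st by auto
  then have "c t \<in> cusp_preimage" using cH[OF t] c\<pi>[OF t] by (simp add: cusp_preimage_def)
  then obtain \<gamma>' where \<gamma>': "\<gamma>' \<in> \<Gamma>" "c t \<in> psl_H3_act \<gamma>' ` horoball A" unfolding cusp_preimage_eq by blast
  have c1: "c ` {t..<1} \<subseteq> psl_H3_act \<gamma>' ` horoball A"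
    by (rule segment[OF _ _ e1 \<gamma>'(1) _ \<gamma>'(2)]) (use st in auto)
  obtain q' where q': "path q'" "path_image q' \<subseteq> H3" "pathstart q' = c t" "\<And>t. t \<in> {0..1} \<Longrightarrow> \<pi> (q' t) = q t"
    using lift_path[OF q(1) qM cH[OF t]] q(3) c\<pi>[OF t] by metis
  have qN: "\<pi> (q' t) \<in> \<pi> ` horoball A" if "t \<in> {0..1}" for t
    using q'(4)[OF that] q(2) dN(1) that unfolding path_image_def by (metis image_eqI subsetD)
  have "path_image q' \<subseteq> psl_H3_act \<gamma>' ` horoball A"
    using q'(3) \<gamma>'(2)
    by (intro path_in_cusp_preimage[OF q'(1,2) qN \<gamma>'(1), of 0]) (auto simp: pathstart_def)
  then have qB: "pathfinish q' \<in> psl_H3_act \<gamma>' ` horoball A" using pathfinish_in_path_image by blast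
  have q'H: "pathfinish q' \<in> H3" using q'(2) pathfinish_in_path_image by blast
  have "\<pi> (pathfinish q') = \<pi> x" using q'(4)[of 1] q(4) by (simp add: pathfinish_def)
  then obtain \<gamma> where \<gamma>: "\<gamma> \<in> \<Gamma>" "pathfinish q' = psl_H3_act \<gamma> x"
    using orbits[OF base_H3 q'H] by auto
  have same: "psl_H3_act \<gamma>' ` horoball A = psl_H3_act \<gamma> ` horoball A"
    using qB \<gamma>(2) base_horoball by (intro translates_disjoint(1)[OF \<gamma>'(1) \<gamma>(1)]) auto
  have lift: "edge_lift K j a b c \<one>\<^bsub>PSL2\<^esub> \<gamma>"
    unfolding edge_lift_def
  proof (intro conjI)
    show "\<forall>\<^sub>F s in at_right 0. c s \<in> psl_H3_act \<one>\<^bsub>PSL2\<^esub> ` horoball A"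
      using eventually_at_right_real[OF st(1)] by eventually_elim (use c0 in auto)
    show "\<forall>\<^sub>F s in at_left 1. c s \<in> psl_H3_act \<gamma> ` horoball A"
      using eventually_at_left_real[OF st(3)] by eventually_elim (use c1 same in auto)
  qed (use j c cH c\<pi> one_closed \<gamma>(1) in auto)
  define m where "m = c \<circ> linepath s t"
  have st_sub: "path_image (linepath s t) \<subseteq> {0<..<1}"
    using st by (auto simp: closed_segment_eq_real_ivl)
  have m: "path m" "path_image m \<subseteq> H3" "pathstart m = c s" "pathfinish m = c t"
    unfolding m_def using cH st_sub
    by (auto simp: path_image_compose pathstart_compose pathfinish_compose simp del: path_image_linepath
        intro!: path_continuous_image continuous_on_subset[OF c])
  have "homotopic_paths M p (\<pi> \<circ> p')"
    using p(1) pM p'(4) by (intro homotopic_paths_eq) auto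
  moreover have "homotopic_paths M (edge_path K j a b \<circ> linepath s t) (\<pi> \<circ> m)"
  proof -
    have eq: "\<pi> (m u) = edge_path K j a b (linepath s t u)" if "u \<in> {0..1}" for u
      using c\<pi> st_sub that unfolding m_def path_image_def by (metis image_subset_iff o_apply)
    have "homotopic_paths M (\<pi> \<circ> m) (edge_path K j a b \<circ> linepath s t)"
      using m continuous_on_subset[OF continuous_proj m(2)] proj_in eq
      by (intro homotopic_paths_eq) (auto simp: path_image_compose intro!: path_continuous_image)
    then show ?thesis by (rule homotopic_paths_sym)
  qed
  moreover have "homotopic_paths M q (\<pi> \<circ> q')"
    using q(1) qM q'(4) by (intro homotopic_paths_eq) auto
  ultimately have "homotopic_paths M (p +++ (edge_path K j a b \<circ> linepath s t) +++ q)
      ((\<pi> \<circ> p') +++ (\<pi> \<circ> m) +++ (\<pi> \<circ> q'))"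
    using p(4) q(3) by (intro homotopic_paths_join) (auto simp: pathstart_compose pathfinish_compose)
  then have "\<alpha> = loop_class M (\<pi> \<circ> (p' +++ m +++ q'))"
    unfolding \<alpha> by (simp add: path_compose_join loop_class_eq)
  moreover have "deck_class \<pi> M x \<gamma> = loop_class M (\<pi> \<circ> (p' +++ m +++ q'))"
    using p' q' m \<gamma>(2) cs
    by (intro deck_class_eq) (auto simp: path_image_join intro!: subset_path_image_join)
  ultimately show ?thesis using that j(3) lift by metis
qed

end

section \<open>Peripheral lifts commute\<close>

lemma PSL2_inv_mem:
  assumes "P \<in> carrier PSL2" "u \<in> P"
  shows "matrix_inv u \<in> inv\<^bsub>PSL2\<^esub> P"
proof -
  have u: "det u = 1" "P = {u, - u}" using PSL2_memD assms by blast+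
  have Q: "{matrix_inv u, - matrix_inv u} \<in> carrier PSL2"
    using u(1) matrix_inv_cancel(3) by (auto simp: carrier_PSL2)
  have "{matrix_inv u, - matrix_inv u} \<otimes>\<^bsub>PSL2\<^esub> P = \<one>\<^bsub>PSL2\<^esub>"
  proof -
    have "mat 1 \<in> {matrix_inv u, - matrix_inv u} \<otimes>\<^bsub>PSL2\<^esub> P"
      using assms(2) matrix_inv_cancel(2)[OF u(1)] unfolding mult_PSL2 by force
    moreover have "{matrix_inv u, - matrix_inv u} \<otimes>\<^bsub>PSL2\<^esub> P \<in> carrier PSL2"
      using Q assms(1) group_PSL2 by (simp add: group.is_monoid monoid.m_closed)
    ultimately show ?thesis using PSL2_memD(2) one_PSL2 by metis
  qed
  then have "inv\<^bsub>PSL2\<^esub> P = {matrix_inv u, - matrix_inv u}"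
    using group.inv_equality[OF group_PSL2 _ assms(1) Q] by blast
  then show ?thesis by simp
qed

lemma trace_eq_0_of_anticommute:
  assumes "det (B :: mat2) = 1" "A ** B = - (B ** A)" shows "trace A = 0"
proof -
  have "matrix_inv B ** (A ** B) = - A"
    unfolding assms(2) using assms(1)
    by (simp add: matrix_mult_uminus(2) matrix_mul_assoc matrix_inv_cancel)
  then have "- trace A = trace (A ** B ** matrix_inv B)"
    by (metis trace_mul_sym trace_uminus)
  also have "\<dots> = trace A"
    using assms(1) by (simp add: matrix_inv_cancel flip: matrix_mul_assoc)
  finally show ?thesis by simp
qed

lemma commute_inv:
  assumes "det (u :: mat2) = 1" "u ** Z = Z ** u" shows "matrix_inv u ** Z = Z ** matrix_inv u"
proof -
  have "matrix_inv u ** Z = matrix_inv u ** (Z ** u) ** matrix_inv u"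
    using assms(1) by (simp add: matrix_inv_cancel flip: matrix_mul_assoc)
  also have "\<dots> = matrix_inv u ** u ** Z ** matrix_inv u"
    unfolding assms(2)[symmetric] by (simp only: matrix_mul_assoc)
  finally show ?thesis using assms(1) by (simp add: matrix_inv_cancel)
qed

lemma generated_lifts_commute:
  assumes G: "group G" and \<rho>: "\<rho> \<in> hom G PSL2" and S: "S \<subseteq> carrier G"
    and comm: "\<And>s u. s \<in> S \<Longrightarrow> u \<in> \<rho> s \<Longrightarrow> u ** Z = Z ** u"
    and "w \<in> generate G S" "v \<in> \<rho> w"
  shows "v ** Z = Z ** v"
proof -
  interpret group_hom G PSL2 \<rho>
    using G \<rho> group_PSL2 by (simp add: group_hom_def group_hom_axioms_def)
  have neg: "u ** Z = Z ** u \<longleftrightarrow> (- u) ** Z = Z ** (- u)" for u :: mat2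
    by (simp add: matrix_mult_uminus)
  have cover: "v ** Z = Z ** v" if "P \<in> carrier PSL2" "u \<in> P" "v \<in> P" "u ** Z = Z ** u" for P u v
    using PSL2_memD(2)[OF that(1,2)] that(3,4) neg[of u] by auto
  show ?thesis using assms(5,6)
  proof (induction arbitrary: v)
    case one
    then show ?case by (auto simp: one_PSL2 matrix_mult_uminus)
  next
    case (incl s)
    then show ?case using comm by blast
  next
    case (inv s)
    then have s: "s \<in> carrier G" using S by blast
    then obtain u where u: "u \<in> \<rho> s" using PSL2_nonempty hom_closed by blast
    have "matrix_inv u \<in> \<rho> (inv\<^bsub>G\<^esub> s)" using PSL2_inv_mem[OF hom_closed[OF s] u] s by simp
    moreover have "matrix_inv u ** Z = Z ** matrix_inv u"
      using commute_inv comm[OF inv(1) u] PSL2_memD(1)[OF hom_closed[OF s] u] by blast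
    ultimately show ?case using cover inv(2) hom_closed s by (metis G group.inv_closed)
  next
    case (eng s t)
    have st: "s \<in> carrier G" "t \<in> carrier G"
      using eng.hyps group.generate_in_carrier[OF G S] by blast+
    then have "v \<in> \<rho> s \<otimes>\<^bsub>PSL2\<^esub> \<rho> t" using eng.prems by simp
    then obtain a b where ab: "a \<in> \<rho> s" "b \<in> \<rho> t" "v = a ** b" by (auto simp: mult_PSL2)
    have "a ** b ** Z = a ** (Z ** b)" using eng.IH(2)[OF ab(2)] by (simp flip: matrix_mul_assoc)
    also have "\<dots> = Z ** a ** b" using eng.IH(1)[OF ab(1)] by (simp add: matrix_mul_assoc)
    finally show ?case by (simp add: ab(3) matrix_mul_assoc)
  qed
qed

text \<open>In \<open>PSL2\<close> commuting elements have lifts which commute or anticommute; the latter forces all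
  three traces to vanish.\<close>

lemma commuting_lifts:
  assumes P: "P \<in> carrier PSL2" "Q \<in> carrier PSL2" "P \<otimes>\<^bsub>PSL2\<^esub> Q = Q \<otimes>\<^bsub>PSL2\<^esub> P"
    and tr: "\<not> (psl_trace_sq P = 0 \<and> psl_trace_sq Q = 0 \<and> psl_trace_sq (P \<otimes>\<^bsub>PSL2\<^esub> Q) = 0)"
    and u: "u \<in> P" and v: "v \<in> Q"
  shows "u ** v = v ** u"
proof (rule ccontr)
  assume ne: "u ** v \<noteq> v ** u"
  have PQ: "P \<otimes>\<^bsub>PSL2\<^esub> Q \<in> carrier PSL2"
    using P group_PSL2 by (simp add: group.is_monoid monoid.m_closed)
  have uv: "u ** v \<in> P \<otimes>\<^bsub>PSL2\<^esub> Q" using u v by (auto simp: mult_PSL2)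
  have "v ** u \<in> P \<otimes>\<^bsub>PSL2\<^esub> Q" unfolding P(3) using u v by (auto simp: mult_PSL2)
  then have anti: "u ** v = - (v ** u)" using PSL2_memD(2)[OF PQ uv] ne by auto
  have d: "det u = 1" "det v = 1" using PSL2_memD(1) P u v by blast+
  have "trace u = 0" using trace_eq_0_of_anticommute[OF d(2) anti] .
  moreover have "v ** u = - (u ** v)" using anti by simp
  then have "trace v = 0" using trace_eq_0_of_anticommute[OF d(1)] by blast
  moreover have "trace (u ** v) = - trace (u ** v)"
    using anti trace_mul_sym[of u v] by (metis trace_uminus)
  then have "trace (u ** v) = 0" by simp
  ultimately show False
    using tr psl_trace_sq_eq[OF P(1) u] psl_trace_sq_eq[OF P(2) v] psl_trace_sq_eq[OF PQ uv] by simp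
qed

section \<open>The ortholength invariant\<close>

context cusped_quotient
begin

abbreviation \<pi>\<^sub>1 :: "(real \<Rightarrow> 'm) set monoid" where "\<pi>\<^sub>1 \<equiv> fundamental_group M (\<pi> x)"
abbreviation deck :: "mat2 set \<Rightarrow> (real \<Rightarrow> 'm) set" where "deck \<equiv> deck_class \<pi> M x"
abbreviation peripheral :: "(real \<Rightarrow> 'm) set set" where
  "peripheral \<equiv> subspace_loops M (\<pi> ` horosphere A) (\<pi> x)"

lemma stabilizer_in: "\<zeta> \<in> cusp_stabilizer \<Longrightarrow> \<zeta> \<in> \<Gamma>"
  by (simp add: cusp_stabilizer_def)

lemma peripheral_carrier: "peripheral \<subseteq> carrier \<pi>\<^sub>1"
  unfolding peripheral_eq using deck_class_carrier[OF base_H3] stabilizer_in by blast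

lemma peripheral_commute:
  assumes "a \<in> peripheral" "b \<in> peripheral" shows "a \<otimes>\<^bsub>\<pi>\<^sub>1\<^esub> b = b \<otimes>\<^bsub>\<pi>\<^sub>1\<^esub> a"
proof -
  obtain \<gamma> \<eta> where "\<gamma> \<in> cusp_stabilizer" "\<eta> \<in> cusp_stabilizer" "a = deck \<gamma>" "b = deck \<eta>"
    using assms unfolding peripheral_eq by blast
  then show ?thesis
    using deck_class_mult[OF base_H3] cusp_stabilizer_commute stabilizer_in by metis
qed

lemma group_\<pi>\<^sub>1: "group \<pi>\<^sub>1"
  by (rule group_fundamental_group[OF base_H3])

lemma peripheral_lifts_commute:
  assumes \<rho>: "\<rho> \<in> hom \<pi>\<^sub>1 PSL2"
    and ml: "m \<in> peripheral" "l \<in> peripheral" "generate \<pi>\<^sub>1 {m, l} = peripheral"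
    and tr: "\<not> (psl_trace_sq (\<rho> m) = 0 \<and> psl_trace_sq (\<rho> l) = 0 \<and> psl_trace_sq (\<rho> (m \<otimes>\<^bsub>\<pi>\<^sub>1\<^esub> l)) = 0)"
    and a: "a \<in> peripheral" "u \<in> \<rho> a" and b: "b \<in> peripheral" "v \<in> \<rho> b"
  shows "u ** v = v ** u"
proof -
  have c: "m \<in> carrier \<pi>\<^sub>1" "l \<in> carrier \<pi>\<^sub>1" using ml peripheral_carrier by blast+
  have cl: "\<rho> m \<in> carrier PSL2" "\<rho> l \<in> carrier PSL2" using \<rho> c by (auto simp: hom_def)
  have hom: "\<rho> (m \<otimes>\<^bsub>\<pi>\<^sub>1\<^esub> l) = \<rho> m \<otimes>\<^bsub>PSL2\<^esub> \<rho> l" "\<rho> (l \<otimes>\<^bsub>\<pi>\<^sub>1\<^esub> m) = \<rho> l \<otimes>\<^bsub>PSL2\<^esub> \<rho> m"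
    using \<rho> c by (auto simp: hom_def)
  have "\<rho> m \<otimes>\<^bsub>PSL2\<^esub> \<rho> l = \<rho> l \<otimes>\<^bsub>PSL2\<^esub> \<rho> m"
    using peripheral_commute[OF ml(1,2)] hom by simp
  then have mixed: "p ** q = q ** p" if "p \<in> \<rho> m" "q \<in> \<rho> l" for p q
    using commuting_lifts[OF cl _ tr[unfolded hom]] that by blast
  have same: "p ** q = q ** p" if "P \<in> carrier PSL2" "p \<in> P" "q \<in> P" for P p q
    using PSL2_memD(2)[OF that(1,2)] that(3) by (auto simp: matrix_mult_uminus)
  have gens: "p ** q = q ** p" if "s \<in> {m, l}" "t \<in> {m, l}" "p \<in> \<rho> s" "q \<in> \<rho> t" for s t p q
    using that mixed mixed[symmetric] same cl by auto
  have ml_sub: "{m, l} \<subseteq> carrier \<pi>\<^sub>1" using c by simp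
  have half: "p ** q = q ** p" if "s \<in> peripheral" "p \<in> \<rho> s" "t \<in> {m, l}" "q \<in> \<rho> t" for s t p q
    using generated_lifts_commute[OF group_\<pi>\<^sub>1 \<rho> ml_sub, of q s p] gens that ml(3) by blast
  show ?thesis
    using generated_lifts_commute[OF group_\<pi>\<^sub>1 \<rho> ml_sub, of v a u] half[OF b(1,2), symmetric] a ml(3) by blast
qed

definition translate_line :: "((real \<Rightarrow> 'm) set \<Rightarrow> mat2 set) \<Rightarrow> mat2 set \<Rightarrow> mat2 \<Rightarrow> mat2" where
  "translate_line \<rho> \<gamma> \<sigma> = psl_line_act (\<rho> (deck \<gamma>)) \<sigma>"

lemma deck_PSL2: "\<rho> \<in> hom \<pi>\<^sub>1 PSL2 \<Longrightarrow> \<gamma> \<in> \<Gamma> \<Longrightarrow> \<rho> (deck \<gamma>) \<in> carrier PSL2"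
  using deck_class_carrier[OF base_H3] by (auto simp: hom_def)

lemma translate_line_mult:
  assumes "\<rho> \<in> hom \<pi>\<^sub>1 PSL2" "\<gamma> \<in> \<Gamma>" "\<eta> \<in> \<Gamma>"
  shows "translate_line \<rho> (\<gamma> \<otimes>\<^bsub>PSL2\<^esub> \<eta>) \<sigma> = translate_line \<rho> \<gamma> (translate_line \<rho> \<eta> \<sigma>)"
proof -
  have "\<rho> (deck (\<gamma> \<otimes>\<^bsub>PSL2\<^esub> \<eta>)) = \<rho> (deck \<gamma>) \<otimes>\<^bsub>PSL2\<^esub> \<rho> (deck \<eta>)"
    using assms deck_class_mult[OF base_H3] deck_class_carrier[OF base_H3] by (auto simp: hom_def)
  then show ?thesis using psl_line_act_mult deck_PSL2 assms by (simp add: translate_line_def)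
qed

lemma translate_line_ex:
  assumes "\<rho> \<in> hom \<pi>\<^sub>1 PSL2" "\<gamma> \<in> \<Gamma>"
  obtains g where "det g = 1" "translate_line \<rho> \<gamma> = line_act g"
proof -
  obtain g where "g \<in> \<rho> (deck \<gamma>)" using PSL2_nonempty deck_PSL2 assms by blast
  then have "det g = 1" "\<And>l. translate_line \<rho> \<gamma> l = line_act g l"
    using PSL2_memD(1) psl_line_act_eq deck_PSL2 assms unfolding translate_line_def by metis+
  then show ?thesis using that by blast
qed

lemma translate_line_one:
  assumes "\<rho> \<in> hom \<pi>\<^sub>1 PSL2" shows "translate_line \<rho> \<one>\<^bsub>PSL2\<^esub> \<sigma> = \<sigma>"
proof -
  have "\<rho> (deck \<one>\<^bsub>PSL2\<^esub>) = \<one>\<^bsub>PSL2\<^esub>"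
    using hom_one[OF assms group_\<pi>\<^sub>1 group_PSL2] deck_class_one[OF base_H3] by simp
  then show ?thesis
    using psl_line_act_eq[of "\<one>\<^bsub>PSL2\<^esub>" "mat 1" \<sigma>] group.is_monoid[OF group_PSL2]
    by (simp add: translate_line_def line_act_one monoid.one_closed) (simp add: one_PSL2)
qed

lemma edge_lift_pairing_unique:
  assumes K: "ideal_triangulation M K" and \<rho>: "\<rho> \<in> hom \<pi>\<^sub>1 PSL2"
    and fixed: "\<And>\<zeta>. \<zeta> \<in> cusp_stabilizer \<Longrightarrow> translate_line \<rho> \<zeta> \<sigma> = \<sigma>"
    and 1: "edge_lift K j a b c \<gamma>1 \<gamma>2" and 2: "edge_lift K j' a' b' c' \<gamma>1' \<gamma>2'"
    and eq: "edge_between K j a b = edge_between K j' a' b'"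
  shows "trace (translate_line \<rho> \<gamma>1 \<sigma> ** translate_line \<rho> \<gamma>2 \<sigma>) =
    trace (translate_line \<rho> \<gamma>1' \<sigma> ** translate_line \<rho> \<gamma>2' \<sigma>)"
proof -
  have same: "trace (translate_line \<rho> \<gamma>1 \<sigma> ** translate_line \<rho> \<gamma>2 \<sigma>) =
    trace (translate_line \<rho> \<gamma>1' \<sigma> ** translate_line \<rho> \<gamma>2' \<sigma>)" if 2: "edge_lift K j' a' b' c' \<gamma>1' \<gamma>2'"
    and eq: "\<And>s. s \<in> {0<..<1} \<Longrightarrow> edge_path K j a b s = edge_path K j' a' b' s" for a' b' c' \<gamma>1' \<gamma>2'
  proof -
    obtain \<eta> \<zeta>1 \<zeta>2 where h: "\<eta> \<in> \<Gamma>" "\<zeta>1 \<in> cusp_stabilizer" "\<zeta>2 \<in> cusp_stabilizer"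
      "\<gamma>1' = \<eta> \<otimes>\<^bsub>PSL2\<^esub> \<gamma>1 \<otimes>\<^bsub>PSL2\<^esub> \<zeta>1" "\<gamma>2' = \<eta> \<otimes>\<^bsub>PSL2\<^esub> \<gamma>2 \<otimes>\<^bsub>PSL2\<^esub> \<zeta>2"
      using edge_lift_unique_same[OF 1 2 eq] by metis
    have \<gamma>: "\<gamma>1 \<in> \<Gamma>" "\<gamma>2 \<in> \<Gamma>" using 1 by (auto simp: edge_lift_def)
    have "translate_line \<rho> \<gamma>1' \<sigma> = translate_line \<rho> \<eta> (translate_line \<rho> \<gamma>1 \<sigma>)"
      "translate_line \<rho> \<gamma>2' \<sigma> = translate_line \<rho> \<eta> (translate_line \<rho> \<gamma>2 \<sigma>)"
      unfolding h(4,5) using h(1-3) \<gamma> mult_closed stabilizer_in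
      by (simp_all add: translate_line_mult[OF \<rho>] fixed)
    moreover obtain g where "det g = 1" "translate_line \<rho> \<eta> = line_act g"
      using translate_line_ex[OF \<rho> h(1)] .
    ultimately show ?thesis by (simp add: trace_line_act)
  qed
  have jab: "j < fst K" "a \<noteq> b" "j' < fst K" "a' \<noteq> b'" using 1 2 by (auto simp: edge_lift_def)
  consider "\<And>s. s \<in> {0<..<1} \<Longrightarrow> edge_path K j a b s = edge_path K j' a' b' s"
    | "\<And>s. s \<in> {0<..<1} \<Longrightarrow> edge_path K j a b s = edge_path K j' b' a' s"
    using edge_between_eqD[OF K jab(1,3,2,4) eq] by (auto simp: edge_path_eq edge_point_swap[of b' a'])
  then show ?thesis
  proof cases
    case 1
    then show ?thesis using same[OF 2] by blast
  next
    case rev: 2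
    show ?thesis
      using same[OF edge_lift_reverse[OF 2] rev]
        trace_mul_sym[of "translate_line \<rho> \<gamma>1' \<sigma>" "translate_line \<rho> \<gamma>2' \<sigma>"] by simp
  qed
qed

lemma cusp_preimage_component: "connected_component_set {y \<in> H3. \<pi> y \<in> \<pi> ` horoball A} x = horoball A"
  using cusp_component[OF base_horoball] by (simp add: cusp_preimage_def)

lemma is_ortho_cosh_iff:
  "is_ortho_cosh \<Gamma> \<pi> M (\<pi> ` horoball A) (\<pi> ` horosphere A) x K \<rho> E w \<longleftrightarrow>
    (\<exists>\<sigma> j a b c \<gamma>1 \<gamma>2 \<delta>. \<sigma> \<in> oriented_lines \<and>
      {line_start \<sigma>, line_end \<sigma>} = {p \<in> CP1. \<forall>g\<in>peripheral. psl_CP1_act (\<rho> g) p = p} \<and>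
      edge_between K j a b = E \<and> edge_lift K j a b c \<gamma>1 \<gamma>2 \<and>
      is_complex_distance (translate_line \<rho> \<gamma>1 \<sigma>) (translate_line \<rho> \<gamma>2 \<sigma>) \<delta> \<and> w = cosh \<delta>)"
  unfolding is_ortho_cosh_def cusp_preimage_component Let_def edge_lift_def translate_line_def
  by (simp only: conj_assoc conj_left_commute conj_commute) 

lemma ortho_cosh_eq:
  assumes K: "ideal_triangulation M K" and \<rho>: "\<rho> \<in> hom \<pi>\<^sub>1 PSL2"
    and \<sigma>: "\<sigma> \<in> oriented_lines"
    and ends: "{line_start \<sigma>, line_end \<sigma>} = {p \<in> CP1. \<forall>g\<in>peripheral. psl_CP1_act (\<rho> g) p = p}"
    and unique: "\<And>\<tau>. \<tau> \<in> oriented_lines \<Longrightarrow> {line_start \<tau>, line_end \<tau>} = {line_start \<sigma>, line_end \<sigma>} \<Longrightarrow> \<tau> = \<sigma> \<or> \<tau> = - \<sigma>"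
    and fixed: "\<And>\<zeta>. \<zeta> \<in> cusp_stabilizer \<Longrightarrow> translate_line \<rho> \<zeta> \<sigma> = \<sigma>"
    and lift: "edge_lift K j a b c \<gamma>1 \<gamma>2"
  shows "(THE w. is_ortho_cosh \<Gamma> \<pi> M (\<pi> ` horoball A) (\<pi> ` horosphere A) x K \<rho> (edge_between K j a b) w)
    = - trace (translate_line \<rho> \<gamma>1 \<sigma> ** translate_line \<rho> \<gamma>2 \<sigma>) / 2" (is "_ = ?v")
proof (rule the_equality)
  have lines: "translate_line \<rho> \<gamma> \<tau> \<in> oriented_lines" if "\<gamma> \<in> \<Gamma>" "\<tau> \<in> oriented_lines" for \<gamma> \<tau>
    using translate_line_ex[OF \<rho> that(1)] line_act_in_lines that(2) by metis
  have \<gamma>: "\<gamma>1 \<in> \<Gamma>" "\<gamma>2 \<in> \<Gamma>" using lift by (auto simp: edge_lift_def)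
  obtain \<delta> where \<delta>: "is_complex_distance (translate_line \<rho> \<gamma>1 \<sigma>) (translate_line \<rho> \<gamma>2 \<sigma>) \<delta>"
    using complex_distance_exists lines \<gamma> \<sigma> by metis
  have "cosh \<delta> = ?v" using is_complex_distance_cosh[OF _ _ \<delta>] lines \<gamma> \<sigma> by blast
  then show "is_ortho_cosh \<Gamma> \<pi> M (\<pi> ` horoball A) (\<pi> ` horosphere A) x K \<rho> (edge_between K j a b) ?v"
    unfolding is_ortho_cosh_iff using \<sigma> ends lift \<delta> by metis
next
  have lines: "translate_line \<rho> \<gamma> \<tau> \<in> oriented_lines" if "\<gamma> \<in> \<Gamma>" "\<tau> \<in> oriented_lines" for \<gamma> \<tau>
    using translate_line_ex[OF \<rho> that(1)] line_act_in_lines that(2) by metis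
  fix w assume "is_ortho_cosh \<Gamma> \<pi> M (\<pi> ` horoball A) (\<pi> ` horosphere A) x K \<rho> (edge_between K j a b) w"
  then obtain \<tau> j' a' b' c' \<gamma>1' \<gamma>2' \<delta> where \<tau>: "\<tau> \<in> oriented_lines"
    and ends': "{line_start \<tau>, line_end \<tau>} = {p \<in> CP1. \<forall>g\<in>peripheral. psl_CP1_act (\<rho> g) p = p}"
    and e: "edge_between K j' a' b' = edge_between K j a b" and lift': "edge_lift K j' a' b' c' \<gamma>1' \<gamma>2'"
    and \<delta>: "is_complex_distance (translate_line \<rho> \<gamma>1' \<tau>) (translate_line \<rho> \<gamma>2' \<tau>) \<delta>" "w = cosh \<delta>"
    unfolding is_ortho_cosh_iff by blast
  have \<gamma>': "\<gamma>1' \<in> \<Gamma>" "\<gamma>2' \<in> \<Gamma>" using lift' by (auto simp: edge_lift_def)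
  have "translate_line \<rho> \<gamma> (- \<sigma>) = - translate_line \<rho> \<gamma> \<sigma>" if "\<gamma> \<in> \<Gamma>" for \<gamma>
    using translate_line_ex[OF \<rho> that] line_act_uminus by metis
  then have "trace (translate_line \<rho> \<gamma>1' \<tau> ** translate_line \<rho> \<gamma>2' \<tau>)
      = trace (translate_line \<rho> \<gamma>1' \<sigma> ** translate_line \<rho> \<gamma>2' \<sigma>)"
    using unique[OF \<tau>] ends ends' \<gamma>' by (auto simp: matrix_mult_uminus)
  also have "\<dots> = trace (translate_line \<rho> \<gamma>1 \<sigma> ** translate_line \<rho> \<gamma>2 \<sigma>)"
    by (rule edge_lift_pairing_unique[OF K \<rho> fixed lift' lift e])
  finally show "w = ?v"
    using is_complex_distance_cosh[OF _ _ \<delta>(1)] lines \<gamma>' \<tau> \<delta>(2) by simp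
qed

end

lemma commute_scalar_plus:
  assumes "k \<noteq> 0" "u ** (mat a + mat k ** l) = (mat a + mat k ** l) ** (u :: mat2)"
  shows "u ** l = l ** u"
proof -
  have "mat k ** (u ** l) = mat k ** (l ** u)"
    using assms(2) by (simp add: mat2_simps algebra_simps)
  then show ?thesis using assms(1) by (simp add: mat2_simps)
qed

theorem proposition12:
  fixes M :: "'m::topological_space set"
    and \<Gamma> :: "mat2 set set"
    and \<pi> :: "complex \<times> real \<Rightarrow> 'm"
    and A :: mat2
    and x :: "complex \<times> real"
    and K :: "'m ideal_cells"
    and e :: "'n::finite \<Rightarrow> 'm set"
    and \<rho> :: "(real \<Rightarrow> 'm) set \<Rightarrow> mat2 set"
    and m l \<beta> :: "(real \<Rightarrow> 'm) set"
    and \<alpha> :: "'n \<Rightarrow> (real \<Rightarrow> 'm) set"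
    and h :: mat2
    and g :: "'n \<Rightarrow> mat2"
  defines "N \<equiv> \<pi> ` horoball A"
    and "dN \<equiv> \<pi> ` horosphere A"
  defines "G \<equiv> fundamental_group M (\<pi> x)"
    and "P \<equiv> subspace_loops M dN (\<pi> x)"
  assumes "hyperbolic_3_manifold \<Gamma> \<pi> M" and "finite_covolume \<Gamma>" and "one_cusped \<Gamma>"
    and "cusp_horoball \<Gamma> A" and "x \<in> horosphere A"
    and "ideal_triangulation M K" and "meets_nicely K N" and "bij_betw e UNIV (edges K)"
    and "\<rho> \<in> hom G PSL2"
    and "m \<in> P" and "l \<in> P" and "generate G {m, l} = P"
    and "\<not> (psl_trace_sq (\<rho> m) = 4 \<and> psl_trace_sq (\<rho> l) = 4)"
    and "\<not> (psl_trace_sq (\<rho> m) = 0 \<and> psl_trace_sq (\<rho> l) = 0 \<and>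
            psl_trace_sq (\<rho> (m \<otimes>\<^bsub>G\<^esub> l)) = 0)"
    and "\<beta> \<in> P" and "\<beta> \<noteq> \<one>\<^bsub>G\<^esub>"
    and "\<And>i. edge_generator M K N dN (\<pi> x) (e i) (\<alpha> i)"
    and "h \<in> \<rho> \<beta>" and "\<And>i. g i \<in> \<rho> (\<alpha> i)"
    and "(trace h)\<^sup>2 \<noteq> 4"
  shows "Orth \<Gamma> \<pi> M N dN x K e \<rho> \<in> ortholength_space K e \<and>
    (\<forall>i. Orth \<Gamma> \<pi> M N dN x K e \<rho> $ i =
       2 * ((trace (h ** g i) * trace (matrix_inv h ** g i) - (trace (g i))\<^sup>2) /
            ((trace h)\<^sup>2 - 4)) - 1)"
proof -
  interpret cusped_quotient \<Gamma> \<pi> M A x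
    using assms(5,8,9) by unfold_locales
  note K = \<open>ideal_triangulation M K\<close>
  have \<rho>: "\<rho> \<in> hom \<pi>\<^sub>1 PSL2" using \<open>\<rho> \<in> hom G PSL2\<close> by (simp add: G_def)
  have P: "P = peripheral" by (simp add: P_def dN_def)
  have carrier: "\<rho> a \<in> carrier PSL2" if "a \<in> P" for a
    using \<rho> that peripheral_carrier by (auto simp: P hom_def)
  have comm: "u ** v = v ** u" if "a \<in> P" "u \<in> \<rho> a" "b \<in> P" "v \<in> \<rho> b" for a b u v
    using peripheral_lifts_commute[OF \<rho>, of m l] assms(14-16,18) that unfolding P G_def by blast
  have det_h: "det h = 1" using PSL2_memD(1)[OF carrier] assms by blast
  obtain \<sigma> k where \<sigma>: "\<sigma> \<in> oriented_lines" and k: "k \<noteq> 0" and h: "h = mat (trace h / 2) + mat k ** \<sigma>"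
    using line_of_matrix[OF det_h \<open>(trace h)\<^sup>2 \<noteq> 4\<close>] .
  have h\<sigma>: "h ** \<sigma> = \<sigma> ** h" by (subst (1 2) h) (rule scalar_plus_line_commute)
  have comm\<sigma>: "u ** \<sigma> = \<sigma> ** u" if "a \<in> P" "u \<in> \<rho> a" for a u
    using commute_scalar_plus[OF k, of u "trace h / 2" \<sigma>] comm[OF that \<open>\<beta> \<in> P\<close> \<open>h \<in> \<rho> \<beta>\<close>] h by simp
  have ends: "{line_start \<sigma>, line_end \<sigma>} = {p \<in> CP1. \<forall>g\<in>peripheral. psl_CP1_act (\<rho> g) p = p}"
  proof (intro equalityI subsetI)
    fix p assume p: "p \<in> {line_start \<sigma>, line_end \<sigma>}"
    then have "p \<in> CP1" using line_start_CP1 line_end_CP1 \<sigma> by blast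
    moreover have "psl_CP1_act (\<rho> a) p = p" if a: "a \<in> peripheral" for a
    proof -
      obtain u where u: "u \<in> \<rho> a" using PSL2_nonempty carrier a P by blast
      have "det u = 1" using PSL2_memD(1) carrier a P u by blast
      then have "CP1_act u p = p" using fixes_ends_iff[OF \<sigma>, of u] comm\<sigma>[OF _ u] a P p by blast
      then show ?thesis using psl_CP1_act_eq carrier a P u \<open>p \<in> CP1\<close> by metis
    qed
    ultimately show "p \<in> {p \<in> CP1. \<forall>g\<in>peripheral. psl_CP1_act (\<rho> g) p = p}" by blast
  next
    fix p assume p: "p \<in> {p \<in> CP1. \<forall>g\<in>peripheral. psl_CP1_act (\<rho> g) p = p}"
    then have "CP1_act h p = p"
      using psl_CP1_act_eq[OF carrier[OF \<open>\<beta> \<in> P\<close>] \<open>h \<in> \<rho> \<beta>\<close>, of p] \<open>\<beta> \<in> P\<close> P by simp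
    then show "p \<in> {line_start \<sigma>, line_end \<sigma>}"
      using fixed_points_scalar_plus_line[OF \<sigma> h det_h k] p by blast
  qed
  have unique: "\<tau> = \<sigma> \<or> \<tau> = - \<sigma>"
    if \<tau>: "\<tau> \<in> oriented_lines" "{line_start \<tau>, line_end \<tau>} = {line_start \<sigma>, line_end \<sigma>}" for \<tau>
  proof -
    have "CP1_act h (line_start \<sigma>) = line_start \<sigma> \<and> CP1_act h (line_end \<sigma>) = line_end \<sigma>"
      using fixes_ends_iff[OF \<sigma> det_h] h\<sigma> by blast
    then have "CP1_act h (line_start \<tau>) = line_start \<tau> \<and> CP1_act h (line_end \<tau>) = line_end \<tau>"
      using \<tau>(2) by (auto simp: doubleton_eq_iff)
    then have "h ** \<tau> = \<tau> ** h" using fixes_ends_iff[OF \<tau>(1) det_h] by blast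
    then show ?thesis using commuting_lines_unique[OF det_h \<open>(trace h)\<^sup>2 \<noteq> 4\<close> \<sigma> h\<sigma> \<tau>(1)] by blast
  qed
  have fixed: "translate_line \<rho> \<zeta> \<sigma> = \<sigma>" if \<zeta>: "\<zeta> \<in> cusp_stabilizer" for \<zeta>
  proof -
    have d: "deck \<zeta> \<in> P" using \<zeta> by (simp add: P peripheral_eq)
    then obtain u where u: "u \<in> \<rho> (deck \<zeta>)" using PSL2_nonempty carrier by blast
    have "line_act u \<sigma> = \<sigma>" using line_act_eq_iff PSL2_memD(1)[OF carrier[OF d] u] comm\<sigma>[OF d u] by blast
    then show ?thesis using psl_line_act_eq[OF carrier[OF d] u] by (simp add: translate_line_def)
  qed
  have Orth: "Orth \<Gamma> \<pi> M N dN x K e \<rho> $ i = - trace (translate_line \<rho> \<gamma>1 \<sigma> ** translate_line \<rho> \<gamma>2 \<sigma>) / 2"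
    if "e i = edge_between K j a b" "edge_lift K j a b c \<gamma>1 \<gamma>2" for i j a b c \<gamma>1 \<gamma>2
  proof -
    have "(THE w. is_ortho_cosh \<Gamma> \<pi> M (\<pi> ` horoball A) (\<pi> ` horosphere A) x K \<rho> (edge_between K j a b) w)
        = - trace (translate_line \<rho> \<gamma>1 \<sigma> ** translate_line \<rho> \<gamma>2 \<sigma>) / 2"
      by (rule ortho_cosh_eq[OF K \<rho> \<sigma> ends]) (use unique fixed that(2) in blast)+
    then show ?thesis using that(1) by (simp add: Orth_def N_def dN_def)
  qed
  show ?thesis
  proof
    show "Orth \<Gamma> \<pi> M N dN x K e \<rho> \<in> ortholength_space K e"
      unfolding ortholength_space_def mem_Collect_eq
    proof (intro allI impI)
      fix j assume j: "j < fst K"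
      obtain \<gamma> :: "4 \<Rightarrow> mat2 set" where \<gamma>: "\<And>a. \<gamma> a \<in> \<Gamma>"
        "\<And>a b. a \<noteq> b \<Longrightarrow> \<exists>c. edge_lift K j a b c (\<gamma> a) (\<gamma> b)"
        using simplex_edge_lifts[OF K _ j] \<open>meets_nicely K N\<close> unfolding N_def by metis
      define L where "L a = translate_line \<rho> (\<gamma> a) \<sigma>" for a
      have L: "L a \<in> oriented_lines" for a
        using translate_line_ex[OF \<rho> \<gamma>(1)] line_act_in_lines \<sigma> unfolding L_def by metis
      have "(if a = b then 1 else Orth \<Gamma> \<pi> M N dN x K e \<rho> $ (THE i. e i = edge_between K j a b))
          = - trace (L a ** L b) / 2" for a b
      proof (cases "a = b")
        case True
        then show ?thesis by (simp add: line_square[OF L]) (simp add: mat2_simps)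
      next
        case False
        have "edge_between K j a b \<in> edges K" using j False by (auto simp: edges_def)
        then obtain i where i: "e i = edge_between K j a b"
          using \<open>bij_betw e UNIV (edges K)\<close> by (metis bij_betw_imp_surj_on imageE)
        moreover have "inj e" using \<open>bij_betw e UNIV (edges K)\<close> by (rule bij_betw_imp_inj_on)
        ultimately have "(THE i. e i = edge_between K j a b) = i"
          by (metis (mono_tags, lifting) injD the_equality)
        then show ?thesis using Orth[OF i] \<gamma>(2)[OF False] False by (auto simp: L_def)
      qed
      then show "det (\<chi> a b. if a = b then 1 else Orth \<Gamma> \<pi> M N dN x K e \<rho> $
          (THE i. e i = edge_between K j a b) :: complex^4^4) = 0"
        using gram_det_eq_0[of L] L by (simp add: oriented_lines_def)
    qed
    show "\<forall>i. Orth \<Gamma> \<pi> M N dN x K e \<rho> $ i =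
       2 * ((trace (h ** g i) * trace (matrix_inv h ** g i) - (trace (g i))\<^sup>2) /
            ((trace h)\<^sup>2 - 4)) - 1"
    proof
      fix i
      obtain j a b c \<gamma> where lift: "edge_between K j a b = e i" "edge_lift K j a b c \<one>\<^bsub>PSL2\<^esub> \<gamma>"
        "\<alpha> i = deck \<gamma>"
        using edge_generator_lift[OF K] assms(21)[of i] unfolding N_def dN_def by metis
      have \<gamma>: "\<rho> (deck \<gamma>) \<in> carrier PSL2" using lift(2) deck_PSL2[OF \<rho>] by (simp add: edge_lift_def)
      have gi: "g i \<in> \<rho> (deck \<gamma>)" using assms(23)[of i] lift(3) by simp
      have "translate_line \<rho> \<gamma> \<sigma> = line_act (g i) \<sigma>"
        using psl_line_act_eq[OF \<gamma> gi] by (simp add: translate_line_def)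
      then show "Orth \<Gamma> \<pi> M N dN x K e \<rho> $ i =
          2 * ((trace (h ** g i) * trace (matrix_inv h ** g i) - (trace (g i))\<^sup>2) /
            ((trace h)\<^sup>2 - 4)) - 1"
        using Orth[OF lift(1)[symmetric] lift(2)] translate_line_one[OF \<rho>]
          ortholength_trace_formula[OF det_h \<open>(trace h)\<^sup>2 \<noteq> 4\<close> \<sigma> h\<sigma> PSL2_memD(1)[OF \<gamma> gi]] by simp
    qed
  qed
qed

end
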